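(* Let $\mathcal G\in\mathbf G$ be a metric graph with edge set $\mathcal E$ and vertex set $\mathcal V$, and let $p>2$. Let $W\in L^\infty(\mathcal G)$ and $\rho\in L^\infty(\mathcal G)\setminus\{0\}$ be such that there exists $a>0$ for which, for every $e\in\mathcal E$, either $\rho\ge a$ on $e$ or $\rho\equiv0$ on $e$. Let $(\lambda,u)\in\mathbb R\times H^1(\mathcal G)$ be a solution of $$\begin{cases}-u''+W(x)u+\lambda u=\rho(x)|u|^{p-2}u&\text{on every edge } e\in\mathcal E,\\ u\text{ is continuous on }\mathcal G,\\ \sum_{e\succ v}\frac{du_e}{dx}(v)=0&\text{at every vertex }v\in\mathcal V.\end{cases}$$ Then the Morse index $\mathrm m(u)$ of $u$ is greater than or equal to the number of nodal zones of $u$ that are not included in the set $\mathcal G_0:=\{x\in\mathcal G\mid\rho(x)=0\}$.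
   Context: Metric graphs: $\mathcal G=(\mathcal E,\mathcal V)$ with edges $\mathcal E$ and vertices $\mathcal V$; each bounded edge $e$ is identified with $[0,\ell_e]$ and each unbounded edge (half-line) with $[0,+\infty)$. $\mathbf G$ is the class of metric graphs that are connected, have at most countably many edges, all of whose vertices are adjacent to finitely many edges, and for which the infimum of the lengths of all edges is positive. $u_e$ is the restriction of $u$ to $e$. $H^1(\mathcal G)$ is the space of continuous $u:\mathcal G\to\mathbb R$ with $u_e\in H^1(e)$ for every edge and $\sum_e(\|u_e'\|_{L^2(e)}^2+\|u_e\|_{L^2(e)}^2)<\infty$. $C_c(\mathcal G)$ is the space of continuous functions with compact support. The notation $e\succ v$ means that $e$ is incident to $v$, and $\frac{du_e}{dx}(v)$ is the derivative along $e$ at $v$ directed away from $v$. Solutions are weak solutions: $\int_{\mathcal G}(u'\varphi'+(W+\lambda)u\varphi)\,dx=\int_{\mathcal G}\rho|u|^{p-2}u\varphi\,dx$ for all $\varphi\in H^1(\mathcal G)\cap C_c(\mathcal G)$. A nodal zone of $u$ is a connected component of $\{x\in\mathcal G\mid u(x)\ne0\}$. Since $\rho$ is defined a.e., inclusion of a nodal zone in $\mathcal G_0$ is understood up to a set of measure zero. The Morse index $\mathrm m(u)$ is the maximal dimension (or $+\infty$ if there is no maximal integer) of a subspace $X\subset H^1(\mathcal G)\cap C_c(\mathcal G)$ such that $\int_{\mathcal G}(|\varphi'|^2+(W+\lambda)\varphi^2-(p-1)\rho|u|^{p-2}\varphi^2)\,dx<0$ for all $\varphi\in X\setminus\{0\}$.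 The number of nodal zones may be infinite. *)

theory Defs
  imports
    "HOL-Analysis.Analysis"
    "HOL-Library.Function_Algebras"
    "HOL-Library.Extended_Nat"
begin

section \<open>Metric graphs\<close>

text \<open>Loops and parallel edges are allowed. An edge \<open>e\<close> is parametrised by \<open>[0, len e]\<close> if
  \<open>len e < \<infinity>\<close> and by \<open>[0, \<infinity>)\<close> otherwise; \<open>src e\<close> is the vertex at parameter \<open>0\<close> and
  \<open>tgt e\<close> the vertex at parameter \<open>len e\<close>. For a half-line \<open>tgt e\<close> has no meaning and is
  never used.\<close>

record ('v, 'e) metric_graph =
  verts :: "'v set"
  edges :: "'e set"
  len :: "'e \<Rightarrow> ereal"
  src :: "'e \<Rightarrow> 'v"
  tgt :: "'e \<Rightarrow> 'v"

definition wf_metric_graph :: "('v, 'e) metric_graph \<Rightarrow> bool" where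
  "wf_metric_graph G \<longleftrightarrow>
     (\<forall>e\<in>edges G. 0 < len G e \<and> src G e \<in> verts G \<and> (len G e < \<infinity> \<longrightarrow> tgt G e \<in> verts G))"

definition edge_dom :: "('v, 'e) metric_graph \<Rightarrow> 'e \<Rightarrow> real set" where
  "edge_dom G e = {x. 0 \<le> x \<and> ereal x \<le> len G e}"

definition incident :: "('v, 'e) metric_graph \<Rightarrow> 'e \<Rightarrow> 'v \<Rightarrow> bool" where
  "incident G e v \<longleftrightarrow> src G e = v \<or> (len G e < \<infinity> \<and> tgt G e = v)"

datatype ('v, 'e) gpoint = Vertex 'v | Inner 'e real

definition points :: "('v, 'e) metric_graph \<Rightarrow> ('v, 'e) gpoint set" where
  "points G = Vertex ` verts G \<union> {Inner e x | e x. e \<in> edges G \<and> 0 < x \<and> ereal x < len G e}"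

definition par :: "('v, 'e) metric_graph \<Rightarrow> 'e \<Rightarrow> real \<Rightarrow> ('v, 'e) gpoint" where
  "par G e x =
     (if x = 0 then Vertex (src G e)
      else if ereal x = len G e then Vertex (tgt G e)
      else Inner e x)"

text \<open>The quotient topology of the disjoint union of the intervals (and the vertices). For
  graphs in the class below it is also the topology of the shortest-path metric.\<close>

definition graph_topology :: "('v, 'e) metric_graph \<Rightarrow> ('v, 'e) gpoint topology" where
  "graph_topology G = topology (\<lambda>U. U \<subseteq> points G \<and>
     (\<forall>e\<in>edges G. openin (top_of_set (edge_dom G e)) {x \<in> edge_dom G e. par G e x \<in> U}))"

lemma openin_graph_topology:
  "openin (graph_topology G) U \<longleftrightarrow> U \<subseteq> points G \<and>
     (\<forall>e\<in>edges G. openin (top_of_set (edge_dom G e)) {x \<in> edge_dom G e. par G e x \<in> U})"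
proof -
  let ?P = "\<lambda>U. U \<subseteq> points G \<and>
     (\<forall>e\<in>edges G. openin (top_of_set (edge_dom G e)) {x \<in> edge_dom G e. par G e x \<in> U})"
  have int: "?P (S \<inter> T)" if S: "?P S" and T: "?P T" for S T
  proof (intro conjI ballI)
    show "S \<inter> T \<subseteq> points G" using S by blast
    fix e assume e: "e \<in> edges G"
    have "{x \<in> edge_dom G e. par G e x \<in> S \<inter> T} =
        {x \<in> edge_dom G e. par G e x \<in> S} \<inter> {x \<in> edge_dom G e. par G e x \<in> T}" by auto
    then show "openin (top_of_set (edge_dom G e)) {x \<in> edge_dom G e. par G e x \<in> S \<inter> T}"
      using S T e by (metis (no_types, lifting) openin_Int)
  qed
  have un: "?P (\<Union>K)" if K: "\<forall>S\<in>K. ?P S" for K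
  proof (intro conjI ballI)
    show "\<Union>K \<subseteq> points G" using K by blast
    fix e assume e: "e \<in> edges G"
    have "{x \<in> edge_dom G e. par G e x \<in> \<Union>K} =
        \<Union>((\<lambda>S. {x \<in> edge_dom G e. par G e x \<in> S}) ` K)" by auto
    moreover have "openin (top_of_set (edge_dom G e))
        (\<Union>((\<lambda>S. {x \<in> edge_dom G e. par G e x \<in> S}) ` K))"
      by (rule openin_Union) (use K e in blast)
    ultimately show "openin (top_of_set (edge_dom G e)) {x \<in> edge_dom G e. par G e x \<in> \<Union>K}"
      by simp
  qed
  have "istopology ?P"
    unfolding istopology_def using int un by blast
  then show ?thesis
    unfolding graph_topology_def by (simp only: topology_inverse')
qed

lemma par_in_points:
  assumes "wf_metric_graph G" "e \<in> edges G" "x \<in> edge_dom G e"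
  shows "par G e x \<in> points G"
proof (cases "x = 0 \<or> ereal x = len G e")
  case True
  then show ?thesis
    using assms by (auto simp: par_def points_def wf_metric_graph_def)
next
  case False
  then show ?thesis
    using assms by (auto simp: par_def points_def edge_dom_def less_le)
qed

lemma topspace_graph_topology:
  assumes "wf_metric_graph G"
  shows "topspace (graph_topology G) = points G"
proof -
  have "{x \<in> edge_dom G e. par G e x \<in> points G} = edge_dom G e" if "e \<in> edges G" for e
    using par_in_points[OF assms that] by auto
  then have "openin (graph_topology G) (points G)"
    by (simp add: openin_graph_topology)
  then show ?thesis
    by (meson openin_graph_topology openin_subset openin_topspace subset_antisym)
qed

definition graph_class_G :: "('v, 'e) metric_graph \<Rightarrow> bool" where
  "graph_class_G G \<longleftrightarrow> wf_metric_graph G \<and> connected_space (graph_topology G) \<and>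
     countable (edges G) \<and> (\<forall>v\<in>verts G. finite {e \<in> edges G. incident G e v}) \<and>
     0 < (INF e\<in>edges G. len G e)"

section \<open>Function spaces\<close>

definition restr :: "('v, 'e) metric_graph \<Rightarrow> (('v, 'e) gpoint \<Rightarrow> real) \<Rightarrow> 'e \<Rightarrow> real \<Rightarrow> real" where
  "restr G u e = (\<lambda>x. u (par G e x))"

definition graph_integral :: "('v, 'e) metric_graph \<Rightarrow> ('e \<Rightarrow> real \<Rightarrow> real) \<Rightarrow> real" where
  "graph_integral G f = (\<Sum>\<^sub>\<infinity>e\<in>edges G. integral\<^sup>L (lebesgue_on (edge_dom G e)) (f e))"

definition graph_null :: "('v, 'e) metric_graph \<Rightarrow> ('v, 'e) gpoint set \<Rightarrow> bool" where
  "graph_null G A \<longleftrightarrow>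
     (\<forall>e\<in>edges G. {x \<in> edge_dom G e. par G e x \<in> A} \<in> null_sets lebesgue)"

text \<open>Elements of \<open>L\<^sup>\<infinity>\<close> are given by representatives; no property below depends on the choice.\<close>

definition Linf :: "('v, 'e) metric_graph \<Rightarrow> (('v, 'e) gpoint \<Rightarrow> real) set" where
  "Linf G = {f. (\<forall>e\<in>edges G. restr G f e \<in> borel_measurable (lebesgue_on (edge_dom G e))) \<and>
     (\<exists>C. \<forall>e\<in>edges G. AE x in lebesgue_on (edge_dom G e). \<bar>restr G f e x\<bar> \<le> C)}"

definition L2_on :: "real set \<Rightarrow> (real \<Rightarrow> real) set" where
  "L2_on S = {f. f \<in> borel_measurable (lebesgue_on S) \<and> integrable (lebesgue_on S) (\<lambda>x. (f x)\<^sup>2)}"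

text \<open>One-dimensional Sobolev space, with test functions in \<open>C\<^sub>c\<^sup>1\<close> of the open interval
  (as in Brezis, \<^emph>\<open>Functional Analysis, Sobolev Spaces and PDE\<close>, Chapter 8).\<close>

definition has_weak_deriv :: "real set \<Rightarrow> (real \<Rightarrow> real) \<Rightarrow> (real \<Rightarrow> real) \<Rightarrow> bool" where
  "has_weak_deriv S f g \<longleftrightarrow>
     (\<forall>\<phi> \<phi>'. (\<forall>x. (\<phi> has_real_derivative \<phi>' x) (at x)) \<and> continuous_on UNIV \<phi>' \<and>
        compact (closure {x. \<phi> x \<noteq> 0}) \<and> closure {x. \<phi> x \<noteq> 0} \<subseteq> interior S \<longrightarrow>
        (LINT x|lebesgue_on S. f x * \<phi>' x) = - (LINT x|lebesgue_on S. g x * \<phi> x))"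

definition H1_on :: "real set \<Rightarrow> (real \<Rightarrow> real) set" where
  "H1_on S = {f \<in> L2_on S. \<exists>g\<in>L2_on S. has_weak_deriv S f g}"

text \<open>The weak derivative is unique up to null sets; an arbitrary representative is chosen.\<close>

definition weak_deriv :: "real set \<Rightarrow> (real \<Rightarrow> real) \<Rightarrow> real \<Rightarrow> real" where
  "weak_deriv S f = (SOME g. g \<in> L2_on S \<and> has_weak_deriv S f g)"

definition gderiv :: "('v, 'e) metric_graph \<Rightarrow> (('v, 'e) gpoint \<Rightarrow> real) \<Rightarrow> 'e \<Rightarrow> real \<Rightarrow> real" where
  "gderiv G u e = weak_deriv (edge_dom G e) (restr G u e)"

text \<open>A function on the graph is represented by its extension by \<open>0\<close> to the whole type of
  points, so that linear independence of functions refers to their values on the graph only.\<close>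

definition H1 :: "('v, 'e) metric_graph \<Rightarrow> (('v, 'e) gpoint \<Rightarrow> real) set" where
  "H1 G = {u. (\<forall>x. x \<notin> points G \<longrightarrow> u x = 0) \<and>
     continuous_map (graph_topology G) euclideanreal u \<and>
     (\<forall>e\<in>edges G. restr G u e \<in> H1_on (edge_dom G e)) \<and>
     (\<lambda>e. (LINT x|lebesgue_on (edge_dom G e). (gderiv G u e x)\<^sup>2) +
          (LINT x|lebesgue_on (edge_dom G e). (restr G u e x)\<^sup>2)) summable_on edges G}"

definition Cc :: "('v, 'e) metric_graph \<Rightarrow> (('v, 'e) gpoint \<Rightarrow> real) set" where
  "Cc G = {\<phi>. (\<forall>x. x \<notin> points G \<longrightarrow> \<phi> x = 0) \<and>
     continuous_map (graph_topology G) euclideanreal \<phi> \<and>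
     compactin (graph_topology G) (graph_topology G closure_of {x \<in> points G. \<phi> x \<noteq> 0})}"

section \<open>Weak solutions, nodal zones and the Morse index\<close>

definition weak_solution :: "('v, 'e) metric_graph \<Rightarrow> (('v, 'e) gpoint \<Rightarrow> real) \<Rightarrow>
    (('v, 'e) gpoint \<Rightarrow> real) \<Rightarrow> real \<Rightarrow> real \<Rightarrow> (('v, 'e) gpoint \<Rightarrow> real) \<Rightarrow> bool" where
  "weak_solution G W \<rho> p lam u \<longleftrightarrow>
     (\<forall>\<phi> \<in> H1 G \<inter> Cc G.
        graph_integral G (\<lambda>e x. gderiv G u e x * gderiv G \<phi> e x +
          (restr G W e x + lam) * restr G u e x * restr G \<phi> e x) =
        graph_integral G (\<lambda>e x. restr G \<rho> e x * \<bar>restr G u e x\<bar> powr (p - 2) *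
          restr G u e x * restr G \<phi> e x))"

definition nodal_zones :: "('v, 'e) metric_graph \<Rightarrow> (('v, 'e) gpoint \<Rightarrow> real) \<Rightarrow>
    ('v, 'e) gpoint set set" where
  "nodal_zones G u =
     connected_components_of (subtopology (graph_topology G) {x \<in> points G. u x \<noteq> 0})"

definition quadratic_form :: "('v, 'e) metric_graph \<Rightarrow> (('v, 'e) gpoint \<Rightarrow> real) \<Rightarrow>
    (('v, 'e) gpoint \<Rightarrow> real) \<Rightarrow> real \<Rightarrow> real \<Rightarrow> (('v, 'e) gpoint \<Rightarrow> real) \<Rightarrow>
    (('v, 'e) gpoint \<Rightarrow> real) \<Rightarrow> real" where
  "quadratic_form G W \<rho> p lam u \<phi> =
     graph_integral G (\<lambda>e x. \<bar>gderiv G \<phi> e x\<bar>\<^sup>2 +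
       (restr G W e x + lam) * (restr G \<phi> e x)\<^sup>2 -
       (p - 1) * restr G \<rho> e x * \<bar>restr G u e x\<bar> powr (p - 2) * (restr G \<phi> e x)\<^sup>2)"

global_interpretation fun_vs: vector_space "\<lambda>(c::real) (f::'a \<Rightarrow> real) x. c * f x"
  by unfold_locales (auto simp: fun_eq_iff algebra_simps)

text \<open>\<open>fun_vs.dim\<close> is \<open>0\<close> on infinite-dimensional spaces, hence the case distinction.\<close>

definition subspace_edim :: "('a \<Rightarrow> real) set \<Rightarrow> enat" where
  "subspace_edim X =
     (if \<exists>B. finite B \<and> X \<subseteq> fun_vs.span B then enat (fun_vs.dim X) else \<infinity>)"

definition morse_index :: "('v, 'e) metric_graph \<Rightarrow> (('v, 'e) gpoint \<Rightarrow> real) \<Rightarrow>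
    (('v, 'e) gpoint \<Rightarrow> real) \<Rightarrow> real \<Rightarrow> real \<Rightarrow> (('v, 'e) gpoint \<Rightarrow> real) \<Rightarrow> enat" where
  "morse_index G W \<rho> p lam u =
     Sup (subspace_edim ` {X. fun_vs.subspace X \<and> X \<subseteq> H1 G \<inter> Cc G \<and>
       (\<forall>\<phi> \<in> X - {0}. quadratic_form G W \<rho> p lam u \<phi> < 0)})"

definition ecard :: "'a set \<Rightarrow> enat" where
  "ecard A = (if finite A then enat (card A) else \<infinity>)"

end

theory Submission
  imports Defs
begin

text \<open>
  For a nodal zone \<open>Z\<close> not contained in \<open>G\<^sub>0\<close>, let \<open>u\<^sub>Z\<close> be \<open>u\<close> on \<open>Z\<close> and \<open>0\<close> elsewhere, and let \<open>\<eta>\<close>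
  be a compactly supported cutoff with \<open>\<bar>\<eta>'\<bar> \<le> \<kappa>\<close>. Testing the equation with \<open>\<eta>\<^sup>2 u\<^sub>Z\<close> shows that the
  quadratic form at \<open>\<phi> = \<eta> u\<^sub>Z\<close> equals
  \<open>\<integral> \<eta>'\<^sup>2 u\<^sub>Z\<^sup>2 - (p - 2) \<integral> \<rho> \<bar>u\<bar>\<^bsup>p-2\<^esup> \<phi>\<^sup>2\<close>. The first integral is at most \<open>\<kappa>\<^sup>2 \<parallel>u\<parallel>\<^sup>2\<close>, while the
  second stays away from \<open>0\<close>, because \<open>Z\<close> meets an edge on which \<open>\<rho> \<ge> a\<close>; so the form is negative
  for small \<open>\<kappa>\<close>. Functions coming from distinct zones have disjoint supports, hence the form is
  negative definite on the span of any finite number of them.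

  Absolute continuity on an edge means that \<open>f y - f x\<close> is the integral of \<open>g\<close>. Its rules for
  products and for restriction to a nodal zone follow from one principle: an increment that is
  bounded on short intervals by integrals of \<open>h\<^sub>n\<close> with \<open>\<integral> h\<^sub>n \<longlonglongrightarrow> 0\<close> vanishes.
\<close>

section \<open>Absolutely continuous functions on intervals\<close>

text \<open>The Morse index admits only compactly supported functions, while a nodal zone may run
  along half-lines or through infinitely many edges; this is why \<open>u\<close> restricted to
  \<open>Z\<close> has to be cut off. Small slopes are available because edge lengths are bounded
  below and vertices have finite degree: the cutoff descends over many combinatorial layers around
  one edge, each of which meets only finitely many edges. The cutoff enters squared in the tested
  equation because the product rule then completes a square: on \<open>Z\<close>,
  \<open>u' (\<eta>^2 u)' = ((\<eta> u)')^2 - (\<eta>' u)^2\<close>. The factor \<open>p - 2\<close>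
  is what remains of \<open>p - 1\<close> after the equation has absorbed one copy of the nonlinear
  term. Two obstacles shape the analysis. A zone can meet one edge in infinitely many intervals, so
  \<open>u\<close> on \<open>Z\<close> cannot be treated by finite gluing. And \<open>gderiv\<close>
  is an arbitrary representative of a weak derivative; functions therefore travel with an explicit
  pointwise derivative, which is exchanged for \<open>gderiv\<close> almost everywhere only inside
  the integrals.\<close>

definition ac_on :: "real set \<Rightarrow> (real \<Rightarrow> real) \<Rightarrow> (real \<Rightarrow> real) \<Rightarrow> bool" where
  "ac_on S f g \<longleftrightarrow> (\<forall>x\<in>S. \<forall>y\<in>S. x \<le> y \<longrightarrow>
     g absolutely_integrable_on {x..y} \<and> f y - f x = integral {x..y} g)"

text \<open>Both sides are compatible with subdivision: increments obey the triangle inequality and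
  the integral is additive, so a bound on short intervals adds up to one on
  \<open>[a, b]\<close>.\<close>

lemma increment_le_integral_if_local:
  fixes D h :: "real \<Rightarrow> real"
  assumes ab: "a \<le> b" and d: "0 < d" and h: "h integrable_on {a..b}"
    and loc: "\<And>x y. a \<le> x \<Longrightarrow> x \<le> y \<Longrightarrow> y \<le> b \<Longrightarrow> y - x \<le> d \<Longrightarrow> \<bar>D y - D x\<bar> \<le> integral {x..y} h"
  shows "\<bar>D b - D a\<bar> \<le> integral {a..b} h"
proof -
  \<comment> \<open>\<open>n\<close> bounds the number of steps of length \<open>d\<close> that lead
    from \<open>a\<close> to \<open>y\<close>; the induction step splits off the last piece
    \<open>[y - d, y]\<close>.\<close>
  have "\<bar>D y - D a\<bar> \<le> integral {a..y} h" if "a \<le> y" "y \<le> b" "y - a \<le> real n * d" for n y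
    using that
  proof (induction n arbitrary: y)
    case 0
    then have "y = a" by simp
    then show ?case by simp
  next
    case (Suc n)
    show ?case
    proof (cases "y - a \<le> d")
      case True
      then show ?thesis using loc[of a y] Suc.prems by simp
    next
      case False
      have "\<bar>D (y - d) - D a\<bar> \<le> integral {a..y - d} h"
        using Suc.prems False d by (intro Suc.IH) (auto simp: algebra_simps)
      moreover have "\<bar>D y - D (y - d)\<bar> \<le> integral {y - d..y} h"
        using Suc.prems False d by (intro loc) auto
      moreover have "integral {a..y - d} h + integral {y - d..y} h = integral {a..y} h"
        using Suc.prems False d integrable_subinterval_real[OF h, of a y]
        by (intro Henstock_Kurzweil_Integration.integral_combine) auto
      ultimately show ?thesis by linarith
    qed
  qed
  moreover obtain n where "(b - a) / d \<le> real n" using real_arch_simple by blast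
  ultimately show ?thesis using ab d by (simp add: pos_divide_le_eq)
qed

text \<open>The admissible length \<open>d\<close> may depend on \<open>n\<close>, since for each
  \<open>n\<close> the local bounds are summed up before the limit is taken. The lemma is applied to
  a defect \<open>D\<close>, the difference between a function and the integral of its candidate
  derivative.\<close>

lemma increment_zero_if_local:
  fixes D :: "real \<Rightarrow> real" and h :: "nat \<Rightarrow> real \<Rightarrow> real"
  assumes ab: "a \<le> b" and h: "\<And>n. h n integrable_on {a..b}"
    and loc: "\<And>n. \<exists>d>0. \<forall>x y. a \<le> x \<longrightarrow> x \<le> y \<longrightarrow> y \<le> b \<longrightarrow> y - x \<le> d \<longrightarrow>
                 \<bar>D y - D x\<bar> \<le> integral {x..y} (h n)"
    and lim: "(\<lambda>n. integral {a..b} (h n)) \<longlonglongrightarrow> 0"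
  shows "D b = D a"
proof -
  have "\<bar>D b - D a\<bar> \<le> integral {a..b} (h n)" for n
    using loc[of n] increment_le_integral_if_local[OF ab _ h] by meson
  then have "\<bar>D b - D a\<bar> \<le> 0"
    using LIMSEQ_le_const[OF lim] by blast
  then show ?thesis by simp
qed

lemma ac_on_subset: "ac_on S f g \<Longrightarrow> T \<subseteq> S \<Longrightarrow> ac_on T f g"
  unfolding ac_on_def by blast

lemma ac_on_cong:
  "(\<And>x. x \<in> S \<Longrightarrow> f x = f' x) \<Longrightarrow> ac_on S f g \<longleftrightarrow> ac_on S f' g"
  unfolding ac_on_def by simp

lemma ac_on_absolutely_integrable:
  "ac_on S f g \<Longrightarrow> {x..y} \<subseteq> S \<Longrightarrow> g absolutely_integrable_on {x..y}"
  by (cases "x \<le> y") (auto simp: ac_on_def subset_eq)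

lemma ac_on_continuous_Icc:
  assumes "ac_on {a..b} f g"
  shows "continuous_on {a..b} f"
proof (cases "a \<le> b")
  case True
  have "g integrable_on {a..b}"
    using ac_on_absolutely_integrable[OF assms] by (auto simp: absolutely_integrable_on_def)
  then have "continuous_on {a..b} (\<lambda>x. f a + integral {a..x} g)"
    by (intro continuous_intros indefinite_integral_continuous_1)
  moreover have "f a + integral {a..x} g = f x" if "x \<in> {a..b}" for x
  proof -
    have "f x - f a = integral {a..x} g"
      using assms that True unfolding ac_on_def by (metis atLeastAtMost_iff order_refl)
    then show ?thesis by linarith
  qed
  ultimately show ?thesis
    by (rule continuous_on_eq)
qed auto

text \<open>Freezing \<open>f\<close> and \<open>g\<close> at end points of a short interval changes
  the integrand by at most their oscillation times \<open>\<bar>f'\<bar> + \<bar>g'\<bar>\<close>,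
  and uniform continuity pushes the oscillation below \<open>inverse (Suc n)\<close>.\<close>

lemma ac_on_mult_Icc:
  assumes f: "ac_on {a..b} f f'" and g: "ac_on {a..b} g g'" and ab: "a \<le> b"
  shows "(\<lambda>x. f x * g' x + g x * f' x) absolutely_integrable_on {a..b}"
    and "f b * g b - f a * g a = integral {a..b} (\<lambda>x. f x * g' x + g x * f' x)"
proof -
  have cf: "continuous_on {a..b} f" and cg: "continuous_on {a..b} g"
    using f g ac_on_continuous_Icc by auto
  have f': "f' absolutely_integrable_on {a..b}" and g': "g' absolutely_integrable_on {a..b}"
    using f g ac_on_absolutely_integrable by blast+
  have bmult: "(\<lambda>x. k x * l x) absolutely_integrable_on {a..b}"
    if "continuous_on {a..b} k" "l absolutely_integrable_on {a..b}" for k l :: "real \<Rightarrow> real"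
    using that by (intro absolutely_integrable_bounded_measurable_product_real
        continuous_imp_measurable_on_sets_lebesgue compact_imp_bounded compact_continuous_image) auto
  show abs: "(\<lambda>x. f x * g' x + g x * f' x) absolutely_integrable_on {a..b}"
    by (intro set_integral_add bmult cf cg f' g')
  define m where "m = (\<lambda>x. \<bar>f' x\<bar> + \<bar>g' x\<bar>)"
  have m: "m integrable_on {a..b}"
    unfolding m_def using f' g' by (intro integrable_add) (auto simp: absolutely_integrable_on_def)
  define D where "D = (\<lambda>x. f x * g x - integral {a..x} (\<lambda>x. f x * g' x + g x * f' x))"
  have "D b = D a"
  proof (rule increment_zero_if_local[OF ab])
    show "(\<lambda>x. inverse (Suc n) * m x) integrable_on {a..b}" for n
      by (intro integrable_on_mult_right m)
    show "(\<lambda>n. integral {a..b} (\<lambda>x. inverse (Suc n) * m x)) \<longlonglongrightarrow> 0"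
      using tendsto_mult_right[OF LIMSEQ_inverse_real_of_nat, of "integral {a..b} m"] by simp
    fix n
    have uc: "uniformly_continuous_on {a..b} f" "uniformly_continuous_on {a..b} g"
      using cf cg by (auto intro: compact_uniformly_continuous)
    have pos: "0 < inverse (real (Suc n))" by simp
    obtain d1 where d1: "d1 > 0"
        "\<And>x y. x \<in> {a..b} \<Longrightarrow> y \<in> {a..b} \<Longrightarrow> dist y x < d1 \<Longrightarrow> dist (f y) (f x) < inverse (Suc n)"
      using uc(1) pos unfolding uniformly_continuous_on_def by blast
    obtain d2 where d2: "d2 > 0"
        "\<And>x y. x \<in> {a..b} \<Longrightarrow> y \<in> {a..b} \<Longrightarrow> dist y x < d2 \<Longrightarrow> dist (g y) (g x) < inverse (Suc n)"
      using uc(2) pos unfolding uniformly_continuous_on_def by blast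
    \<comment> \<open>The half turns the non-strict condition \<open>y - x \<le> d\<close> into the
      strict ones of uniform continuity.\<close>
    define d where "d = min d1 d2 / 2"
    show "\<exists>d>0. \<forall>x y. a \<le> x \<longrightarrow> x \<le> y \<longrightarrow> y \<le> b \<longrightarrow> y - x \<le> d \<longrightarrow>
            \<bar>D y - D x\<bar> \<le> integral {x..y} (\<lambda>x. inverse (Suc n) * m x)"
    proof (intro exI[of _ d] conjI allI impI)
      show "d > 0" using d1 d2 by (simp add: d_def)
      fix x y assume xy: "a \<le> x" "x \<le> y" "y \<le> b" "y - x \<le> d"
      have sub: "{x..y} \<subseteq> {a..b}" using xy by auto
      have f'i: "f' integrable_on {x..y}" and g'i: "g' integrable_on {x..y}"
        using absolutely_integrable_on_subinterval[OF f' sub]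
          absolutely_integrable_on_subinterval[OF g' sub]
        by (auto simp: absolutely_integrable_on_def)
      have pi: "(\<lambda>x. f x * g' x + g x * f' x) integrable_on {x..y}"
        using absolutely_integrable_on_subinterval[OF abs sub]
        by (auto simp: absolutely_integrable_on_def)
      have "integral {a..x} (\<lambda>x. f x * g' x + g x * f' x) + integral {x..y} (\<lambda>x. f x * g' x + g x * f' x)
          = integral {a..y} (\<lambda>x. f x * g' x + g x * f' x)"
        using xy absolutely_integrable_on_subinterval[OF abs, of a y]
        by (intro Henstock_Kurzweil_Integration.integral_combine) (auto simp: absolutely_integrable_on_def)
      \<comment> \<open>Taking \<open>f\<close> at the right end and \<open>g\<close> at the left
        end makes the discrete product rule exact, without a term containing the product of both
        increments.\<close>
      then have "D y - D x = f y * (g y - g x) + g x * (f y - f x)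
          - integral {x..y} (\<lambda>x. f x * g' x + g x * f' x)"
        by (simp add: D_def algebra_simps)
      also have "g y - g x = integral {x..y} g'"
        using g xy unfolding ac_on_def by auto
      also have "f y - f x = integral {x..y} f'"
        using f xy unfolding ac_on_def by auto
      also have "f y * integral {x..y} g' + g x * integral {x..y} f'
          - integral {x..y} (\<lambda>x. f x * g' x + g x * f' x)
        = integral {x..y} (\<lambda>t. (f y * g' t + g x * f' t) - (f t * g' t + g t * f' t))"
        by (intro integral_unique[symmetric] has_integral_diff has_integral_add
            has_integral_mult_right integrable_integral f'i g'i pi)
      finally have "\<bar>D y - D x\<bar> =
        norm (integral {x..y} (\<lambda>t. (f y * g' t + g x * f' t) - (f t * g' t + g t * f' t)))" by simp
      also have "\<dots> \<le> integral {x..y} (\<lambda>x. inverse (Suc n) * m x)"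
      proof (rule integral_norm_bound_integral)
        show "(\<lambda>t. (f y * g' t + g x * f' t) - (f t * g' t + g t * f' t)) integrable_on {x..y}"
          using f'i g'i by (intro integrable_diff[OF _ pi] integrable_add integrable_on_mult_right)
        show "(\<lambda>x. inverse (Suc n) * m x) integrable_on {x..y}"
          using integrable_subinterval_real[OF m sub] by (intro integrable_on_mult_right)
        fix t assume t: "t \<in> {x..y}"
        have 1: "\<bar>f y - f t\<bar> \<le> inverse (Suc n)"
          using d1(2)[of t y] t xy d1(1) d2(1) by (auto simp: dist_real_def d_def)
        have 2: "\<bar>g x - g t\<bar> \<le> inverse (Suc n)"
          using d2(2)[of t x] t xy d1(1) d2(1) by (auto simp: dist_real_def d_def)
        have "norm ((f y * g' t + g x * f' t) - (f t * g' t + g t * f' t))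
           = \<bar>(f y - f t) * g' t + (g x - g t) * f' t\<bar>"
          by (simp add: algebra_simps)
        also have "\<dots> \<le> \<bar>f y - f t\<bar> * \<bar>g' t\<bar> + \<bar>g x - g t\<bar> * \<bar>f' t\<bar>"
          by (metis abs_mult abs_triangle_ineq)
        also have "\<dots> \<le> inverse (Suc n) * \<bar>g' t\<bar> + inverse (Suc n) * \<bar>f' t\<bar>"
          by (intro add_mono mult_right_mono 1 2) auto
        finally show "norm ((f y * g' t + g x * f' t) - (f t * g' t + g t * f' t))
            \<le> inverse (Suc n) * m t"
          by (simp add: m_def algebra_simps)
      qed
      finally show "\<bar>D y - D x\<bar> \<le> integral {x..y} (\<lambda>x. inverse (Suc n) * m x)" .
    qed
  qed
  then show "f b * g b - f a * g a = integral {a..b} (\<lambda>x. f x * g' x + g x * f' x)"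
    by (simp add: D_def)
qed

lemma ac_on_mult:
  assumes "ac_on S f f'" "ac_on S g g'" "is_interval S"
  shows "ac_on S (\<lambda>x. f x * g x) (\<lambda>x. f x * g' x + g x * f' x)"
  unfolding ac_on_def
proof (intro ballI impI)
  fix x y assume xy: "x \<in> S" "y \<in> S" "x \<le> y"
  then have "{x..y} \<subseteq> S" using assms(3) by (meson atLeastAtMost_iff mem_is_interval_1_I subsetI)
  then have "ac_on {x..y} f f'" "ac_on {x..y} g g'"
    using assms ac_on_subset by blast+
  then show "(\<lambda>x. f x * g' x + g x * f' x) absolutely_integrable_on {x..y} \<and>
     f y * g y - f x * g x = integral {x..y} (\<lambda>x. f x * g' x + g x * f' x)"
    using ac_on_mult_Icc xy by blast
qed

text \<open>Short intervals inside \<open>A\<close> contribute no error; on the others \<open>f\<close> has a zero, so the error is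
  at most \<open>3 \<integral> \<bar>g\<bar>\<close> over the points of \<open>A\<close> near the complement of \<open>A\<close>, a set shrinking to \<open>{}\<close>.\<close>

lemma ac_on_indicator_Icc:
  fixes f g :: "real \<Rightarrow> real"
  assumes f: "ac_on {a..b} f g" and ab: "a \<le> b" and A: "A \<subseteq> {a..b}"
    and nz: "\<And>x. x \<in> A \<Longrightarrow> f x \<noteq> 0"
    and sat: "\<And>x y. a \<le> x \<Longrightarrow> x \<le> y \<Longrightarrow> y \<le> b \<Longrightarrow> (\<And>r. x \<le> r \<Longrightarrow> r \<le> y \<Longrightarrow> f r \<noteq> 0) \<Longrightarrow>
                x \<in> A \<longleftrightarrow> y \<in> A"
  shows "(\<lambda>x. indicator A x * g x) absolutely_integrable_on {a..b}"
    and "indicator A b * f b - indicator A a * f a = integral {a..b} (\<lambda>x. indicator A x * g x)"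
proof -
  have cf: "continuous_on {a..b} f"
    using f by (rule ac_on_continuous_Icc)
  have gabs: "g absolutely_integrable_on {a..b}"
    using f ac_on_absolutely_integrable by blast
  \<comment> \<open>Near a point of \<open>A\<close> the function \<open>f\<close> does not vanish,
    so \<open>sat\<close> keeps a whole neighbourhood in \<open>A\<close>. Openness makes
    \<open>A\<close> a Borel set and its complement \<open>C\<close> closed, so that extremal points
    of \<open>C\<close> exist below.\<close>
  have opA: "openin (top_of_set {a..b}) A"
  proof (subst openin_contains_ball, intro conjI ballI A)
    fix x assume x: "x \<in> A"
    then have "x \<in> {a..b}" "f x \<noteq> 0" using A nz by auto
    then obtain e where e: "e > 0" "\<And>y. y \<in> {a..b} \<Longrightarrow> dist x y < e \<Longrightarrow> f y \<noteq> 0"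
      using continuous_on_avoid[OF cf] by metis
    have "y \<in> A" if y: "y \<in> ball x e" "y \<in> {a..b}" for y
    proof (cases "x \<le> y")
      case True
      then show ?thesis
        using sat[of x y] x y e(2) A by (force simp: dist_real_def)
    next
      case False
      then show ?thesis
        using sat[of y x] x y e(2) A by (force simp: dist_real_def)
    qed
    then show "\<exists>e>0. ball x e \<inter> {a..b} \<subseteq> A" using e(1) by blast
  qed
  define C where "C = {a..b} - A"
  have C: "closed C"
    unfolding C_def by (metis closed_atLeastAtMost closedin_closed_trans closedin_diff closedin_subtopology_refl closed_closedin opA closedin_topspace topspace_euclidean_subtopology)
  have Ameas: "A \<in> sets borel"
    using opA by (auto simp: openin_open)
  have bmult: "(\<lambda>x. indicator B x * k x) absolutely_integrable_on {a..b}"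
    if "B \<in> sets borel" "k absolutely_integrable_on {a..b}" for B and k :: "real \<Rightarrow> real"
    using that by (intro absolutely_integrable_bounded_measurable_product_real
        measurable_restrict_space1 measurable_completion borel_measurable_indicator)
      (auto intro!: boundedI[of _ 1] simp: indicator_def)
  show g1abs: "(\<lambda>x. indicator A x * g x) absolutely_integrable_on {a..b}"
    by (intro bmult Ameas gabs)
  define f1 where "f1 = (\<lambda>x. indicator A x * f x)"
  define g1 where "g1 = (\<lambda>x. indicator A x * g x)"
  define D where "D = (\<lambda>x. f1 x - integral {a..x} g1)"
  define N where "N = (\<lambda>n::nat. \<Union>r\<in>C. ball r (inverse (Suc n)))"
  define h where "h = (\<lambda>(n::nat) x. indicator (A \<inter> N n) x * (3 * \<bar>g x\<bar>))"
  have g1i: "g1 integrable_on {s..t}" "(\<lambda>x. \<bar>g1 x\<bar>) integrable_on {s..t}"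
    if "a \<le> s" "t \<le> b" for s t
    using absolutely_integrable_on_subinterval[OF g1abs, of s t] that
    by (auto simp: absolutely_integrable_on_def g1_def)
  \<comment> \<open>If \<open>t\<close> is in \<open>A\<close>, let \<open>r\<close> be the last
    point of \<open>C\<close> in \<open>[s, t]\<close>. It is a zero of \<open>f\<close>, for
    otherwise \<open>f\<close> has no zero on \<open>[r, t]\<close> and \<open>sat\<close> would put
    \<open>r\<close> into \<open>A\<close>. Hence \<open>f1 t\<close> is the integral of
    \<open>g1\<close> over \<open>[r, t]\<close>.\<close>
  have left: "\<bar>f1 t\<bar> \<le> integral {s..t} (\<lambda>x. \<bar>g1 x\<bar>)"
    if st: "a \<le> s" "s \<le> t" "t \<le> b" and r0: "r0 \<in> {s..t} - A" for s t r0
  proof (cases "t \<in> A")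
    case False
    then show ?thesis by (simp add: f1_def integral_nonneg g1i st)
  next
    case True
    define r where "r = Sup (C \<inter> {s..t})"
    have ne: "r0 \<in> C \<inter> {s..t}" using r0 st by (auto simp: C_def)
    have bd: "bdd_above (C \<inter> {s..t})" by (auto intro: bdd_aboveI[of _ t])
    have "r \<in> C \<inter> {s..t}"
      unfolding r_def by (rule closed_contains_Sup[OF _ bd]) (use ne C in auto)
    then have r: "r \<notin> A" "s \<le> r" "r \<le> t" by (auto simp: C_def)
    have inA: "x \<in> A" if "r < x" "x \<le> t" for x
    proof (rule ccontr)
      assume "x \<notin> A"
      then have "x \<in> C \<inter> {s..t}" using that r st by (auto simp: C_def)
      then have "x \<le> r" unfolding r_def by (rule cSup_upper[OF _ bd])
      then show False using that by simp
    qed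
    have fr: "f r = 0"
    proof (rule ccontr)
      assume "f r \<noteq> 0"
      then have "f x \<noteq> 0" if "r \<le> x" "x \<le> t" for x
        using that inA[of x] nz by (cases "x = r") auto
      then have "r \<in> A" using sat[of r t] r st True by auto
      then show False using r by simp
    qed
    have "f t - f r = integral {r..t} g"
      using f r st unfolding ac_on_def by (metis atLeastAtMost_iff order_trans)
    also have "\<dots> = integral {r..t} g1"
      by (rule integral_spike[of "{r}"]) (use inA in \<open>auto simp: g1_def\<close>)
    finally have "\<bar>f1 t\<bar> = norm (integral {r..t} g1)" by (simp add: f1_def fr True)
    also have "\<dots> \<le> integral {r..t} (\<lambda>x. \<bar>g1 x\<bar>)"
      by (rule integral_norm_bound_integral) (use r st in \<open>auto intro: g1i\<close>)
    also have "\<dots> \<le> integral {s..t} (\<lambda>x. \<bar>g1 x\<bar>)"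
      by (rule integral_subset_le) (use r st in \<open>auto intro: g1i\<close>)
    finally show ?thesis .
  qed
  \<comment> \<open>Mirror image of \<open>left\<close>, with the first point of \<open>C\<close> in
    \<open>[s, t]\<close>.\<close>
  have right: "\<bar>f1 s\<bar> \<le> integral {s..t} (\<lambda>x. \<bar>g1 x\<bar>)"
    if st: "a \<le> s" "s \<le> t" "t \<le> b" and r0: "r0 \<in> {s..t} - A" for s t r0
  proof (cases "s \<in> A")
    case False
    then show ?thesis by (simp add: f1_def integral_nonneg g1i st)
  next
    case True
    define r where "r = Inf (C \<inter> {s..t})"
    have ne: "r0 \<in> C \<inter> {s..t}" using r0 st by (auto simp: C_def)
    have bd: "bdd_below (C \<inter> {s..t})" by (auto intro: bdd_belowI[of _ s])
    have "r \<in> C \<inter> {s..t}"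
      unfolding r_def by (rule closed_contains_Inf[OF _ bd]) (use ne C in auto)
    then have r: "r \<notin> A" "s \<le> r" "r \<le> t" by (auto simp: C_def)
    have inA: "x \<in> A" if "x < r" "s \<le> x" for x
    proof (rule ccontr)
      assume "x \<notin> A"
      then have "x \<in> C \<inter> {s..t}" using that r st by (auto simp: C_def)
      then have "r \<le> x" unfolding r_def by (rule cInf_lower[OF _ bd])
      then show False using that by simp
    qed
    have fr: "f r = 0"
    proof (rule ccontr)
      assume "f r \<noteq> 0"
      then have "f x \<noteq> 0" if "s \<le> x" "x \<le> r" for x
        using that inA[of x] nz by (cases "x = r") auto
      then have "r \<in> A" using sat[of s r] r st True by auto
      then show False using r by simp
    qed
    have "f r - f s = integral {s..r} g"
      using f r st unfolding ac_on_def by (metis atLeastAtMost_iff order_trans)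
    also have "\<dots> = integral {s..r} g1"
      by (rule integral_spike[of "{r}"]) (use inA in \<open>auto simp: g1_def\<close>)
    finally have "\<bar>f1 s\<bar> = norm (integral {s..r} g1)" by (simp add: f1_def fr True)
    also have "\<dots> \<le> integral {s..r} (\<lambda>x. \<bar>g1 x\<bar>)"
      by (rule integral_norm_bound_integral) (use r st in \<open>auto intro: g1i\<close>)
    also have "\<dots> \<le> integral {s..t} (\<lambda>x. \<bar>g1 x\<bar>)"
      by (rule integral_subset_le) (use r st in \<open>auto intro: g1i\<close>)
    finally show ?thesis .
  qed
  have Nmeas: "A \<inter> N n \<in> sets borel" for n
    unfolding N_def by (intro sets.Int Ameas borel_open open_UN ballI open_ball)
  have gabs3: "(\<lambda>x. 3 * \<bar>g x\<bar>) absolutely_integrable_on {a..b}"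
    using absolutely_integrable_abs[OF gabs] by (intro set_integrable_mult_right) auto
  have hi: "h n integrable_on {a..b}" for n
    using bmult[OF Nmeas gabs3] by (auto simp: h_def absolutely_integrable_on_def)
  have "D b = D a"
  proof (rule increment_zero_if_local[OF ab hi])
    have "(\<lambda>n. integral {a..b} (h n)) \<longlonglongrightarrow> integral {a..b} (\<lambda>x. 0)"
    proof (rule dominated_convergence[OF hi])
      show "(\<lambda>x. 3 * \<bar>g x\<bar>) integrable_on {a..b}"
        using gabs3 by (auto simp: absolutely_integrable_on_def)
      show "norm (h n x) \<le> 3 * \<bar>g x\<bar>" for n x
        by (auto simp: h_def indicator_def)
      fix x assume x: "x \<in> {a..b}"
      show "(\<lambda>n. h n x) \<longlonglongrightarrow> 0"
      proof (cases "x \<in> A")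
        case True
        then have "x \<in> - C" by (simp add: C_def)
        then obtain e where e: "e > 0" "ball x e \<subseteq> - C"
          using C open_contains_ball by (metis open_Compl)
        have "\<forall>\<^sub>F n in sequentially. inverse (real (Suc n)) < e"
          using LIMSEQ_inverse_real_of_nat e(1) by (rule order_tendstoD)
        then have "\<forall>\<^sub>F n in sequentially. h n x = 0"
        proof eventually_elim
          case (elim n)
          have "x \<notin> N n"
          proof
            assume "x \<in> N n"
            then obtain r where "r \<in> C" "dist r x < inverse (real (Suc n))" by (auto simp: N_def)
            then have "r \<in> ball x e" using elim by (simp add: dist_commute)
            then show False using e(2) \<open>r \<in> C\<close> by blast
          qed
          then show ?case by (simp add: h_def)
        qed
        then show ?thesis by (rule tendsto_eventually)
      qed (simp add: h_def)
    qed
    then show "(\<lambda>n. integral {a..b} (h n)) \<longlonglongrightarrow> 0" by simp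
    fix n
    \<comment> \<open>Strictly less than the radius of the balls in \<open>N n\<close>: an interval
      of length at most \<open>d\<close> that meets \<open>C\<close> then lies inside
      \<open>N n\<close>.\<close>
    define d where "d = inverse (real (Suc n)) / 2"
    show "\<exists>d>0. \<forall>x y. a \<le> x \<longrightarrow> x \<le> y \<longrightarrow> y \<le> b \<longrightarrow> y - x \<le> d \<longrightarrow> \<bar>D y - D x\<bar> \<le> integral {x..y} (h n)"
    proof (intro exI[of _ d] conjI allI impI)
      show "d > 0" by (simp add: d_def)
      fix s t assume st: "a \<le> s" "s \<le> t" "t \<le> b" "t - s \<le> d"
      have "integral {a..s} g1 + integral {s..t} g1 = integral {a..t} g1"
        using st g1i[of a t] by (intro Henstock_Kurzweil_Integration.integral_combine) auto
      then have D: "D t - D s = f1 t - f1 s - integral {s..t} g1" by (simp add: D_def)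
      show "\<bar>D t - D s\<bar> \<le> integral {s..t} (h n)"
      proof (cases "{s..t} \<subseteq> A")
        case True
        have "f t - f s = integral {s..t} g"
          using f st unfolding ac_on_def by (metis atLeastAtMost_iff order_trans)
        also have "\<dots> = integral {s..t} g1"
          by (rule integral_cong) (use True in \<open>auto simp: g1_def\<close>)
        finally have "D t - D s = 0"
          using True st by (simp add: D f1_def subset_eq)
        moreover have "0 \<le> integral {s..t} (h n)"
          using integrable_subinterval_real[OF hi[of n], of s t] st
          by (intro integral_nonneg) (auto simp: h_def)
        ultimately show ?thesis by simp
      next
        case False
        then obtain r0 where r0: "r0 \<in> {s..t} - A" by blast
        have hn: "h n x = 3 * \<bar>g1 x\<bar>" if "x \<in> {s..t}" for x
        proof -
          have "dist r0 x \<le> d" using r0 that st by (auto simp: dist_real_def)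
          also have "d < inverse (real (Suc n))" by (simp add: d_def)
          finally have "x \<in> N n" using r0 st by (auto simp: N_def C_def)
          then show ?thesis by (auto simp: h_def g1_def indicator_def)
        qed
        \<comment> \<open>Three terms, each at most the integral of \<open>\<bar>g1\<bar>\<close>
          over \<open>[s, t]\<close>; this is the factor 3 in \<open>h\<close>.\<close>
        have "\<bar>D t - D s\<bar> \<le> \<bar>f1 t\<bar> + \<bar>f1 s\<bar> + \<bar>integral {s..t} g1\<bar>" by (simp add: D)
        also have "\<bar>integral {s..t} g1\<bar> \<le> integral {s..t} (\<lambda>x. \<bar>g1 x\<bar>)"
          using integral_norm_bound_integral[of g1 "{s..t}" "\<lambda>x. \<bar>g1 x\<bar>"] g1i[of s t] st by auto
        finally have "\<bar>D t - D s\<bar> \<le> 3 * integral {s..t} (\<lambda>x. \<bar>g1 x\<bar>)"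
          using left[OF st(1-3) r0] right[OF st(1-3) r0] by linarith
        also have "\<dots> = integral {s..t} (\<lambda>x. 3 * \<bar>g1 x\<bar>)" by simp
        also have "\<dots> = integral {s..t} (h n)"
          by (rule integral_cong) (simp add: hn)
        finally show ?thesis .
      qed
    qed
  qed
  then show "indicator A b * f b - indicator A a * f a = integral {a..b} (\<lambda>x. indicator A x * g x)"
    by (simp add: D_def f1_def g1_def)
qed

text \<open>\<open>nz\<close> and \<open>sat\<close> together say that \<open>A\<close> meets
  \<open>S\<close> in a union of connected components of the set where \<open>f\<close> does not
  vanish, possibly infinitely many. A nodal zone has this form on each edge.\<close>

lemma ac_on_indicator:
  assumes f: "ac_on S f g" and S: "is_interval S"
    and nz: "\<And>x. x \<in> A \<Longrightarrow> f x \<noteq> 0"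
    and sat: "\<And>x y. x \<in> S \<Longrightarrow> y \<in> S \<Longrightarrow> x \<le> y \<Longrightarrow> (\<And>r. x \<le> r \<Longrightarrow> r \<le> y \<Longrightarrow> f r \<noteq> 0) \<Longrightarrow>
                x \<in> A \<longleftrightarrow> y \<in> A"
  shows "ac_on S (\<lambda>x. indicator A x * f x) (\<lambda>x. indicator A x * g x)"
  unfolding ac_on_def
proof (intro ballI impI)
  fix x y assume xy: "x \<in> S" "y \<in> S" "x \<le> y"
  then have sub: "{x..y} \<subseteq> S" using S by (meson atLeastAtMost_iff mem_is_interval_1_I subsetI)
  let ?B = "A \<inter> {x..y}"
  have B: "z \<in> ?B \<longleftrightarrow> w \<in> ?B"
    if "x \<le> z" "z \<le> w" "w \<le> y" "\<And>r. z \<le> r \<Longrightarrow> r \<le> w \<Longrightarrow> f r \<noteq> 0" for z w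
  proof -
    have "z \<in> A \<longleftrightarrow> w \<in> A" by (rule sat) (use that sub in auto)
    then show ?thesis using that by auto
  qed
  have nzB: "f z \<noteq> 0" if "z \<in> ?B" for z using nz that by blast
  note * = ac_on_indicator_Icc[OF ac_on_subset[OF f sub] xy(3) Int_lower2 nzB B]
  have i1: "(\<lambda>t. indicator ?B t * g t) absolutely_integrable_on {x..y}
      \<longleftrightarrow> (\<lambda>t. indicator A t * g t) absolutely_integrable_on {x..y}"
    by (rule absolutely_integrable_spike_eq[of "{}"]) (auto simp: indicator_def)
  have i2: "integral {x..y} (\<lambda>t. indicator ?B t * g t) = integral {x..y} (\<lambda>t. indicator A t * g t)"
    by (rule integral_cong) (auto simp: indicator_def)
  have i3: "indicator ?B y = (indicator A y :: real)" "indicator ?B x = (indicator A x :: real)"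
    using xy by (auto simp: indicator_def)
  show "(\<lambda>x. indicator A x * g x) absolutely_integrable_on {x..y} \<and>
     indicator A y * f y - indicator A x * f x = integral {x..y} (\<lambda>x. indicator A x * g x)"
    using *(1) *(2) unfolding i1 i2 i3 by (rule conjI)
qed

section \<open>Weak derivatives\<close>

lemma integrable_lebesgue_on_iff_absolutely_integrable:
  fixes f :: "real \<Rightarrow> real"
  assumes "S \<in> sets lebesgue"
  shows "integrable (lebesgue_on S) f \<longleftrightarrow> f absolutely_integrable_on S"
  using assms by (simp add: set_integrable_def integrable_restrict_space)

lemma lebesgue_on_supported:
  fixes F :: "real \<Rightarrow> real"
  assumes S: "S \<in> sets lebesgue" and sub: "{a..b} \<subseteq> S"
    and zero: "\<And>x. x \<in> S \<Longrightarrow> x \<notin> {a..b} \<Longrightarrow> F x = 0"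
    and F: "F absolutely_integrable_on {a..b}"
  shows "integrable (lebesgue_on S) F" "(LINT x|lebesgue_on S. F x) = integral {a..b} F"
proof -
  have eq: "(\<lambda>x. indicator S x * F x) = (\<lambda>x. indicator {a..b} x * F x)"
    using sub zero by (auto simp: fun_eq_iff indicator_def)
  show i: "integrable (lebesgue_on S) F"
    using F S by (simp add: integrable_restrict_space set_integrable_def eq)
  have "(LINT x|lebesgue_on S. F x) = (LINT x|lebesgue. indicator {a..b} x * F x)"
    using S by (subst integral_restrict_space) (auto simp: eq)
  also have "\<dots> = integral {a..b} F"
    using set_lebesgue_integral_eq_integral(2)[OF F] by (simp add: set_lebesgue_integral_def)
  finally show "(LINT x|lebesgue_on S. F x) = integral {a..b} F" .
qed

lemma borel_measurable_lebesgue_on_subset: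
  assumes "f \<in> borel_measurable (lebesgue_on S)" "T \<subseteq> S" "T \<in> sets lebesgue"
  shows "f \<in> borel_measurable (lebesgue_on T)"
  using assms measurable_restrict_mono by blast

text \<open>On a bounded interval the constant 1 is integrable, and
  \<open>\<bar>g\<bar> \<le> 1 + g^2\<close>.\<close>

lemma L2_on_absolutely_integrable:
  assumes g: "g \<in> L2_on S" and S: "S \<in> sets lebesgue" and sub: "{x..y} \<subseteq> S"
  shows "g absolutely_integrable_on {x..y}"
proof (rule measurable_bounded_by_integrable_imp_absolutely_integrable)
  show "g \<in> borel_measurable (lebesgue_on {x..y})"
    using g sub by (auto simp: L2_on_def intro: borel_measurable_lebesgue_on_subset)
  have "(\<lambda>x. (g x)\<^sup>2) absolutely_integrable_on {x..y}"
    using g S sub absolutely_integrable_on_subinterval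
    by (simp add: L2_on_def integrable_lebesgue_on_iff_absolutely_integrable) blast
  then show "(\<lambda>x. 1 + (g x)\<^sup>2) integrable_on {x..y}"
    by (intro integrable_add) (auto simp: absolutely_integrable_on_def)
  show "norm (g t) \<le> 1 + (g t)\<^sup>2" for t
    using sum_squares_ge_zero[of "\<bar>g t\<bar> - 1" 0] zero_le_power2[of "\<bar>g t\<bar>"]
    by (simp add: power2_eq_square algebra_simps)
qed auto

lemma ac_on_continuous_deriv:
  assumes "\<And>x. x \<in> {a..b} \<Longrightarrow> (\<phi> has_real_derivative \<phi>' x) (at x)" "continuous_on {a..b} \<phi>'"
  shows "ac_on {a..b} \<phi> \<phi>'"
  unfolding ac_on_def
proof (intro ballI impI conjI)
  fix x y assume xy: "x \<in> {a..b}" "y \<in> {a..b}" "x \<le> y"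
  then have sub: "{x..y} \<subseteq> {a..b}" by auto
  then show "\<phi>' absolutely_integrable_on {x..y}"
    using assms(2) absolutely_integrable_continuous_real continuous_on_subset by blast
  have "(\<phi>' has_integral \<phi> y - \<phi> x) {x..y}"
    using xy sub assms(1)
    by (intro fundamental_theorem_of_calculus)
      (auto intro: has_field_derivative_at_within simp flip: has_real_derivative_iff_has_vector_derivative)
  then show "\<phi> y - \<phi> x = integral {x..y} \<phi>'"
    by (simp add: integral_unique)
qed

text \<open>Integration by parts is the product rule for \<open>ac_on\<close>, applied on a compact
  interval at whose ends the test function vanishes.\<close>

lemma has_weak_deriv_if_ac_on:
  assumes f: "ac_on S f g" and S: "is_interval S" "S \<in> sets lebesgue"
  shows "has_weak_deriv S f g"
  unfolding has_weak_deriv_def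
proof (intro allI impI, elim conjE)
  fix \<phi> \<phi>' :: "real \<Rightarrow> real"
  define K where "K = closure {x. \<phi> x \<noteq> 0}"
  assume der: "\<forall>x. (\<phi> has_real_derivative \<phi>' x) (at x)" and c: "continuous_on UNIV \<phi>'"
    and "compact (closure {x. \<phi> x \<noteq> 0})" and "closure {x. \<phi> x \<noteq> 0} \<subseteq> interior S"
  then have K: "compact K" "K \<subseteq> interior S" by (simp_all add: K_def)
  have \<phi>0: "\<phi> x = 0" if "x \<notin> K" for x
    using that subsetD[OF closure_subset, of x "{x. \<phi> x \<noteq> 0}"] by (auto simp: K_def)
  \<comment> \<open>Off the closed set \<open>K\<close> the function \<open>\<phi>\<close> is
    locally constant 0.\<close>
  have \<phi>'0: "\<phi>' x = 0" if "x \<notin> K" for x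
  proof -
    have "open (- K)" using K(1) by (simp add: compact_imp_closed open_Compl)
    then have "((\<lambda>_. 0) has_real_derivative \<phi>' x) (at x)"
      using has_field_derivative_transform_within_open[of \<phi> "\<phi>' x" x "- K" "\<lambda>_. 0"] der that \<phi>0
      by simp
    then show ?thesis using DERIV_const DERIV_unique by blast
  qed
  show "(LINT x|lebesgue_on S. f x * \<phi>' x) = - (LINT x|lebesgue_on S. g x * \<phi> x)"
  proof (cases "K = {}")
    case True
    then show ?thesis using \<phi>0 \<phi>'0 by simp
  next
    case False
    have KS: "Inf K \<in> K" "Sup K \<in> K"
      using K(1) False closed_contains_Inf closed_contains_Sup
      by (meson bounded_imp_bdd_above bounded_imp_bdd_below compact_imp_bounded compact_imp_closed)+
    have Kb: "Inf K \<le> x" "x \<le> Sup K" if "x \<in> K" for x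
      using that K(1) by (auto intro!: cInf_lower cSup_upper bounded_imp_bdd_above
          bounded_imp_bdd_below compact_imp_bounded)
    obtain e1 where e1: "e1 > 0" "ball (Inf K) e1 \<subseteq> S"
      using KS(1) K(2) by (meson mem_interior subsetD)
    obtain e2 where e2: "e2 > 0" "ball (Sup K) e2 \<subseteq> S"
      using KS(2) K(2) by (meson mem_interior subsetD)
    \<comment> \<open>The ends are moved off the support but stay inside \<open>S\<close>, which is
      possible because \<open>K\<close> lies in the interior.\<close>
    define a b where "a = Inf K - e1 / 2" and "b = Sup K + e2 / 2"
    have ab: "a \<in> S" "b \<in> S" "a \<le> b" "a \<notin> K" "b \<notin> K"
      using e1 e2 Kb[of a] Kb[of b] Kb[of "Inf K"] KS by (auto simp: a_def b_def dist_real_def subset_eq)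
    have sub: "{a..b} \<subseteq> S"
      using ab S(1) by (meson atLeastAtMost_iff mem_is_interval_1_I subsetI)
    have out: "x \<notin> K" if "x \<notin> {a..b}" for x
      using that Kb[of x] e1(1) e2(1) by (auto simp: a_def b_def)
    have acf: "ac_on {a..b} f g" using f sub by (rule ac_on_subset)
    have ac\<phi>: "ac_on {a..b} \<phi> \<phi>'"
      using der c by (intro ac_on_continuous_deriv) (auto intro: continuous_on_subset)
    note cont = ac_on_continuous_Icc[OF acf] ac_on_continuous_Icc[OF ac\<phi>]
    have c': "continuous_on {a..b} \<phi>'" using c continuous_on_subset by blast
    have i1: "(\<lambda>x. f x * \<phi>' x) absolutely_integrable_on {a..b}"
      by (intro absolutely_integrable_continuous_real continuous_intros cont c')
    have "(\<lambda>x. \<phi> x * g x) absolutely_integrable_on {a..b}"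
      using cont(2) acf
      by (intro absolutely_integrable_bounded_measurable_product_real
        continuous_imp_measurable_on_sets_lebesgue compact_imp_bounded compact_continuous_image)
        (auto intro: ac_on_absolutely_integrable)
    then have i2: "(\<lambda>x. g x * \<phi> x) absolutely_integrable_on {a..b}"
      by (simp add: mult.commute)
    have "0 = f b * \<phi> b - f a * \<phi> a" using \<phi>0 ab by simp
    also have "\<dots> = integral {a..b} (\<lambda>x. f x * \<phi>' x + \<phi> x * g x)"
      by (rule ac_on_mult_Icc(2)[OF acf ac\<phi> ab(3)])
    also have "\<dots> = integral {a..b} (\<lambda>x. f x * \<phi>' x) + integral {a..b} (\<lambda>x. g x * \<phi> x)"
      using i1 i2 by (subst integral_add[symmetric]) (auto simp: absolutely_integrable_on_def mult.commute)
    also have "integral {a..b} (\<lambda>x. f x * \<phi>' x) = (LINT x|lebesgue_on S. f x * \<phi>' x)"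
      using \<phi>'0 out by (intro lebesgue_on_supported(2)[symmetric] S sub i1) auto
    also have "integral {a..b} (\<lambda>x. g x * \<phi> x) = (LINT x|lebesgue_on S. g x * \<phi> x)"
      using \<phi>0 out by (intro lebesgue_on_supported(2)[symmetric] S sub i2) auto
    finally show ?thesis by simp
  qed
qed

text \<open>Du Bois-Reymond: with \<open>H = f - \<integral> g\<close>, the test function with derivative \<open>w (H - c)\<close>,
  where \<open>w t = (t - a) (b - t)\<close> and \<open>c\<close> is the \<open>w\<close>-weighted mean of \<open>H\<close>, yields
  \<open>\<integral> w (H - c)\<^sup>2 = 0\<close>.\<close>

lemma increment_if_has_weak_deriv_interior:
  assumes wd: "has_weak_deriv S f g" and S: "S \<in> sets lebesgue"
    and ab: "a < b" and sub: "{a..b} \<subseteq> interior S"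
    and cf: "continuous_on {a..b} f" and g: "g absolutely_integrable_on {a..b}"
  shows "f b - f a = integral {a..b} g"
proof -
  define H where "H = (\<lambda>x. f x - integral {a..x} g)"
  \<comment> \<open>\<open>w\<close> vanishes at \<open>a\<close> and \<open>b\<close>, so
    \<open>\<phi>'\<close> stays continuous when extended by 0; its positivity in between later
    forces \<open>H = c\<close>.\<close>
  define w where "w = (\<lambda>x. (x - a) * (b - x))"
  have gi: "g integrable_on {a..b}" using g by (simp add: absolutely_integrable_on_def)
  have cG: "continuous_on {a..b} (\<lambda>x. integral {a..x} g)"
    by (rule indefinite_integral_continuous_1[OF gi])
  have cH: "continuous_on {a..b} H"
    unfolding H_def by (intro continuous_intros cf cG)
  have cw: "continuous_on A w" for A unfolding w_def by (intro continuous_intros)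
  have wi: "w integrable_on {a..b}" "(\<lambda>x. w x * H x) integrable_on {a..b}"
    by (intro integrable_continuous_real continuous_intros cw cH)+
  have wpos: "w x > 0" if "a < x" "x < b" for x using that by (simp add: w_def)
  have wnn: "w x \<ge> 0" if "x \<in> {a..b}" for x using that by (simp add: w_def)
  have W: "integral {a..b} w > 0"
  proof -
    have "integral {a..b} w \<noteq> 0"
      using integral_eq_0_iff[OF cw ab wnn] wpos[of "(a + b) / 2"] ab by force
    moreover have "integral {a..b} w \<ge> 0" by (rule integral_nonneg[OF wi(1) wnn])
    ultimately show ?thesis by simp
  qed
  \<comment> \<open>This value makes the integral of \<open>\<phi>'\<close> vanish, so that
    \<open>\<phi>\<close> is 0 again from \<open>b\<close> onwards.\<close>
  define c where "c = integral {a..b} (\<lambda>x. w x * H x) / integral {a..b} w"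
  define \<phi>' where "\<phi>' = (\<lambda>x. if x \<in> {a..b} then w x * (H x - c) else 0)"
  \<comment> \<open>The base point \<open>a - 1\<close> lies strictly to the left of
    \<open>a\<close>, so the fundamental theorem gives a two-sided derivative at \<open>a\<close> as
    well.\<close>
  define \<phi> where "\<phi> = (\<lambda>x. integral {a - 1..x} \<phi>')"
  have c\<phi>ab: "continuous_on {a..b} (\<lambda>x. w x * (H x - c))"
    by (intro continuous_intros cw cH)
  have c\<phi>': "continuous_on UNIV \<phi>'"
  proof -
    have "continuous_on ({a..b} \<union> ({..a} \<union> {b..})) \<phi>'"
      unfolding \<phi>'_def
    proof (rule continuous_on_cases)
      show "\<forall>x. x \<in> {a..b} \<and> x \<notin> {a..b} \<or> x \<in> {..a} \<union> {b..} \<and> x \<in> {a..b} \<longrightarrow> w x * (H x - c) = 0"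
        by (auto simp: w_def)
    qed (auto intro: c\<phi>ab)
    moreover have "{a..b} \<union> ({..a} \<union> {b..}) = UNIV" using ab by auto
    ultimately show ?thesis by simp
  qed
  have \<phi>'i: "\<phi>' integrable_on {x..y}" for x y
    by (intro integrable_continuous_real continuous_on_subset[OF c\<phi>']) auto
  have \<phi>a: "\<phi> x = 0" if "x \<le> a" for x
  proof -
    have "\<phi> x = integral {a - 1..x} (\<lambda>_. 0)"
      unfolding \<phi>_def by (rule integral_cong) (use that in \<open>auto simp: \<phi>'_def w_def\<close>)
    then show ?thesis by simp
  qed
  have comb: "\<phi> x = integral {a..x} \<phi>'" if "a \<le> x" for x
    using Henstock_Kurzweil_Integration.integral_combine[of "a - 1" a x \<phi>'] that \<phi>'i \<phi>a[of a]
    by (simp add: \<phi>_def)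
  have "integral {a..b} \<phi>' = integral {a..b} (\<lambda>x. w x * H x - c * w x)"
    by (rule integral_cong) (auto simp: \<phi>'_def algebra_simps)
  also have "\<dots> = integral {a..b} (\<lambda>x. w x * H x) - c * integral {a..b} w"
    using wi by (simp add: integral_diff integrable_on_mult_right)
  also have "\<dots> = 0" using W by (simp add: c_def)
  finally have int0: "integral {a..b} \<phi>' = 0" .
  have \<phi>b: "\<phi> x = 0" if "x \<ge> b" for x
  proof -
    have "\<phi> x = integral {a..b} \<phi>' + integral {b..x} \<phi>'"
      using Henstock_Kurzweil_Integration.integral_combine[of a b x \<phi>'] that ab \<phi>'i comb[of x]
      by simp
    also have "integral {b..x} \<phi>' = integral {b..x} (\<lambda>_. 0)"
      by (rule integral_cong) (auto simp: \<phi>'_def w_def)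
    finally show ?thesis by (simp add: int0)
  qed
  have der: "(\<phi> has_real_derivative \<phi>' x) (at x)" for x
  proof (cases "x > a - 1")
    case True
    have "(\<phi> has_real_derivative \<phi>' x) (at x within {a - 1..x + 1})"
      unfolding \<phi>_def
      by (rule integral_has_real_derivative) (use True in \<open>auto intro: continuous_on_subset[OF c\<phi>']\<close>)
    then show ?thesis
      using True by (simp add: at_within_Icc_at)
  next
    case False
    have "((\<lambda>_. 0) has_real_derivative 0) (at x)" by simp
    then have "(\<phi> has_real_derivative 0) (at x)"
      by (rule has_field_derivative_transform_within_open[where S = "{..<a}"]) (use False \<phi>a in auto)
    then show ?thesis using False by (simp add: \<phi>'_def)
  qed
  have supp: "{x. \<phi> x \<noteq> 0} \<subseteq> {a..b}"
  proof
    fix x assume "x \<in> {x. \<phi> x \<noteq> 0}"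
    then have "\<not> x \<le> a" "\<not> b \<le> x" using \<phi>a \<phi>b by auto
    then show "x \<in> {a..b}" by simp
  qed
  then have cl: "closure {x. \<phi> x \<noteq> 0} \<subseteq> {a..b}" by (rule closure_minimal) simp
  have "compact (closure {x. \<phi> x \<noteq> 0})"
    unfolding compact_closure by (rule bounded_subset[OF _ supp]) simp
  then have weak: "(LINT x|lebesgue_on S. f x * \<phi>' x) = - (LINT x|lebesgue_on S. g x * \<phi> x)"
    using wd[unfolded has_weak_deriv_def, THEN spec[of _ \<phi>], THEN spec[of _ \<phi>']]
      der c\<phi>' order_trans[OF cl sub] by simp
  have subS: "{a..b} \<subseteq> S" using sub interior_subset by blast
  have acG: "ac_on {a..b} (\<lambda>x. integral {a..x} g) g"
    unfolding ac_on_def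
  proof (intro ballI impI conjI)
    fix x y assume xy: "x \<in> {a..b}" "y \<in> {a..b}" "x \<le> y"
    then show "g absolutely_integrable_on {x..y}"
      by (intro absolutely_integrable_on_subinterval[OF g]) auto
    show "integral {a..y} g - integral {a..x} g = integral {x..y} g"
      using xy Henstock_Kurzweil_Integration.integral_combine[of a x y g]
        integrable_subinterval_real[OF gi, of a y] by auto
  qed
  have ac\<phi>: "ac_on {a..b} \<phi> \<phi>'"
    using der c\<phi>' by (intro ac_on_continuous_deriv) (auto intro: continuous_on_subset)
  have c\<phi>'ab: "continuous_on {a..b} \<phi>'" using c\<phi>' continuous_on_subset by blast
  have i1: "(\<lambda>x. f x * \<phi>' x) absolutely_integrable_on {a..b}"
    by (intro absolutely_integrable_continuous_real continuous_intros cf c\<phi>'ab)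
  have i3: "(\<lambda>x. integral {a..x} g * \<phi>' x) absolutely_integrable_on {a..b}"
    by (intro absolutely_integrable_continuous_real continuous_intros cG c\<phi>'ab)
  have "(\<lambda>x. \<phi> x * g x) absolutely_integrable_on {a..b}"
    using ac_on_continuous_Icc[OF ac\<phi>] g
    by (intro absolutely_integrable_bounded_measurable_product_real
        continuous_imp_measurable_on_sets_lebesgue compact_imp_bounded compact_continuous_image) auto
  then have i2: "(\<lambda>x. g x * \<phi> x) absolutely_integrable_on {a..b}"
    by (simp add: mult.commute)
  have ii: "(\<lambda>x. f x * \<phi>' x) integrable_on {a..b}" "(\<lambda>x. g x * \<phi> x) integrable_on {a..b}"
      "(\<lambda>x. integral {a..x} g * \<phi>' x) integrable_on {a..b}"
    using i1 i2 i3 by (auto simp: absolutely_integrable_on_def)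
  have "integral {a..b} (\<lambda>x. f x * \<phi>' x) = (LINT x|lebesgue_on S. f x * \<phi>' x)"
    by (intro lebesgue_on_supported(2)[symmetric] S subS i1) (auto simp: \<phi>'_def)
  also have "\<dots> = - integral {a..b} (\<lambda>x. g x * \<phi> x)"
    unfolding weak using supp by (subst lebesgue_on_supported(2)[OF S subS _ i2]) auto
  \<comment> \<open>Integration by parts against the primitive of \<open>g\<close>; the boundary
    terms drop out because \<open>\<phi>\<close> vanishes at \<open>a\<close> and
    \<open>b\<close>.\<close>
  also have "\<dots> = integral {a..b} (\<lambda>x. integral {a..x} g * \<phi>' x)"
    using ac_on_mult_Icc(2)[OF acG ac\<phi>] ab \<phi>a[of a] \<phi>b[of b] ii
    by (simp add: integral_add mult.commute[of "\<phi> _"])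
  finally have "integral {a..b} (\<lambda>x. H x * \<phi>' x) = 0"
    using ii by (simp add: H_def left_diff_distrib integral_diff)
  \<comment> \<open>Write \<open>H = (H - c) + c\<close> in front of
    \<open>\<phi>' = w (H - c)\<close>; the part with the constant \<open>c\<close> integrates to
    0.\<close>
  moreover have "integral {a..b} (\<lambda>x. H x * \<phi>' x) =
      integral {a..b} (\<lambda>x. w x * (H x - c)\<^sup>2 + c * \<phi>' x)"
    by (rule integral_cong) (auto simp: \<phi>'_def power2_eq_square algebra_simps)
  moreover have cq: "continuous_on {a..b} (\<lambda>x. w x * (H x - c)\<^sup>2)"
    by (intro continuous_intros cw cH)
  moreover have "integral {a..b} (\<lambda>x. w x * (H x - c)\<^sup>2 + c * \<phi>' x) =
      integral {a..b} (\<lambda>x. w x * (H x - c)\<^sup>2)"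
    using integrable_continuous_real[OF cq] int0
    by (subst integral_add) (auto intro: \<phi>'i integrable_on_mult_right)
  ultimately have "integral {a..b} (\<lambda>x. w x * (H x - c)\<^sup>2) = 0" by simp
  then have "\<forall>x\<in>{a..b}. w x * (H x - c)\<^sup>2 = 0"
    using integral_eq_0_iff[OF cq ab] wnn by auto
  then have Hc: "H x = c" if "x \<in> {a<..<b}" for x
    using that wpos[of x] by force
  have "closure {a<..<b} = {a..b}" using ab by simp
  then have "H x = c" if "x \<in> {a..b}" for x
    using continuous_constant_on_closure[of "{a<..<b}" H c] cH Hc that by simp
  then have "H b = H a" using ab by simp
  then show ?thesis by (simp add: H_def)
qed

text \<open>Test functions see only the interior of \<open>S\<close>. There \<open>f\<close> minus
  the primitive of \<open>g\<close> is constant, and continuity carries this to end points that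
  belong to \<open>S\<close>, such as the vertices of an edge.\<close>

lemma ac_on_if_has_weak_deriv:
  assumes wd: "has_weak_deriv S f g" and S: "is_interval S" "S \<in> sets lebesgue"
    and cf: "continuous_on S f" and g: "g \<in> L2_on S"
  shows "ac_on S f g"
  unfolding ac_on_def
proof (intro ballI impI)
  fix x y assume xy: "x \<in> S" "y \<in> S" "x \<le> y"
  have sub: "{x..y} \<subseteq> S" using xy S(1) by (meson atLeastAtMost_iff mem_is_interval_1_I subsetI)
  have gabs: "g absolutely_integrable_on {x..y}"
    by (rule L2_on_absolutely_integrable[OF g S(2) sub])
  then have gi: "g integrable_on {x..y}" by (simp add: absolutely_integrable_on_def)
  have "f y - f x = integral {x..y} g"
  proof (cases "x = y")
    case False
    then have "x < y" using xy by simp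
    define H where "H = (\<lambda>t. f t - integral {x..t} g)"
    have cH: "continuous_on {x..y} H"
      unfolding H_def
      by (intro continuous_intros indefinite_integral_continuous_1 gi continuous_on_subset[OF cf sub])
    define z where "z = (x + y) / 2"
    have z: "x < z" "z < y" using \<open>x < y\<close> by (auto simp: z_def)
    have incr: "H s = H t" if st: "x < s" "s < t" "t < y" for s t
    proof -
      have "{s..t} \<subseteq> {x<..<y}" using st by auto
      also have "\<dots> \<subseteq> interior S" by (rule interior_maximal) (use sub in auto)
      finally have int: "{s..t} \<subseteq> interior S" .
      have st': "{s..t} \<subseteq> {x..y}" using st by auto
      have "f t - f s = integral {s..t} g"
        using increment_if_has_weak_deriv_interior[OF wd S(2) st(2) int]
          continuous_on_subset[OF cf] absolutely_integrable_on_subinterval[OF gabs st'] st' sub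
        by blast
      moreover have "integral {x..s} g + integral {s..t} g = integral {x..t} g"
        using st integrable_subinterval_real[OF gi, of x t]
        by (intro Henstock_Kurzweil_Integration.integral_combine) auto
      ultimately show ?thesis by (simp add: H_def)
    qed
    have Hz: "H t = H z" if "t \<in> {x<..<y}" for t
    proof (cases t z rule: linorder_cases)
      case less
      then show ?thesis by (intro incr) (use that z in auto)
    next
      case greater
      then show ?thesis by (intro incr[symmetric]) (use that z in auto)
    qed simp
    have "H t = H z" if "t \<in> {x..y}" for t
      using continuous_constant_on_closure[of "{x<..<y}" H "H z"] cH Hz that \<open>x < y\<close> by simp
    from this[of x] this[of y] have "H y = H x" using xy by simp
    then show ?thesis by (simp add: H_def)
  qed simp
  then show "g absolutely_integrable_on {x..y} \<and> f y - f x = integral {x..y} g"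
    using gabs by blast
qed

text \<open>Closedness of \<open>S\<close> makes its intersection with \<open>[a, b]\<close> a
  compact interval, on which both derivatives have the same integral. So \<open>g - k\<close>,
  extended by 0, has integral 0 over every interval, and Lebesgue differentiation makes it vanish
  almost everywhere.\<close>

lemma ac_on_deriv_unique:
  assumes f: "ac_on S f g" "ac_on S f k" and S: "is_interval S" "closed S"
  shows "AE x in lebesgue_on S. g x = k x"
proof -
  define h where "h = (\<lambda>x. if x \<in> S then g x - k x else 0)"
  have h: "(h has_integral 0) {a..b}" for a b
  proof (cases "{a..b} \<inter> S = {}")
    case True
    then show ?thesis
      by (intro has_integral_is_0) (auto simp: h_def)
  next
    case False
    have "compact ({a..b} \<inter> S)" "is_interval ({a..b} \<inter> S)"
      using S is_interval_Int is_interval_cc by (auto intro!: compact_Int_closed is_interval_Int is_interval_cc)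
    then obtain c d where cd: "{a..b} \<inter> S = {c..d}"
      using is_interval_compact by (metis box_real(2))
    have cdle: "c \<le> d" using False cd by (metis atLeastatMost_empty_iff2)
    then have "c \<in> {a..b} \<inter> S" "d \<in> {a..b} \<inter> S" unfolding cd by auto
    then have "c \<in> S" "d \<in> S" by blast+
    then have "g absolutely_integrable_on {c..d} \<and> f d - f c = integral {c..d} g"
        "k absolutely_integrable_on {c..d} \<and> f d - f c = integral {c..d} k"
      using f cdle unfolding ac_on_def by blast+
    then have "g integrable_on {c..d}" "k integrable_on {c..d}" "integral {c..d} g = integral {c..d} k"
      by (auto simp: absolutely_integrable_on_def)
    then have "((\<lambda>x. g x - k x) has_integral 0) {c..d}"
      using has_integral_diff[of g _ "{c..d}" k] by (metis diff_self integrable_integral)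
    then have "((\<lambda>x. if x \<in> S then g x - k x else 0) has_integral 0) {a..b}"
      using has_integral_restrict_Int[of S "\<lambda>x. g x - k x" 0 "{a..b}"] cd by (simp add: Int_commute)
    then show ?thesis by (simp add: h_def)
  qed
  \<comment> \<open>Off \<open>N\<close> the averages of \<open>h\<close> over
    \<open>[x, x + r]\<close> approach \<open>h x\<close>, yet all of them are 0.\<close>
  obtain N where N: "negligible N"
    "\<And>x e. \<lbrakk>x \<notin> N; 0 < e\<rbrakk> \<Longrightarrow> \<exists>d>0. \<forall>r. 0 < r \<and> r < d \<longrightarrow>
       norm (integral (cbox x (x + r *\<^sub>R One)) h /\<^sub>R r ^ DIM(real) - h x) < e"
    using integrable_ccontinuous_explicit[of h] h by (metis box_real(2) has_integral_integrable)
  have "h x = 0" if xN: "x \<notin> N" for x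
  proof (rule ccontr)
    assume "h x \<noteq> 0"
    then obtain d where d: "d > 0" "\<forall>r. 0 < r \<and> r < d \<longrightarrow>
       norm (integral (cbox x (x + r *\<^sub>R One)) h /\<^sub>R r ^ DIM(real) - h x) < \<bar>h x\<bar>"
      using N(2)[OF xN, of "\<bar>h x\<bar>"] by auto
    have "integral (cbox x (x + (d / 2) *\<^sub>R One)) h = 0"
      using h[of x "x + d / 2"] by (simp add: integral_unique)
    then show False using d(2)[rule_format, of "d / 2"] d(1) by simp
  qed
  then have "AE x in lebesgue. h x = 0"
    using N(1) by (auto simp: eventually_ae_filter_negligible)
  then have "AE x in lebesgue. x \<in> S \<longrightarrow> g x = k x"
    by eventually_elim (auto simp: h_def split: if_splits)
  then show ?thesis
    using S(2) by (subst AE_restrict_space_iff) auto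
qed

lemma ac_on_continuous:
  assumes f: "ac_on S f g" and S: "is_interval S" "closed S"
  shows "continuous_on S f"
  unfolding continuous_on_eq_continuous_within
proof
  fix x assume x: "x \<in> S"
  have "compact ({x - 1..x + 1} \<inter> S)" "is_interval ({x - 1..x + 1} \<inter> S)"
    using S by (auto intro!: compact_Int_closed is_interval_Int is_interval_cc)
  then obtain c d where cd: "{x - 1..x + 1} \<inter> S = {c..d}"
    using is_interval_compact by (metis box_real(2))
  have "continuous_on ({x - 1..x + 1} \<inter> S) f"
    unfolding cd by (rule ac_on_continuous_Icc[OF ac_on_subset[OF f]]) (use cd in blast)
  then have "continuous (at x within {x - 1..x + 1} \<inter> S) f"
    using x by (simp add: continuous_on_eq_continuous_within)
  moreover have "at x within {x - 1..x + 1} \<inter> S = at x within S"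
    by (rule at_within_nhd[of x "{x - 1<..<x + 1}"]) auto
  ultimately show "continuous (at x within S) f" by simp
qed

text \<open>\<open>weak_deriv\<close> is a choice among representatives; for continuous
  \<open>f\<close> whichever one is chosen satisfies the fundamental theorem, with no exceptional
  points.\<close>

lemma H1_on_weak_deriv:
  assumes f: "f \<in> H1_on S" "continuous_on S f" and S: "is_interval S" "closed S"
  shows "weak_deriv S f \<in> L2_on S" "ac_on S f (weak_deriv S f)"
proof -
  have "\<exists>g. g \<in> L2_on S \<and> has_weak_deriv S f g"
    using f(1) by (auto simp: H1_on_def)
  then have "weak_deriv S f \<in> L2_on S \<and> has_weak_deriv S f (weak_deriv S f)"
    unfolding weak_deriv_def by (rule someI_ex)
  then show "weak_deriv S f \<in> L2_on S" "ac_on S f (weak_deriv S f)"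
    using ac_on_if_has_weak_deriv f(2) S by auto
qed

text \<open>The way back: an explicitly computed derivative agrees almost everywhere with the
  representative chosen by \<open>weak_deriv\<close>, hence may replace it under integrals.\<close>

lemma ac_on_H1_on:
  assumes f: "ac_on S f k" "f \<in> L2_on S" "k \<in> L2_on S" and S: "is_interval S" "closed S"
  shows "f \<in> H1_on S" "AE x in lebesgue_on S. weak_deriv S f x = k x"
proof -
  show H: "f \<in> H1_on S"
    using f has_weak_deriv_if_ac_on[OF f(1)] S by (auto simp: H1_on_def)
  show "AE x in lebesgue_on S. weak_deriv S f x = k x"
    using H1_on_weak_deriv(2)[OF H ac_on_continuous[OF f(1) S] S] f(1) S
    by (rule ac_on_deriv_unique)
qed

section \<open>Compactly supported test functions on a graph\<close>

lemma is_interval_edge_dom: "is_interval (edge_dom G e)"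
  unfolding is_interval_1 edge_dom_def by (auto intro: order_trans[of "ereal _" "ereal _"])

lemma edge_dom_bounded_part:
  assumes "0 < len G e" "0 \<le> R"
  obtains r where "0 \<le> r" "edge_dom G e \<inter> {..R} = {0..r}"
proof (cases "len G e")
  case (real l)
  then have "edge_dom G e \<inter> {..R} = {0..min l R}" by (auto simp: edge_dom_def)
  then show ?thesis using assms real by (intro that[of "min l R"]) auto
next
  case PInf
  then have "edge_dom G e \<inter> {..R} = {0..R}" by (auto simp: edge_dom_def)
  then show ?thesis using assms by (intro that[of R]) auto
qed (use assms in auto)

lemma closed_edge_dom: "closed (edge_dom G e)"
proof -
  have "edge_dom G e = {0..} \<inter> {x. ereal x \<le> len G e}" by (auto simp: edge_dom_def)
  moreover have "closed {x. ereal x \<le> len G e}"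
    by (intro closed_Collect_le continuous_intros)
  ultimately show ?thesis by auto
qed

lemma edge_dom_lebesgue [simp]: "edge_dom G e \<in> sets lebesgue"
  by (simp add: closed_edge_dom)

lemma continuous_on_edge_measurable:
  assumes "continuous_on (edge_dom G e) q"
  shows "q \<in> borel_measurable (lebesgue_on (edge_dom G e))"
  using assms by (intro continuous_imp_measurable_on_sets_lebesgue) auto

lemma integrable_edge_supported:
  fixes q :: "real \<Rightarrow> real"
  assumes len: "0 < len G e" and q: "continuous_on (edge_dom G e) q"
    and zero: "\<And>t. t \<in> edge_dom G e \<Longrightarrow> R < t \<Longrightarrow> q t = 0"
  shows "integrable (lebesgue_on (edge_dom G e)) q"
proof -
  obtain r where r: "0 \<le> r" "edge_dom G e \<inter> {..max 0 R} = {0..r}"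
    using edge_dom_bounded_part[OF len, of "max 0 R"] by auto
  have sub: "{0..r} \<subseteq> edge_dom G e" using r by blast
  show ?thesis
  proof (rule lebesgue_on_supported(1)[OF _ sub])
    show "q t = 0" if "t \<in> edge_dom G e" "t \<notin> {0..r}" for t
    proof -
      have "\<not> t \<le> max 0 R" using that r(2) by blast
      then show ?thesis using zero that by simp
    qed
    show "q absolutely_integrable_on {0..r}"
      by (intro absolutely_integrable_continuous_real continuous_on_subset[OF q sub])
  qed simp
qed

lemma integrable_edge_mult:
  fixes q m :: "real \<Rightarrow> real"
  assumes len: "0 < len G e" and q: "continuous_on (edge_dom G e) q"
    and zero: "\<And>t. t \<in> edge_dom G e \<Longrightarrow> R < t \<Longrightarrow> q t = 0"
    and m: "m \<in> borel_measurable (lebesgue_on (edge_dom G e))"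
      "AE t in lebesgue_on (edge_dom G e). \<bar>m t\<bar> \<le> C"
  shows "integrable (lebesgue_on (edge_dom G e)) (\<lambda>t. m t * q t)"
proof (rule Bochner_Integration.integrable_bound)
  show "integrable (lebesgue_on (edge_dom G e)) (\<lambda>t. C * q t)"
    by (intro integrable_mult_right integrable_edge_supported[OF len q zero])
  show "(\<lambda>t. m t * q t) \<in> borel_measurable (lebesgue_on (edge_dom G e))"
    by (intro borel_measurable_times m continuous_on_edge_measurable q)
  show "AE t in lebesgue_on (edge_dom G e). norm (m t * q t) \<le> norm (C * q t)"
    using m(2) by eventually_elim (auto simp: abs_mult intro!: mult_right_mono)
qed

text \<open>Universal property of the quotient topology. Agreement at common vertices is built in,
  because all restrictions come from one function on points.\<close>

lemma continuous_map_graph_topology_iff: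
  assumes "wf_metric_graph G"
  shows "continuous_map (graph_topology G) euclideanreal f \<longleftrightarrow>
    (\<forall>e\<in>edges G. continuous_on (edge_dom G e) (restr G f e))"
proof -
  have "{t \<in> edge_dom G e. par G e t \<in> {x \<in> points G. f x \<in> U}} =
      {t \<in> edge_dom G e. restr G f e t \<in> U}" if "e \<in> edges G" for e U
    using par_in_points[OF assms that] by (auto simp: restr_def)
  then have "continuous_map (graph_topology G) euclideanreal f \<longleftrightarrow>
    (\<forall>U. open U \<longrightarrow> (\<forall>e\<in>edges G. openin (top_of_set (edge_dom G e)) {t \<in> edge_dom G e. restr G f e t \<in> U}))"
    by (simp add: continuous_map_def topspace_graph_topology[OF assms] openin_graph_topology)
  also have "\<dots> \<longleftrightarrow> (\<forall>e\<in>edges G. continuous_map (top_of_set (edge_dom G e)) euclideanreal (restr G f e))"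
    by (auto simp: continuous_map_def)
  finally show ?thesis by simp
qed

lemma continuous_map_par:
  assumes "wf_metric_graph G" "e \<in> edges G"
  shows "continuous_map (top_of_set (edge_dom G e)) (graph_topology G) (par G e)"
  using assms by (auto simp: continuous_map_def topspace_graph_topology par_in_points openin_graph_topology)

lemma H1_edge:
  assumes wf: "wf_metric_graph G" and u: "u \<in> H1 G" and e: "e \<in> edges G"
  shows "continuous_on (edge_dom G e) (restr G u e)"
    "restr G u e \<in> L2_on (edge_dom G e)"
    "gderiv G u e \<in> L2_on (edge_dom G e)"
    "ac_on (edge_dom G e) (restr G u e) (gderiv G u e)"
proof -
  show c: "continuous_on (edge_dom G e) (restr G u e)"
    using u e continuous_map_graph_topology_iff[OF wf] by (auto simp: H1_def)
  have H: "restr G u e \<in> H1_on (edge_dom G e)" using u e by (auto simp: H1_def)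
  then show "restr G u e \<in> L2_on (edge_dom G e)" by (simp add: H1_on_def)
  show "gderiv G u e \<in> L2_on (edge_dom G e)"
    "ac_on (edge_dom G e) (restr G u e) (gderiv G u e)"
    unfolding gderiv_def using H1_on_weak_deriv[OF H c is_interval_edge_dom closed_edge_dom] by auto
qed

text \<open>A compactly supported function together with a pointwise derivative \<open>k\<close>,
  which survives sums and products where the chosen \<open>gderiv\<close> could be followed only up
  to null sets. The first clause lets edges cover all points where \<open>\<phi>\<close> is nonzero,
  isolated vertices being invisible to the other clauses. The last clause is compactness of the
  support in terms of edges: finitely many of them, and bounded parameters on half-lines.\<close>

definition test_pair ::
  "('v, 'e) metric_graph \<Rightarrow> (('v, 'e) gpoint \<Rightarrow> real) \<Rightarrow> ('e \<Rightarrow> real \<Rightarrow> real) \<Rightarrow> bool" where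
  "test_pair G \<phi> k \<longleftrightarrow>
     (\<forall>x. \<phi> x \<noteq> 0 \<longrightarrow> (\<exists>e\<in>edges G. \<exists>t\<in>edge_dom G e. x = par G e t)) \<and>
     (\<forall>e\<in>edges G. ac_on (edge_dom G e) (restr G \<phi> e) (k e) \<and> k e \<in> L2_on (edge_dom G e)) \<and>
     (\<exists>F R. finite F \<and> (\<forall>e\<in>edges G. \<forall>t\<in>edge_dom G e. e \<notin> F \<or> R < t \<longrightarrow>
        restr G \<phi> e t = 0 \<and> k e t = 0))"

lemma test_pair_support:
  assumes "test_pair G \<phi> k"
  obtains F R where "finite F" "F \<subseteq> edges G" "0 \<le> R"
    "\<And>e t. e \<in> edges G \<Longrightarrow> t \<in> edge_dom G e \<Longrightarrow> e \<notin> F \<or> R < t \<Longrightarrow> restr G \<phi> e t = 0 \<and> k e t = 0"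
proof -
  obtain F R where "finite F" "\<forall>e\<in>edges G. \<forall>t\<in>edge_dom G e. e \<notin> F \<or> R < t \<longrightarrow>
      restr G \<phi> e t = 0 \<and> k e t = 0"
    using assms unfolding test_pair_def by blast
  then show ?thesis
    using that[of "F \<inter> edges G" "max R 0"] by auto
qed

lemma par_in_edges_not_end:
  assumes "par G e t = par G e' s" "t \<noteq> 0" "ereal t \<noteq> len G e"
  shows "e = e' \<and> t = s"
  using assms by (auto simp: par_def split: if_splits)

text \<open>The support lies in a finite union \<open>K\<close> of compact pieces of edges. Its
  closure is compact once \<open>K\<close> is known to be closed, and closedness is tested edge by
  edge in the quotient topology.\<close>

lemma test_pair_Cc:
  assumes wf: "wf_metric_graph G" and tp: "test_pair G \<phi> k"
  shows "\<phi> \<in> Cc G"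
proof -
  obtain F R where FR: "finite F" "F \<subseteq> edges G" "0 \<le> R"
    "\<And>e t. e \<in> edges G \<Longrightarrow> t \<in> edge_dom G e \<Longrightarrow> e \<notin> F \<or> R < t \<Longrightarrow> restr G \<phi> e t = 0 \<and> k e t = 0"
    using test_pair_support[OF tp] by metis
  define I where "I = (\<lambda>e. edge_dom G e \<inter> {..R})"
  have I: "compact (I e)" "I e \<subseteq> edge_dom G e" if "e \<in> edges G" for e
  proof -
    have "0 < len G e" using wf that by (auto simp: wf_metric_graph_def)
    then obtain r where "edge_dom G e \<inter> {..R} = {0..r}"
      using edge_dom_bounded_part FR(3) by metis
    then show "compact (I e)" by (simp add: I_def)
  qed (simp add: I_def)
  define K where "K = (\<Union>e\<in>F. par G e ` I e)"
  have Kpts: "K \<subseteq> points G"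
    using par_in_points[OF wf] FR(2) I(2) by (fastforce simp: K_def)
  have "compactin (graph_topology G) (par G e ` I e)" if "e \<in> F" for e
  proof (rule image_compactin)
    have "e \<in> edges G" using that FR(2) by blast
    then show "compactin (top_of_set (edge_dom G e)) (I e)"
      using I by (simp add: compactin_subtopology)
    show "continuous_map (top_of_set (edge_dom G e)) (graph_topology G) (par G e)"
      by (rule continuous_map_par[OF wf \<open>e \<in> edges G\<close>])
  qed
  then have Kcomp: "compactin (graph_topology G) K"
    unfolding K_def using FR(1) by (intro compactin_Union) auto
  have "openin (top_of_set (edge_dom G e)) {t \<in> edge_dom G e. par G e t \<in> points G - K}"
    if e: "e \<in> edges G" for e
  proof -
    \<comment> \<open>End points of \<open>e\<close> may belong to \<open>K\<close> through another
      edge at the same vertex; these finitely many parameters do not disturb closedness. On a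
      half-line \<open>real_of_ereal\<close> of the infinite length is 0, so the set of candidates
      reduces to the starting point.\<close>
    define E where "E = {t \<in> edge_dom G e. par G e t \<in> K} \<inter> {0, real_of_ereal (len G e)}"
    have eq: "{t \<in> edge_dom G e. par G e t \<in> K} = (if e \<in> F then I e else {}) \<union> E"
    proof (intro equalityI subsetI)
      fix t assume t: "t \<in> {t \<in> edge_dom G e. par G e t \<in> K}"
      then obtain e' s where s: "e' \<in> F" "s \<in> I e'" "par G e t = par G e' s" by (auto simp: K_def)
      show "t \<in> (if e \<in> F then I e else {}) \<union> E"
      proof (cases "t = 0 \<or> ereal t = len G e")
        case True
        then have "t \<in> {0, real_of_ereal (len G e)}" by (metis insertCI real_of_ereal.simps(1))
        then show ?thesis using t by (simp add: E_def)
      next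
        case False
        then show ?thesis using par_in_edges_not_end[OF s(3)] s by auto
      qed
    next
      fix t assume t: "t \<in> (if e \<in> F then I e else {}) \<union> E"
      then show "t \<in> {t \<in> edge_dom G e. par G e t \<in> K}"
        using I(2)[OF e] by (auto simp: K_def E_def split: if_splits)
    qed
    have "finite E" by (simp add: E_def)
    then have "closed ((if e \<in> F then I e else {}) \<union> E)"
      using compact_imp_closed[OF I(1)[OF e]] by (auto intro!: closed_Un intro: finite_imp_closed)
    moreover have "{t \<in> edge_dom G e. par G e t \<in> points G - K} =
        edge_dom G e \<inter> - ((if e \<in> F then I e else {}) \<union> E)"
      using par_in_points[OF wf e] eq by blast
    ultimately show ?thesis by (metis openin_open_Int open_Compl)
  qed
  then have "openin (graph_topology G) (points G - K)"
    by (simp add: openin_graph_topology)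
  then have Kcl: "closedin (graph_topology G) K"
    using Kpts by (simp add: closedin_def topspace_graph_topology[OF wf])
  have sub: "{x \<in> points G. \<phi> x \<noteq> 0} \<subseteq> K"
  proof
    fix x assume "x \<in> {x \<in> points G. \<phi> x \<noteq> 0}"
    then obtain e t where et: "e \<in> edges G" "t \<in> edge_dom G e" "x = par G e t" "\<phi> x \<noteq> 0"
      using tp unfolding test_pair_def by blast
    then have "restr G \<phi> e t \<noteq> 0" by (simp add: restr_def)
    then have "\<not> (e \<notin> F \<or> R < t)"
      using FR(4)[OF et(1,2)] by blast
    then have "e \<in> F" "t \<in> I e" using et(2) by (auto simp: I_def)
    then show "x \<in> K" using et by (auto simp: K_def)
  qed
  have "compactin (graph_topology G) (graph_topology G closure_of {x \<in> points G. \<phi> x \<noteq> 0})"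
    by (rule closed_compactin[OF Kcomp closure_of_minimal[OF sub Kcl]]) simp
  moreover have "\<phi> x = 0" if "x \<notin> points G" for x
    using tp that par_in_points[OF wf] unfolding test_pair_def by blast
  moreover have "continuous_map (graph_topology G) euclideanreal \<phi>"
    unfolding continuous_map_graph_topology_iff[OF wf]
  proof
    fix e assume "e \<in> edges G"
    then have "ac_on (edge_dom G e) (restr G \<phi> e) (k e)"
      using tp by (simp add: test_pair_def)
    then show "continuous_on (edge_dom G e) (restr G \<phi> e)"
      by (rule ac_on_continuous[OF _ is_interval_edge_dom closed_edge_dom])
  qed
  ultimately show ?thesis by (simp add: Cc_def)
qed

lemma test_pair_edge:
  assumes wf: "wf_metric_graph G" and tp: "test_pair G \<phi> k" and e: "e \<in> edges G"
  shows "continuous_on (edge_dom G e) (restr G \<phi> e)"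
    "restr G \<phi> e \<in> L2_on (edge_dom G e)"
    "k e \<in> L2_on (edge_dom G e)"
    "restr G \<phi> e \<in> H1_on (edge_dom G e)"
    "gderiv G \<phi> e \<in> borel_measurable (lebesgue_on (edge_dom G e))"
    "AE t in lebesgue_on (edge_dom G e). gderiv G \<phi> e t = k e t"
proof -
  have ac: "ac_on (edge_dom G e) (restr G \<phi> e) (k e)" and k: "k e \<in> L2_on (edge_dom G e)"
    using tp e by (auto simp: test_pair_def)
  show "k e \<in> L2_on (edge_dom G e)" by (rule k)
  show c: "continuous_on (edge_dom G e) (restr G \<phi> e)"
    by (rule ac_on_continuous[OF ac is_interval_edge_dom closed_edge_dom])
  obtain F R where FR: "\<And>e t. e \<in> edges G \<Longrightarrow> t \<in> edge_dom G e \<Longrightarrow> e \<notin> F \<or> R < t \<Longrightarrow>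
      restr G \<phi> e t = 0 \<and> k e t = 0"
    using test_pair_support[OF tp] by metis
  have len: "0 < len G e" using wf e by (auto simp: wf_metric_graph_def)
  have "integrable (lebesgue_on (edge_dom G e)) (\<lambda>t. (restr G \<phi> e t)\<^sup>2)"
    by (rule integrable_edge_supported[OF len, where R = R])
      (use FR[OF e] c in \<open>auto intro: continuous_intros\<close>)
  then show L2: "restr G \<phi> e \<in> L2_on (edge_dom G e)"
    using continuous_on_edge_measurable[OF c] by (simp add: L2_on_def)
  show H: "restr G \<phi> e \<in> H1_on (edge_dom G e)"
    by (rule ac_on_H1_on(1)[OF ac L2 k is_interval_edge_dom closed_edge_dom])
  show "AE t in lebesgue_on (edge_dom G e). gderiv G \<phi> e t = k e t"
    unfolding gderiv_def by (rule ac_on_H1_on(2)[OF ac L2 k is_interval_edge_dom closed_edge_dom])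
  show "gderiv G \<phi> e \<in> borel_measurable (lebesgue_on (edge_dom G e))"
    using H1_on_weak_deriv(1)[OF H c is_interval_edge_dom closed_edge_dom]
    by (simp add: gderiv_def L2_on_def)
qed

lemma test_pair_H1:
  assumes wf: "wf_metric_graph G" and tp: "test_pair G \<phi> k"
  shows "\<phi> \<in> H1 G"
proof -
  obtain F R where FR: "finite F" "\<And>e t. e \<in> edges G \<Longrightarrow> t \<in> edge_dom G e \<Longrightarrow> e \<notin> F \<or> R < t \<Longrightarrow>
      restr G \<phi> e t = 0 \<and> k e t = 0"
    using test_pair_support[OF tp] by metis
  have "(LINT x|lebesgue_on (edge_dom G e). (gderiv G \<phi> e x)\<^sup>2) +
        (LINT x|lebesgue_on (edge_dom G e). (restr G \<phi> e x)\<^sup>2) = 0"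
    if e: "e \<in> edges G" "e \<notin> F" for e
  proof -
    have "(LINT x|lebesgue_on (edge_dom G e). (gderiv G \<phi> e x)\<^sup>2) =
        (LINT x|lebesgue_on (edge_dom G e). (k e x)\<^sup>2)"
      using test_pair_edge(3,5,6)[OF wf tp e(1)]
      by (intro integral_cong_AE) (auto simp: L2_on_def)
    moreover have "(LINT x|lebesgue_on (edge_dom G e). (k e x)\<^sup>2) = 0"
      "(LINT x|lebesgue_on (edge_dom G e). (restr G \<phi> e x)\<^sup>2) = 0"
      using FR(2)[OF e(1)] e(2) by (auto intro!: integral_eq_zero_AE)
    ultimately show ?thesis by simp
  qed
  then have "finite {e \<in> edges G. (LINT x|lebesgue_on (edge_dom G e). (gderiv G \<phi> e x)\<^sup>2) +
        (LINT x|lebesgue_on (edge_dom G e). (restr G \<phi> e x)\<^sup>2) \<noteq> 0}"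
    by (intro finite_subset[OF _ FR(1)]) auto
  then have "(\<lambda>e. (LINT x|lebesgue_on (edge_dom G e). (gderiv G \<phi> e x)\<^sup>2) +
          (LINT x|lebesgue_on (edge_dom G e). (restr G \<phi> e x)\<^sup>2)) summable_on edges G"
    by (rule finite_nonzero_values_imp_summable_on)
  then show ?thesis
    using test_pair_Cc[OF wf tp] test_pair_edge(4)[OF wf tp] by (simp add: H1_def Cc_def)
qed

section \<open>Linear combinations of test pairs\<close>

lemma ac_on_add:
  assumes "ac_on S f f'" "ac_on S g g'"
  shows "ac_on S (\<lambda>x. f x + g x) (\<lambda>x. f' x + g' x)"
  unfolding ac_on_def
proof (intro ballI impI conjI)
  fix x y assume xy: "x \<in> S" "y \<in> S" "x \<le> y"
  have *: "f' absolutely_integrable_on {x..y}" "f y - f x = integral {x..y} f'"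
    "g' absolutely_integrable_on {x..y}" "g y - g x = integral {x..y} g'"
    using assms xy unfolding ac_on_def by blast+
  show "(\<lambda>x. f' x + g' x) absolutely_integrable_on {x..y}"
    by (intro set_integral_add *)
  have "integral {x..y} (\<lambda>x. f' x + g' x) = integral {x..y} f' + integral {x..y} g'"
    using *(1,3) by (intro integral_add) (auto simp: absolutely_integrable_on_def)
  then show "f y + g y - (f x + g x) = integral {x..y} (\<lambda>x. f' x + g' x)"
    using *(2,4) by linarith
qed

lemma ac_on_cmult:
  assumes "ac_on S f f'"
  shows "ac_on S (\<lambda>x. c * f x) (\<lambda>x. c * f' x)"
  unfolding ac_on_def
proof (intro ballI impI conjI)
  fix x y assume xy: "x \<in> S" "y \<in> S" "x \<le> y"
  have *: "f' absolutely_integrable_on {x..y}" "f y - f x = integral {x..y} f'"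
    using assms xy unfolding ac_on_def by blast+
  show "(\<lambda>x. c * f' x) absolutely_integrable_on {x..y}"
    using * by (intro set_integrable_mult_right) auto
  show "c * f y - c * f x = integral {x..y} (\<lambda>x. c * f' x)"
    using *(2) by (simp flip: right_diff_distrib)
qed

lemma L2_on_add: "f \<in> L2_on S \<Longrightarrow> g \<in> L2_on S \<Longrightarrow> (\<lambda>x. f x + g x) \<in> L2_on S"
proof -
  assume f: "f \<in> L2_on S" and g: "g \<in> L2_on S"
  have "integrable (lebesgue_on S) (\<lambda>x. (f x + g x)\<^sup>2)"
  proof (rule Bochner_Integration.integrable_bound)
    show "integrable (lebesgue_on S) (\<lambda>x. 2 * (f x)\<^sup>2 + 2 * (g x)\<^sup>2)"
      using f g by (auto simp: L2_on_def)
    show "(\<lambda>x. (f x + g x)\<^sup>2) \<in> borel_measurable (lebesgue_on S)"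
      using f g by (auto simp: L2_on_def)
    show "AE x in lebesgue_on S. norm ((f x + g x)\<^sup>2) \<le> norm (2 * (f x)\<^sup>2 + 2 * (g x)\<^sup>2)"
    proof (rule AE_I2)
      fix x
      have "0 \<le> (f x - g x)\<^sup>2" by simp
      then have "(f x + g x)\<^sup>2 \<le> 2 * (f x)\<^sup>2 + 2 * (g x)\<^sup>2"
        by (simp add: power2_eq_square algebra_simps)
      then show "norm ((f x + g x)\<^sup>2) \<le> norm (2 * (f x)\<^sup>2 + 2 * (g x)\<^sup>2)"
        by simp
    qed
  qed
  then show ?thesis using f g by (auto simp: L2_on_def)
qed

lemma L2_on_cmult: "f \<in> L2_on S \<Longrightarrow> (\<lambda>x. c * f x) \<in> L2_on S"
  by (auto simp: L2_on_def power_mult_distrib)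

lemma test_pair_add:
  assumes "test_pair G \<phi> k" "test_pair G \<psi> l"
  shows "test_pair G (\<lambda>x. \<phi> x + \<psi> x) (\<lambda>e t. k e t + l e t)"
proof -
  obtain F1 R1 where 1: "finite F1" "\<And>e t. e \<in> edges G \<Longrightarrow> t \<in> edge_dom G e \<Longrightarrow> e \<notin> F1 \<or> R1 < t \<Longrightarrow>
      restr G \<phi> e t = 0 \<and> k e t = 0"
    using test_pair_support[OF assms(1)] by metis
  obtain F2 R2 where 2: "finite F2" "\<And>e t. e \<in> edges G \<Longrightarrow> t \<in> edge_dom G e \<Longrightarrow> e \<notin> F2 \<or> R2 < t \<Longrightarrow>
      restr G \<psi> e t = 0 \<and> l e t = 0"
    using test_pair_support[OF assms(2)] by metis
  have r: "restr G (\<lambda>x. \<phi> x + \<psi> x) e = (\<lambda>t. restr G \<phi> e t + restr G \<psi> e t)" for e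
    by (simp add: restr_def)
  show ?thesis
    unfolding test_pair_def r
  proof (intro conjI)
    show "\<forall>x. \<phi> x + \<psi> x \<noteq> 0 \<longrightarrow> (\<exists>e\<in>edges G. \<exists>t\<in>edge_dom G e. x = par G e t)"
    proof (intro allI impI)
      fix x assume "\<phi> x + \<psi> x \<noteq> 0"
      then have "\<phi> x \<noteq> 0 \<or> \<psi> x \<noteq> 0" by auto
      then show "\<exists>e\<in>edges G. \<exists>t\<in>edge_dom G e. x = par G e t"
        using assms unfolding test_pair_def by blast
    qed
    show "\<forall>e\<in>edges G. ac_on (edge_dom G e) (\<lambda>t. restr G \<phi> e t + restr G \<psi> e t) (\<lambda>t. k e t + l e t) \<and>
        (\<lambda>t. k e t + l e t) \<in> L2_on (edge_dom G e)"
      using assms ac_on_add L2_on_add unfolding test_pair_def by blast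
    show "\<exists>F R. finite F \<and> (\<forall>e\<in>edges G. \<forall>t\<in>edge_dom G e. e \<notin> F \<or> R < t \<longrightarrow>
        restr G \<phi> e t + restr G \<psi> e t = 0 \<and> k e t + l e t = 0)"
      using 1 2 by (intro exI[of _ "F1 \<union> F2"] exI[of _ "max R1 R2"]) simp
  qed
qed

lemma test_pair_cmult:
  assumes "test_pair G \<phi> k"
  shows "test_pair G (\<lambda>x. c * \<phi> x) (\<lambda>e t. c * k e t)"
proof -
  obtain F R where 1: "finite F" "\<And>e t. e \<in> edges G \<Longrightarrow> t \<in> edge_dom G e \<Longrightarrow> e \<notin> F \<or> R < t \<Longrightarrow>
      restr G \<phi> e t = 0 \<and> k e t = 0"
    using test_pair_support[OF assms] by metis
  have r: "restr G (\<lambda>x. c * \<phi> x) e = (\<lambda>t. c * restr G \<phi> e t)" for e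
    by (simp add: restr_def)
  show ?thesis
    unfolding test_pair_def r
  proof (intro conjI)
    show "\<forall>x. c * \<phi> x \<noteq> 0 \<longrightarrow> (\<exists>e\<in>edges G. \<exists>t\<in>edge_dom G e. x = par G e t)"
      using assms unfolding test_pair_def by (metis mult_zero_right)
    show "\<forall>e\<in>edges G. ac_on (edge_dom G e) (\<lambda>t. c * restr G \<phi> e t) (\<lambda>t. c * k e t) \<and>
        (\<lambda>t. c * k e t) \<in> L2_on (edge_dom G e)"
      using assms ac_on_cmult L2_on_cmult unfolding test_pair_def by blast
    show "\<exists>F R. finite F \<and> (\<forall>e\<in>edges G. \<forall>t\<in>edge_dom G e. e \<notin> F \<or> R < t \<longrightarrow>
        c * restr G \<phi> e t = 0 \<and> c * k e t = 0)"
      using 1 by (intro exI[of _ F] exI[of _ R]) simp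
  qed
qed

lemma test_pair_zero: "test_pair G (\<lambda>x. 0) (\<lambda>e t. 0)"
  by (auto simp: test_pair_def ac_on_def restr_def L2_on_def)

lemma test_pair_sum:
  assumes "finite I" "\<And>i. i \<in> I \<Longrightarrow> test_pair G (\<phi> i) (k i)"
  shows "test_pair G (\<lambda>x. \<Sum>i\<in>I. c i * \<phi> i x) (\<lambda>e t. \<Sum>i\<in>I. c i * k i e t)"
  using assms
  by (induction I rule: finite_induct)
    (simp_all add: test_pair_zero test_pair_add test_pair_cmult)

section \<open>Cutoff functions\<close>

text \<open>Covers the kink of the cutoff on a half-line. The uniform bound supplies integrability,
  continuity carries the fundamental theorem across \<open>K\<close>.\<close>

lemma ac_on_if_deriv_except_finite:
  assumes K: "finite K" and der: "\<And>x. x \<notin> K \<Longrightarrow> (f has_real_derivative f' x) (at x)"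
    and c: "continuous_on UNIV f" and m: "f' \<in> borel_measurable borel" and b: "\<And>x. \<bar>f' x\<bar> \<le> C"
  shows "ac_on S f f'"
  unfolding ac_on_def
proof (intro ballI impI conjI)
  fix x y :: real assume xy: "x \<le> y"
  show "f' absolutely_integrable_on {x..y}"
  proof (rule measurable_bounded_by_integrable_imp_absolutely_integrable)
    show "f' \<in> borel_measurable (lebesgue_on {x..y})"
      using m by (simp add: measurable_restrict_space1 measurable_completion)
    show "(\<lambda>x. C) integrable_on {x..y}" by (rule integrable_const_ivl)
  qed (use b in auto)
  have "(f' has_integral f y - f x) {x..y}"
  proof (rule fundamental_theorem_of_calculus_strong[OF K xy])
    show "continuous_on {x..y} f" by (rule continuous_on_subset[OF c]) simp
    show "(f has_vector_derivative f' z) (at z)" if "z \<in> {x..y} - K" for z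
      using der[of z] that by (simp add: has_real_derivative_iff_has_vector_derivative)
  qed
  then show "f y - f x = integral {x..y} f'" by (simp add: integral_unique)
qed

lemma finite_incident_vertices: "finite {w. incident G e w}"
  by (rule finite_subset[of _ "{src G e, tgt G e}"]) (auto simp: incident_def)

text \<open>\<open>h v\<close> is \<open>max 0 (1 - r / N)\<close>, where \<open>r\<close> is the
  combinatorial distance from \<open>v0\<close> to \<open>v\<close> (and 0 if \<open>v\<close> is
  out of reach). It changes by at most \<open>1 / N\<close> along an edge, and finite degrees keep
  the balls, hence the set of affected edges, finite.\<close>

lemma exists_vertex_cutoff:
  fixes G :: "('v, 'e) metric_graph"
  assumes G: "graph_class_G G" and N: "0 < N"
  obtains h :: "'v \<Rightarrow> real" where "h v0 = 1" "\<And>v. 0 \<le> h v" "\<And>v. h v \<le> 1"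
    "finite {e \<in> edges G. \<exists>v. incident G e v \<and> h v \<noteq> 0}"
    "\<And>e v w. e \<in> edges G \<Longrightarrow> incident G e v \<Longrightarrow> incident G e w \<Longrightarrow> \<bar>h v - h w\<bar> \<le> 1 / real N"
    "\<And>v. h v \<noteq> 0 \<Longrightarrow> v = v0 \<or> (\<exists>e\<in>edges G. incident G e v)"
proof -
  have wf: "wf_metric_graph G" using G by (simp add: graph_class_G_def)
  have fin: "finite {e \<in> edges G. incident G e v}" for v
  proof (cases "v \<in> verts G")
    case True
    then show ?thesis using G by (simp add: graph_class_G_def)
  next
    case False
    then have "{e \<in> edges G. incident G e v} = {}"
      using wf by (auto simp: wf_metric_graph_def incident_def)
    then show ?thesis by (metis finite.emptyI)
  qed
  \<comment> \<open>\<open>B k\<close> is the ball of radius \<open>k\<close> around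
    \<open>v0\<close> for the combinatorial distance.\<close>
  define B where "B = (\<lambda>k. ((\<lambda>S. S \<union> (\<Union>w\<in>S. \<Union>e\<in>{e \<in> edges G. incident G e w}. {v. incident G e v})) ^^ k) {v0})"
  have B0: "B 0 = {v0}" by (simp add: B_def)
  have BS: "B (Suc k) = B k \<union> (\<Union>w\<in>B k. \<Union>e\<in>{e \<in> edges G. incident G e w}. {v. incident G e v})" for k
    by (simp add: B_def)
  have Bfin: "finite (B k)" for k
    by (induction k) (auto simp: B0 BS simp del: mem_Collect_eq intro!: fin finite_incident_vertices)
  have Bv0: "v0 \<in> B k" for k
    by (induction k) (auto simp: B0 BS)
  have Badj: "w \<in> B (Suc k)" if "e \<in> edges G" "incident G e v" "incident G e w" "v \<in> B k" for e v w k
    using that by (auto simp: BS)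
  have Binc: "v = v0 \<or> (\<exists>e\<in>edges G. incident G e v)" if "v \<in> B k" for v k
    using that by (induction k) (auto simp: B0 BS)
  \<comment> \<open>Counting the balls that contain \<open>v\<close> avoids naming the distance: at
    distance \<open>r \<le> N\<close> these are the \<open>N - r\<close> balls of radius
    \<open>r\<close>, ..., \<open>N - 1\<close>.\<close>
  define h where "h = (\<lambda>v. real (card {k. k < N \<and> v \<in> B k}) / real N)"
  have one: "h v - h w \<le> 1 / real N"
    if "e \<in> edges G" "incident G e v" "incident G e w" for e v w
  proof -
    \<comment> \<open>A ball of radius \<open>k\<close> containing \<open>v\<close> yields one of
      radius \<open>k + 1\<close> containing \<open>w\<close>; for \<open>k = N - 1\<close> that
      radius is out of range, hence the extra element \<open>N\<close>.\<close>
    have "Suc ` {k. k < N \<and> v \<in> B k} \<subseteq> insert N {k. k < N \<and> w \<in> B k}"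
      using Badj[OF that] by (auto simp: less_Suc_eq[symmetric])
    then have "card (Suc ` {k. k < N \<and> v \<in> B k}) \<le> card (insert N {k. k < N \<and> w \<in> B k})"
      by (intro card_mono) auto
    also have "\<dots> \<le> Suc (card {k. k < N \<and> w \<in> B k})"
      by (rule card_insert_le_m1) auto
    finally have "card {k. k < N \<and> v \<in> B k} \<le> Suc (card {k. k < N \<and> w \<in> B k})"
      by (simp add: card_image)
    then have "real (card {k. k < N \<and> v \<in> B k}) \<le> 1 + real (card {k. k < N \<and> w \<in> B k})"
      by linarith
    then show ?thesis
      unfolding h_def diff_divide_distrib[symmetric] by (intro divide_right_mono) auto
  qed
  show ?thesis
  proof (rule that[of h])
    show "h v0 = 1" using Bv0 N by (simp add: h_def)
    show "0 \<le> h v" for v by (simp add: h_def)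
    show "h v \<le> 1" for v
    proof -
      have "card {k. k < N \<and> v \<in> B k} \<le> card {..<N}" by (intro card_mono) auto
      then show ?thesis using N by (simp add: h_def)
    qed
    have "{e \<in> edges G. \<exists>v. incident G e v \<and> h v \<noteq> 0}
        \<subseteq> (\<Union>k<N. \<Union>v\<in>B k. {e \<in> edges G. incident G e v})"
    proof
      fix e assume "e \<in> {e \<in> edges G. \<exists>v. incident G e v \<and> h v \<noteq> 0}"
      then obtain v where v: "e \<in> edges G" "incident G e v" "h v \<noteq> 0" by auto
      then have "{k. k < N \<and> v \<in> B k} \<noteq> {}" by (auto simp: h_def)
      then show "e \<in> (\<Union>k<N. \<Union>v\<in>B k. {e \<in> edges G. incident G e v})" using v by auto
    qed
    moreover have "finite (\<Union>k<N. \<Union>v\<in>B k. {e \<in> edges G. incident G e v})"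
      using fin Bfin by auto
    ultimately show "finite {e \<in> edges G. \<exists>v. incident G e v \<and> h v \<noteq> 0}"
      by (rule finite_subset)
    show "v = v0 \<or> (\<exists>e\<in>edges G. incident G e v)" if "h v \<noteq> 0" for v
    proof -
      have "{k. k < N \<and> v \<in> B k} \<noteq> {}" using that by (auto simp: h_def)
      then show ?thesis using Binc by blast
    qed
    show "\<bar>h v - h w\<bar> \<le> 1 / real N"
      if "e \<in> edges G" "incident G e v" "incident G e w" for e v w
      using one[OF that] one[OF that(1,3,2)] by linarith
  qed
qed

text \<open>The bounds hold at every point of an edge, not only almost everywhere.
  \<open>\<eta>\<close> need not vanish off \<open>points G\<close>: it is always multiplied by a
  function that does.\<close>

definition cutoff ::
  "('v, 'e) metric_graph \<Rightarrow> real \<Rightarrow> (('v, 'e) gpoint \<Rightarrow> real) \<Rightarrow> ('e \<Rightarrow> real \<Rightarrow> real) \<Rightarrow> bool" where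
  "cutoff G \<kappa> \<eta> d\<eta> \<longleftrightarrow>
     (\<forall>x\<in>points G. \<eta> x \<noteq> 0 \<longrightarrow> (\<exists>e\<in>edges G. \<exists>t\<in>edge_dom G e. x = par G e t)) \<and>
     (\<forall>e\<in>edges G. ac_on (edge_dom G e) (restr G \<eta> e) (d\<eta> e) \<and> d\<eta> e \<in> borel_measurable borel \<and>
        (\<forall>t\<in>edge_dom G e. \<bar>d\<eta> e t\<bar> \<le> \<kappa> \<and> \<bar>restr G \<eta> e t\<bar> \<le> 1)) \<and>
     (\<exists>F R. finite F \<and> (\<forall>e\<in>edges G. \<forall>t\<in>edge_dom G e. e \<notin> F \<or> R < t \<longrightarrow>
        restr G \<eta> e t = 0 \<and> d\<eta> e t = 0))"

text \<open>The cutoff is affine on bounded edges, with the vertex values of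
  \<open>exists_vertex_cutoff\<close>, and \<open>max 0 (h v - \<sigma> t)\<close> on a half-line from \<open>v\<close>.\<close>

lemma exists_cutoff:
  fixes G :: "('v, 'e) metric_graph"
  assumes G: "graph_class_G G" and e0: "e0 \<in> edges G" and \<kappa>: "0 < \<kappa>" and d: "0 \<le> d"
  obtains \<eta> d\<eta> where "cutoff G \<kappa> \<eta> d\<eta>"
    "\<And>t. t \<in> edge_dom G e0 \<Longrightarrow> t \<le> d \<Longrightarrow> 1 / 2 \<le> restr G \<eta> e0 t"
proof -
  have wf: "wf_metric_graph G" using G by (simp add: graph_class_G_def)
  have "0 < (INF e\<in>edges G. len G e)" using G by (simp add: graph_class_G_def)
  then obtain l0 where l0': "ereal 0 < ereal l0" "ereal l0 < (INF e\<in>edges G. len G e)"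
    using ereal_dense2[of 0] by (auto simp: zero_ereal_def)
  then have l0: "l0 > 0" "ereal l0 \<le> len G e" if "e \<in> edges G" for e
    using that by (auto intro: order_trans[OF less_imp_le INF_lower])
  \<comment> \<open>A vertex step of size \<open>1 / N\<close> on an edge of length at least
    \<open>l0\<close> has slope at most \<open>1 / (N * l0)\<close>, to be kept below
    \<open>\<kappa>\<close>.\<close>
  obtain N0 :: nat where N0: "1 / (\<kappa> * l0) < real N0" using reals_Archimedean2 by blast
  \<comment> \<open>With \<open>N \<ge> 2\<close> the far end of a bounded \<open>e0\<close> still
    has vertex value at least \<open>1 / 2\<close>.\<close>
  define N where "N = max N0 2"
  have N: "2 \<le> N" "1 / real N \<le> \<kappa> * l0"
  proof -
    have "1 / (\<kappa> * l0) \<le> real N" using N0 by (simp add: N_def)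
    then show "1 / real N \<le> \<kappa> * l0"
      using \<kappa> l0(1)[OF e0] by (simp add: field_simps N_def)
  qed (simp add: N_def)
  have Npos: "0 < N" using N(1) by simp
  \<comment> \<open>The slope on half-lines: at most \<open>\<kappa>\<close>, and so small that a
    half-line \<open>e0\<close> loses at most \<open>1 / 2\<close> up to parameter
    \<open>d\<close>.\<close>
  define \<sigma> where "\<sigma> = min \<kappa> (1 / (2 * (d + 1)))"
  have \<sigma>: "0 < \<sigma>" "\<sigma> \<le> \<kappa>" "\<sigma> * d \<le> 1 / 2"
  proof -
    have "\<sigma> * d \<le> 1 / (2 * (d + 1)) * d" using d by (intro mult_right_mono) (auto simp: \<sigma>_def)
    also have "\<dots> \<le> 1 / 2" using d by (simp add: field_simps)
    finally show "\<sigma> * d \<le> 1 / 2" .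
  qed (use \<kappa> d in \<open>auto simp: \<sigma>_def\<close>)
  obtain h :: "'v \<Rightarrow> real" where h: "h (src G e0) = 1" "\<And>v. 0 \<le> h v" "\<And>v. h v \<le> 1"
    and F: "finite {e \<in> edges G. \<exists>v. incident G e v \<and> h v \<noteq> 0}"
    and hadj: "\<And>e v w. e \<in> edges G \<Longrightarrow> incident G e v \<Longrightarrow> incident G e w \<Longrightarrow> \<bar>h v - h w\<bar> \<le> 1 / real N"
    and hinc: "\<And>v. h v \<noteq> 0 \<Longrightarrow> v = src G e0 \<or> (\<exists>e\<in>edges G. incident G e v)"
    by (rule exists_vertex_cutoff[OF G Npos, where ?v0.0 = "src G e0"], rule that)
  define L where "L = (\<lambda>e. real_of_ereal (len G e))"
  define E where "E = (\<lambda>e t. if len G e = \<infinity> then max 0 (h (src G e) - \<sigma> * t)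
      else h (src G e) + (h (tgt G e) - h (src G e)) / L e * t)"
  define \<eta> where "\<eta> = (\<lambda>x. case x of Vertex v \<Rightarrow> h v | Inner e t \<Rightarrow> E e t)"
  \<comment> \<open>The strict inequality gives slope 0 at the kink itself. A half-line with
    \<open>h (src G e) = 0\<close> thus has derivative 0 also at \<open>t = 0\<close>, as required
    for edges outside \<open>F\<close>.\<close>
  define d\<eta> where "d\<eta> = (\<lambda>e t. if len G e = \<infinity> then (if t < h (src G e) / \<sigma> then - \<sigma> else 0)
      else (h (tgt G e) - h (src G e)) / L e)"
  have lenL: "len G e = ereal (L e)" "l0 \<le> L e" "0 < L e" "edge_dom G e = {0..L e}"
      "incident G e (tgt G e)"
    if "e \<in> edges G" "len G e \<noteq> \<infinity>" for e
  proof -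
    have "0 < len G e" using wf that by (auto simp: wf_metric_graph_def)
    then show 1: "len G e = ereal (L e)" using that by (cases "len G e") (auto simp: L_def)
    then show "l0 \<le> L e" "0 < L e" using l0[OF that(1)] by auto
    show "edge_dom G e = {0..L e}" by (auto simp: edge_dom_def 1)
    show "incident G e (tgt G e)" by (auto simp: incident_def 1)
  qed
  have restr: "restr G \<eta> e t = E e t" if "e \<in> edges G" "t \<in> edge_dom G e" for e t
  proof -
    have "E e 0 = h (src G e)" using h by (simp add: E_def)
    moreover have "E e t = h (tgt G e)" if "ereal t = len G e" "t \<noteq> 0"
    proof -
      have "L e = t" "len G e \<noteq> \<infinity>" unfolding L_def that(1)[symmetric] by simp_all
      then show ?thesis using that(2) by (simp add: E_def)
    qed
    ultimately show ?thesis by (auto simp: restr_def \<eta>_def par_def)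
  qed
  have slope: "\<bar>(h (tgt G e) - h (src G e)) / L e\<bar> \<le> \<kappa>" if "e \<in> edges G" "len G e \<noteq> \<infinity>" for e
  proof -
    have "\<bar>h (tgt G e) - h (src G e)\<bar> \<le> 1 / real N"
      using hadj[OF that(1) lenL(5)[OF that]] by (simp add: incident_def)
    also have "\<dots> \<le> \<kappa> * L e" using N(2) lenL(2)[OF that] \<kappa>
      by (meson less_imp_le mult_left_mono order_trans)
    finally show ?thesis using lenL(3)[OF that] by (simp add: abs_divide pos_divide_le_eq)
  qed
  have meas: "d\<eta> e \<in> borel_measurable borel" for e
    unfolding d\<eta>_def by (cases "len G e = \<infinity>") auto
  have bound: "\<bar>d\<eta> e t\<bar> \<le> \<kappa>" if "e \<in> edges G" for e t
    using slope[OF that] \<sigma> by (auto simp: d\<eta>_def)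
  have ac: "ac_on (edge_dom G e) (restr G \<eta> e) (d\<eta> e)" if e: "e \<in> edges G" for e
  proof -
    have "ac_on (edge_dom G e) (E e) (d\<eta> e)"
    proof (rule ac_on_if_deriv_except_finite[where K = "{h (src G e) / \<sigma>}", OF _ _ _ meas bound[OF e]])
      show "continuous_on UNIV (E e)"
        unfolding E_def using lenL(3)[OF e]
        by (cases "len G e = \<infinity>") (auto intro!: continuous_intros)
      fix x assume x: "x \<notin> {h (src G e) / \<sigma>}"
      show "(E e has_real_derivative d\<eta> e x) (at x)"
      proof (cases "len G e = \<infinity>")
        case False
        then have "E e = (\<lambda>t. h (src G e) + (h (tgt G e) - h (src G e)) / L e * t)"
          "d\<eta> e x = (h (tgt G e) - h (src G e)) / L e"
          by (auto simp: E_def d\<eta>_def)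
        moreover have "((\<lambda>t. b + c * t) has_real_derivative c) (at x)" for b c :: real
          by (auto intro!: derivative_eq_intros)
        ultimately show ?thesis by presburger
      next
        case True
        show ?thesis
        proof (cases "x < h (src G e) / \<sigma>")
          case lt: True
          have "((\<lambda>t. h (src G e) - \<sigma> * t) has_real_derivative d\<eta> e x) (at x)"
            using True lt by (auto simp: d\<eta>_def intro!: derivative_eq_intros)
          then show ?thesis
            by (rule has_field_derivative_transform_within_open[where S = "{..<h (src G e) / \<sigma>}"])
              (use True lt \<sigma> in \<open>auto simp: E_def pos_less_divide_eq mult.commute\<close>)
        next
          case False
          then have gt: "h (src G e) / \<sigma> < x" using x by simp
          have "((\<lambda>t. 0) has_real_derivative d\<eta> e x) (at x)"
            using True gt by (auto simp: d\<eta>_def)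
          then show ?thesis
            by (rule has_field_derivative_transform_within_open[where S = "{h (src G e) / \<sigma><..}"])
              (use True gt \<sigma> in \<open>auto simp: E_def pos_divide_less_eq mult.commute\<close>)
        qed
      qed
    qed simp
    then show ?thesis
      using ac_on_cong[of "edge_dom G e" "E e" "restr G \<eta> e"] restr[OF e] by simp
  qed
  define F where "F = {e \<in> edges G. \<exists>v. incident G e v \<and> h v \<noteq> 0}"
  \<comment> \<open>On half-lines \<open>\<eta>\<close> has died out at \<open>1 / \<sigma>\<close>,
    since \<open>h \<le> 1\<close>; the sum exceeds the length of every bounded edge in
    \<open>F\<close>, so none of them has parameters beyond \<open>R\<close>.\<close>
  define R where "R = 1 / \<sigma> + (\<Sum>e\<in>F. \<bar>L e\<bar>)"
  have finF: "finite F" using F by (simp add: F_def)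
  have zero: "restr G \<eta> e t = 0 \<and> d\<eta> e t = 0"
    if e: "e \<in> edges G" and t: "t \<in> edge_dom G e" and out: "e \<notin> F \<or> R < t" for e t
  proof -
    have t0: "0 \<le> t" using t by (simp add: edge_dom_def)
    show ?thesis
    proof (cases "len G e = \<infinity>")
      case True
      have "h (src G e) / \<sigma> \<le> t"
      proof (cases "e \<in> F")
        case False
        then have "h (src G e) = 0" using e by (auto simp: F_def incident_def)
        then show ?thesis using t0 by simp
      next
        case True
        have "h (src G e) / \<sigma> \<le> 1 / \<sigma>" using h(3) \<sigma>(1) by (simp add: divide_right_mono)
        also have "\<dots> \<le> R" unfolding R_def by (simp add: sum_nonneg)
        finally show ?thesis using out True by simp
      qed
      then have "\<not> t < h (src G e) / \<sigma>" by linarith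
      moreover have "h (src G e) - \<sigma> * t \<le> 0"
        using \<open>h (src G e) / \<sigma> \<le> t\<close> \<sigma>(1) by (simp add: pos_divide_le_eq mult.commute)
      ultimately show ?thesis using True restr[OF e t] by (simp add: E_def d\<eta>_def)
    next
      case False
      have "e \<notin> F"
      proof
        assume eF: "e \<in> F"
        have "t \<le> L e" using t lenL(4)[OF e False] by simp
        also have "\<dots> \<le> (\<Sum>e\<in>F. \<bar>L e\<bar>)"
          using member_le_sum[of e F "\<lambda>e. \<bar>L e\<bar>"] finF eF by auto
        also have "\<dots> \<le> R" using \<sigma>(1) by (simp add: R_def)
        finally show False using out eF by simp
      qed
      then have "h (src G e) = 0" "h (tgt G e) = 0"
        using e lenL(5)[OF e False] by (auto simp: F_def incident_def)
      then show ?thesis using restr[OF e t] False by (simp add: E_def d\<eta>_def)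
    qed
  qed
  \<comment> \<open>On a bounded edge the cutoff is a convex combination of its two vertex values
    and inherits their bounds.\<close>
  have conv: "E e t = (1 - t / L e) * h (src G e) + t / L e * h (tgt G e)" "0 \<le> t / L e" "t / L e \<le> 1"
    if "e \<in> edges G" "len G e \<noteq> \<infinity>" "t \<in> edge_dom G e" for e t
    using that lenL[OF that(1,2)] by (auto simp: E_def field_simps)
  have image: "\<exists>e\<in>edges G. \<exists>t\<in>edge_dom G e. x = par G e t"
    if x: "x \<in> points G" "\<eta> x \<noteq> 0" for x
    proof (cases x)
      case (Vertex v)
      then obtain e where e: "e \<in> edges G" "incident G e v"
        using x hinc[of v] e0 by (auto simp: \<eta>_def incident_def)
      show ?thesis
      proof (cases "src G e = v")
        case True
        have "0 < len G e" using e wf by (auto simp: wf_metric_graph_def)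
        then show ?thesis using True Vertex e
          by (intro bexI[of _ e] bexI[of _ 0]) (auto simp: par_def edge_dom_def zero_ereal_def[symmetric])
      next
        case False
        then have "len G e \<noteq> \<infinity>" "tgt G e = v" using e by (auto simp: incident_def)
        then show ?thesis using lenL[OF e(1)] Vertex e
          by (intro bexI[of _ e] bexI[of _ "L e"]) (auto simp: par_def)
      qed
    next
      case (Inner e t)
      then have "e \<in> edges G" "0 < t" "ereal t < len G e" using x by (auto simp: points_def)
      then show ?thesis using Inner
        by (intro bexI[of _ e] bexI[of _ t]) (auto simp: par_def edge_dom_def)
    qed
  have le1: "\<bar>restr G \<eta> e t\<bar> \<le> 1" if e: "e \<in> edges G" and t: "t \<in> edge_dom G e" for e t
  proof -
    have t0: "0 \<le> t" using t by (simp add: edge_dom_def)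
    show ?thesis
    proof (cases "len G e = \<infinity>")
      case True
      have "h (src G e) - \<sigma> * t \<le> 1"
        using h(3)[of "src G e"] mult_nonneg_nonneg[of \<sigma> t] \<sigma>(1) t0 by linarith
      then show ?thesis using restr[OF e t] True by (auto simp: E_def)
    next
      case False
      note c = conv[OF e False t]
      have "E e t \<le> (1 - t / L e) * 1 + t / L e * 1"
        unfolding c(1) by (intro add_mono mult_left_mono h c) (use c in auto)
      moreover have "0 \<le> E e t"
        unfolding c(1) using c h by (intro add_nonneg_nonneg mult_nonneg_nonneg) auto
      ultimately show ?thesis using restr[OF e t] by simp
    qed
  qed
  show ?thesis
  proof (rule that[of \<eta> d\<eta>])
    show "cutoff G \<kappa> \<eta> d\<eta>"
      unfolding cutoff_def
      by (intro conjI ballI impI exI[of _ F] exI[of _ R] image ac meas bound le1 finF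
          conjunct1[OF zero] conjunct2[OF zero])
    fix t assume t: "t \<in> edge_dom G e0" "t \<le> d"
    show "1 / 2 \<le> restr G \<eta> e0 t"
    proof (cases "len G e0 = \<infinity>")
      case True
      have "\<sigma> * t \<le> \<sigma> * d" using t \<sigma>(1) by simp
      then show ?thesis using restr[OF e0 t(1)] True h(1) \<sigma>(3) by (simp add: E_def)
    next
      case False
      note c = conv[OF e0 False t(1)]
      have "\<bar>h (tgt G e0) - h (src G e0)\<bar> \<le> 1 / real N"
        using hadj[OF e0 lenL(5)[OF e0 False]] by (simp add: incident_def)
      also have "\<dots> \<le> 1 / 2" using N(1) by (simp add: field_simps)
      finally have "1 / 2 \<le> h (tgt G e0)" using h(1) by linarith
      then have "(1 - t / L e0) * (1 / 2) + t / L e0 * (1 / 2) \<le> E e0 t"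
        unfolding c(1) using c h(1) by (intro add_mono mult_left_mono) auto
      then show ?thesis using restr[OF e0 t(1)] by (simp add: algebra_simps)
    qed
  qed
qed

section \<open>Nodal zones\<close>

lemma L2_on_bounded_mult:
  assumes m: "m \<in> borel_measurable (lebesgue_on S)" "\<And>x. x \<in> S \<Longrightarrow> \<bar>m x\<bar> \<le> C"
    and g: "g \<in> L2_on S"
  shows "(\<lambda>x. m x * g x) \<in> L2_on S"
proof -
  have "integrable (lebesgue_on S) (\<lambda>x. (m x * g x)\<^sup>2)"
  proof (rule Bochner_Integration.integrable_bound)
    show "integrable (lebesgue_on S) (\<lambda>x. C\<^sup>2 * (g x)\<^sup>2)" using g by (auto simp: L2_on_def)
    show "(\<lambda>x. (m x * g x)\<^sup>2) \<in> borel_measurable (lebesgue_on S)"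
      using m(1) g by (auto simp: L2_on_def)
    show "AE x in lebesgue_on S. norm ((m x * g x)\<^sup>2) \<le> norm (C\<^sup>2 * (g x)\<^sup>2)"
    proof (rule AE_I2)
      fix x assume "x \<in> space (lebesgue_on S)"
      then have "\<bar>m x\<bar> \<le> C" using m(2) by simp
      then have "(m x)\<^sup>2 \<le> C\<^sup>2" using abs_le_square_iff[of "m x" C] by simp
      then show "norm ((m x * g x)\<^sup>2) \<le> norm (C\<^sup>2 * (g x)\<^sup>2)"
        by (simp add: power_mult_distrib mult_right_mono)
    qed
  qed
  then show ?thesis using m(1) g by (auto simp: L2_on_def)
qed

text \<open>Applied twice: to \<open>u\<close> on \<open>Z\<close>, giving \<open>\<phi>\<close>,
  and then to \<open>\<phi>\<close> with the same cutoff, giving the function inserted into the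
  equation.\<close>

lemma test_pair_cutoff:
  assumes wf: "wf_metric_graph G" and cut: "cutoff G \<kappa> \<eta> d\<eta>"
    and v: "\<And>x. x \<notin> points G \<Longrightarrow> v x = 0"
    and vac: "\<And>e. e \<in> edges G \<Longrightarrow> ac_on (edge_dom G e) (restr G v e) (l e)"
    and vL2: "\<And>e. e \<in> edges G \<Longrightarrow> restr G v e \<in> L2_on (edge_dom G e)"
      "\<And>e. e \<in> edges G \<Longrightarrow> l e \<in> L2_on (edge_dom G e)"
  shows "test_pair G (\<lambda>x. \<eta> x * v x) (\<lambda>e t. restr G \<eta> e t * l e t + restr G v e t * d\<eta> e t)"
  unfolding test_pair_def
proof (intro conjI ballI)
  have r: "restr G (\<lambda>x. \<eta> x * v x) e = (\<lambda>t. restr G \<eta> e t * restr G v e t)" for e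
    by (simp add: restr_def)
  show "\<forall>x. \<eta> x * v x \<noteq> 0 \<longrightarrow> (\<exists>e\<in>edges G. \<exists>t\<in>edge_dom G e. x = par G e t)"
  proof (intro allI impI)
    fix x assume "\<eta> x * v x \<noteq> 0"
    then have "\<eta> x \<noteq> 0" "x \<in> points G" using v[of x] by auto
    then show "\<exists>e\<in>edges G. \<exists>t\<in>edge_dom G e. x = par G e t"
      using cut unfolding cutoff_def by blast
  qed
  fix e assume e: "e \<in> edges G"
  have c: "ac_on (edge_dom G e) (restr G \<eta> e) (d\<eta> e)" "d\<eta> e \<in> borel_measurable borel"
    "\<And>t. t \<in> edge_dom G e \<Longrightarrow> \<bar>d\<eta> e t\<bar> \<le> \<kappa>"
    "\<And>t. t \<in> edge_dom G e \<Longrightarrow> \<bar>restr G \<eta> e t\<bar> \<le> 1"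
    using cut e unfolding cutoff_def by auto
  show "ac_on (edge_dom G e) (restr G (\<lambda>x. \<eta> x * v x) e)
      (\<lambda>t. restr G \<eta> e t * l e t + restr G v e t * d\<eta> e t)"
    unfolding r by (rule ac_on_mult[OF c(1) vac[OF e] is_interval_edge_dom])
  have "(\<lambda>t. restr G \<eta> e t * l e t) \<in> L2_on (edge_dom G e)"
    by (rule L2_on_bounded_mult[OF continuous_on_edge_measurable c(4) vL2(2)[OF e]])
      (rule ac_on_continuous[OF c(1) is_interval_edge_dom closed_edge_dom])
  moreover have "(\<lambda>t. d\<eta> e t * restr G v e t) \<in> L2_on (edge_dom G e)"
    by (rule L2_on_bounded_mult[OF _ c(3) vL2(1)[OF e]])
      (simp add: measurable_restrict_space1 measurable_completion c(2))
  ultimately show "(\<lambda>t. restr G \<eta> e t * l e t + restr G v e t * d\<eta> e t) \<in> L2_on (edge_dom G e)"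
    using L2_on_add by (simp add: mult.commute[of "restr G v e _"])
next
  obtain F R where "finite F" "\<forall>e\<in>edges G. \<forall>t\<in>edge_dom G e. e \<notin> F \<or> R < t \<longrightarrow>
      restr G \<eta> e t = 0 \<and> d\<eta> e t = 0"
    using cut unfolding cutoff_def by blast
  then show "\<exists>F R. finite F \<and> (\<forall>e\<in>edges G. \<forall>t\<in>edge_dom G e. e \<notin> F \<or> R < t \<longrightarrow>
      restr G (\<lambda>x. \<eta> x * v x) e t = 0 \<and> restr G \<eta> e t * l e t + restr G v e t * d\<eta> e t = 0)"
    by (intro exI[of _ F] exI[of _ R]) (simp add: restr_def)
qed

lemma nodal_zone_subset:
  assumes "wf_metric_graph G" "Z \<in> nodal_zones G u" "x \<in> Z"
  shows "x \<in> points G" "u x \<noteq> 0"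
  using connected_components_of_subset[of Z "subtopology (graph_topology G) {x \<in> points G. u x \<noteq> 0}"]
    assms by (auto simp: nodal_zones_def)

text \<open>The image of \<open>[x, y]\<close> is connected and avoids the zeros of
  \<open>u\<close>, so it lies in a single component.\<close>

lemma nodal_zone_saturated:
  assumes wf: "wf_metric_graph G" and Z: "Z \<in> nodal_zones G u" and e: "e \<in> edges G"
    and xy: "x \<in> edge_dom G e" "y \<in> edge_dom G e" "x \<le> y"
    and nz: "\<And>r. x \<le> r \<Longrightarrow> r \<le> y \<Longrightarrow> restr G u e r \<noteq> 0"
  shows "par G e x \<in> Z \<longleftrightarrow> par G e y \<in> Z"
proof -
  let ?X = "subtopology (graph_topology G) {x \<in> points G. u x \<noteq> 0}"
  let ?S = "par G e ` {x..y}"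
  have sub: "{x..y} \<subseteq> edge_dom G e"
    using is_interval_edge_dom[of G e] xy by (meson atLeastAtMost_iff mem_is_interval_1_I subsetI)
  have "connectedin (top_of_set (edge_dom G e)) {x..y}"
    using sub by (simp add: connectedin_subtopology)
  then have "connectedin (graph_topology G) ?S"
    by (rule connectedin_continuous_map_image[OF continuous_map_par[OF wf e]])
  moreover have "?S \<subseteq> {x \<in> points G. u x \<noteq> 0}"
    using sub nz par_in_points[OF wf e] by (auto simp: restr_def)
  ultimately have S: "connectedin ?X ?S" by (simp add: connectedin_subtopology)
  have "?S \<subseteq> Z" if "?S \<inter> Z \<noteq> {}"
    using connected_components_of_maximal[OF _ S, of Z] Z that
    by (auto simp: nodal_zones_def disjnt_def Int_commute)
  moreover have "par G e x \<in> ?S" "par G e y \<in> ?S" using xy(3) by auto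
  ultimately show ?thesis by blast
qed

lemma nodal_zones_disjoint:
  assumes "Z \<in> nodal_zones G u" "Z' \<in> nodal_zones G u" "x \<in> Z" "x \<in> Z'"
  shows "Z = Z'"
  using assms pairwise_disjoint_connected_components_of[of "subtopology (graph_topology G) {x \<in> points G. u x \<noteq> 0}"]
  by (auto simp: nodal_zones_def pairwise_def disjnt_def)

text \<open>Cutting \<open>u\<close> down to one zone creates no jumps and multiplies the derivative
  by the indicator of the zone, even if the zone meets the edge in infinitely many
  intervals.\<close>

lemma nodal_zone_restriction:
  fixes G :: "('v, 'e) metric_graph" and u :: "('v, 'e) gpoint \<Rightarrow> real"
  assumes wf: "wf_metric_graph G" and u: "u \<in> H1 G" and Z: "Z \<in> nodal_zones G u"
    and e: "e \<in> edges G"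
  shows "ac_on (edge_dom G e) (restr G (\<lambda>x. indicator Z x * u x) e)
      (\<lambda>t. indicator Z (par G e t) * gderiv G u e t)"
    "restr G (\<lambda>x. indicator Z x * u x) e \<in> L2_on (edge_dom G e)"
    "(\<lambda>t. indicator Z (par G e t) * gderiv G u e t) \<in> L2_on (edge_dom G e)"
proof -
  define A where "A = par G e -` Z"
  have ind: "indicator A t = (indicator Z (par G e t) :: real)" for t
    by (simp add: A_def indicator_def)
  have r: "restr G (\<lambda>x. indicator Z x * u x) e = (\<lambda>t. indicator A t * restr G u e t)"
    by (simp add: restr_def ind)
  have nz: "restr G u e t \<noteq> 0" if "t \<in> A" for t
    using that nodal_zone_subset(2)[OF wf Z] by (auto simp: A_def restr_def)
  have sat: "x \<in> A \<longleftrightarrow> y \<in> A" if "x \<in> edge_dom G e" "y \<in> edge_dom G e" "x \<le> y"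
    "\<And>r. x \<le> r \<Longrightarrow> r \<le> y \<Longrightarrow> restr G u e r \<noteq> 0" for x y
    unfolding A_def vimage_eq by (rule nodal_zone_saturated[OF wf Z e that])
  show ac: "ac_on (edge_dom G e) (restr G (\<lambda>x. indicator Z x * u x) e)
      (\<lambda>t. indicator Z (par G e t) * gderiv G u e t)"
    unfolding r ind[symmetric]
    by (rule ac_on_indicator[OF H1_edge(4)[OF wf u e] is_interval_edge_dom nz sat])
  have "(\<lambda>t. indicator A t * restr G u e t) \<in> borel_measurable (lebesgue_on (edge_dom G e))"
    using ac_on_continuous[OF ac is_interval_edge_dom closed_edge_dom] unfolding r
    by (rule continuous_on_edge_measurable)
  \<comment> \<open>Measurability of \<open>A\<close> on the edge: it is the set where the
    continuous function \<open>indicator A t * restr G u e t\<close> is nonzero.\<close>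
  then have "(\<lambda>t. if indicator A t * restr G u e t \<noteq> 0 then 1 else 0 :: real)
      \<in> borel_measurable (lebesgue_on (edge_dom G e))"
    by measurable
  moreover have "(\<lambda>t. if indicator A t * restr G u e t \<noteq> 0 then 1 else 0 :: real) = indicator A"
    using nz by (auto simp: fun_eq_iff indicator_def)
  ultimately have m: "(indicator A :: real \<Rightarrow> real) \<in> borel_measurable (lebesgue_on (edge_dom G e))" by simp
  show "restr G (\<lambda>x. indicator Z x * u x) e \<in> L2_on (edge_dom G e)"
    unfolding r by (rule L2_on_bounded_mult[OF m _ H1_edge(2)[OF wf u e], of 1]) (simp add: indicator_def)
  show "(\<lambda>t. indicator Z (par G e t) * gderiv G u e t) \<in> L2_on (edge_dom G e)"
    unfolding ind[symmetric]
    by (rule L2_on_bounded_mult[OF m _ H1_edge(3)[OF wf u e], of 1]) (simp add: indicator_def)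
qed

lemma infsum_finite_support:
  fixes f :: "'a \<Rightarrow> real"
  assumes "finite F" "F \<subseteq> A" "\<And>x. x \<in> A - F \<Longrightarrow> f x = 0"
  shows "infsum f A = sum f F"
proof -
  have "infsum f A = infsum f F"
    by (rule infsum_cong_neutral) (use assms in auto)
  then show ?thesis using assms(1) by simp
qed

section \<open>The energy identity\<close>

locale graph_solution =
  fixes G :: "('v, 'e) metric_graph"
    and W \<rho> u :: "('v, 'e) gpoint \<Rightarrow> real"
    and p lam a :: real
  assumes G: "graph_class_G G"
    and p: "p > 2"
    and W: "W \<in> Linf G"
    and \<rho>: "\<rho> \<in> Linf G"
    and a: "a > 0"
    and \<rho>_dichotomy: "\<And>e. e \<in> edges G \<Longrightarrow>
      (AE x in lebesgue_on (edge_dom G e). restr G \<rho> e x \<ge> a) \<or>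
      (AE x in lebesgue_on (edge_dom G e). restr G \<rho> e x = 0)"
    and u: "u \<in> H1 G"
    and sol: "weak_solution G W \<rho> p lam u"
begin

section \<open>Integrability of the potential and nonlinear terms on one edge\<close>

abbreviation "leb e \<equiv> lebesgue_on (edge_dom G e)"

abbreviation "pot e t \<equiv> \<bar>restr G u e t\<bar> powr (p - 2)"

lemma wf: "wf_metric_graph G"
  using G by (simp add: graph_class_G_def)

lemma len_pos: "e \<in> edges G \<Longrightarrow> 0 < len G e"
  using wf by (auto simp: wf_metric_graph_def)

lemma \<rho>_nonneg:
  assumes "e \<in> edges G"
  shows "AE t in leb e. 0 \<le> restr G \<rho> e t"
  using \<rho>_dichotomy[OF assms]
proof
  assume "AE x in leb e. restr G \<rho> e x \<ge> a"
  then show ?thesis by eventually_elim (use a in simp)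
next
  assume "AE x in leb e. restr G \<rho> e x = 0"
  then show ?thesis by eventually_elim simp
qed

text \<open>The exponent \<open>p - 2\<close> is positive, which gives continuity of
  \<open>powr\<close> at the zeros of \<open>u\<close> too.\<close>

lemma continuous_on_pot:
  assumes "e \<in> edges G"
  shows "continuous_on (edge_dom G e) (pot e)"
  using H1_edge(1)[OF wf u assms] p by (intro continuous_on_powr' continuous_intros) auto

lemma integrable_W_edge:
  assumes e: "e \<in> edges G" and q: "continuous_on (edge_dom G e) q"
    and zero: "\<And>t. t \<in> edge_dom G e \<Longrightarrow> R < t \<Longrightarrow> q t = 0"
  shows "integrable (leb e) (\<lambda>t. (restr G W e t + lam) * q t)"
proof -
  obtain C where C: "AE t in leb e. \<bar>restr G W e t\<bar> \<le> C" "restr G W e \<in> borel_measurable (leb e)"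
    using W e by (auto simp: Linf_def)
  show ?thesis
  proof (rule integrable_edge_mult[OF len_pos[OF e] q zero])
    show "(\<lambda>t. restr G W e t + lam) \<in> borel_measurable (leb e)"
      using C(2) by (intro borel_measurable_add) auto
    show "AE t in leb e. \<bar>restr G W e t + lam\<bar> \<le> C + \<bar>lam\<bar>"
      using C(1) by eventually_elim linarith
  qed
qed

lemma integrable_\<rho>_edge:
  assumes e: "e \<in> edges G" and q: "continuous_on (edge_dom G e) q"
    and zero: "\<And>t. t \<in> edge_dom G e \<Longrightarrow> R < t \<Longrightarrow> q t = 0"
  shows "integrable (leb e) (\<lambda>t. restr G \<rho> e t * (pot e t * q t))"
proof -
  obtain C where C: "AE t in leb e. \<bar>restr G \<rho> e t\<bar> \<le> C" "restr G \<rho> e \<in> borel_measurable (leb e)"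
    using \<rho> e by (auto simp: Linf_def)
  show ?thesis
    by (rule integrable_edge_mult[OF len_pos[OF e] _ _ C(2,1), where R = R])
      (use q zero continuous_on_pot[OF e] in \<open>auto intro: continuous_on_mult\<close>)
qed

lemma integral_edge_zero:
  fixes f :: "real \<Rightarrow> real"
  assumes "\<And>t. t \<in> edge_dom G e \<Longrightarrow> f t = 0"
  shows "(LINT t|leb e. f t) = 0"
  by (rule integral_eq_zero_AE) (use assms in auto)

text \<open>Contribution of one edge to \<open>quadratic_form\<close>, with the explicit derivative
  \<open>k\<close> in place of \<open>gderiv\<close>.\<close>

definition edge_form :: "(('v, 'e) gpoint \<Rightarrow> real) \<Rightarrow> ('e \<Rightarrow> real \<Rightarrow> real) \<Rightarrow> 'e \<Rightarrow> real" where
  "edge_form \<phi> k e = (LINT t|leb e. (k e t)\<^sup>2) + (LINT t|leb e. (restr G W e t + lam) * (restr G \<phi> e t)\<^sup>2) -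
     (p - 1) * (LINT t|leb e. restr G \<rho> e t * (pot e t * (restr G \<phi> e t)\<^sup>2))"

text \<open>Edges outside \<open>F\<close> contribute 0, so the infinite sum is finite; on each edge
  \<open>k\<close> and \<open>gderiv G \<phi> e\<close> agree almost everywhere.\<close>

lemma quadratic_form_test_pair:
  assumes tp: "test_pair G \<phi> k" and F: "finite F" "F \<subseteq> edges G"
    and out: "\<And>e t. e \<in> edges G \<Longrightarrow> e \<notin> F \<Longrightarrow> t \<in> edge_dom G e \<Longrightarrow> restr G \<phi> e t = 0 \<and> k e t = 0"
  shows "quadratic_form G W \<rho> p lam u \<phi> = (\<Sum>e\<in>F. edge_form \<phi> k e)"
proof -
  have edge: "(LINT x|leb e. \<bar>gderiv G \<phi> e x\<bar>\<^sup>2 + (restr G W e x + lam) * (restr G \<phi> e x)\<^sup>2 -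
       (p - 1) * restr G \<rho> e x * pot e x * (restr G \<phi> e x)\<^sup>2) = edge_form \<phi> k e"
    if e: "e \<in> edges G" for e
  proof -
    note t = test_pair_edge[OF wf tp e]
    obtain R where R: "\<And>t. t \<in> edge_dom G e \<Longrightarrow> R < t \<Longrightarrow> restr G \<phi> e t = 0"
      using test_pair_support[OF tp] e by metis
    have R2: "(restr G \<phi> e t)\<^sup>2 = 0" if "t \<in> edge_dom G e" "R < t" for t using R[OF that] by simp
    have c2: "continuous_on (edge_dom G e) (\<lambda>t. (restr G \<phi> e t)\<^sup>2)"
      by (intro continuous_intros t(1))
    note i1 = integrable_W_edge[OF e c2 R2] and i2 = integrable_\<rho>_edge[OF e c2 R2]
    have i0: "integrable (leb e) (\<lambda>t. (k e t)\<^sup>2)" using t(3) by (simp add: L2_on_def)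
    have km: "k e \<in> borel_measurable (leb e)" using t(3) by (simp add: L2_on_def)
    note m1 = borel_measurable_integrable[OF i1] and m2 = borel_measurable_integrable[OF i2]
    have "(LINT x|leb e. \<bar>gderiv G \<phi> e x\<bar>\<^sup>2 + (restr G W e x + lam) * (restr G \<phi> e x)\<^sup>2 -
       (p - 1) * restr G \<rho> e x * pot e x * (restr G \<phi> e x)\<^sup>2) =
      (LINT x|leb e. (gderiv G \<phi> e x)\<^sup>2 + (restr G W e x + lam) * (restr G \<phi> e x)\<^sup>2 -
       (p - 1) * (restr G \<rho> e x * (pot e x * (restr G \<phi> e x)\<^sup>2)))"
      by (simp add: mult.assoc)
    also have "\<dots> = (LINT x|leb e. (k e x)\<^sup>2 + (restr G W e x + lam) * (restr G \<phi> e x)\<^sup>2 -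
       (p - 1) * (restr G \<rho> e x * (pot e x * (restr G \<phi> e x)\<^sup>2)))"
    proof (rule integral_cong_AE)
      show "(\<lambda>x. (gderiv G \<phi> e x)\<^sup>2 + (restr G W e x + lam) * (restr G \<phi> e x)\<^sup>2 -
          (p - 1) * (restr G \<rho> e x * (pot e x * (restr G \<phi> e x)\<^sup>2))) \<in> borel_measurable (leb e)"
        by (intro borel_measurable_diff borel_measurable_add borel_measurable_power t(5) m1
            borel_measurable_times borel_measurable_const m2)
      show "(\<lambda>x. (k e x)\<^sup>2 + (restr G W e x + lam) * (restr G \<phi> e x)\<^sup>2 -
          (p - 1) * (restr G \<rho> e x * (pot e x * (restr G \<phi> e x)\<^sup>2))) \<in> borel_measurable (leb e)"
        by (intro borel_measurable_diff borel_measurable_add borel_measurable_power km m1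
            borel_measurable_times borel_measurable_const m2)
    qed (use t(6) in eventually_elim, simp)
    also have "\<dots> = edge_form \<phi> k e"
      using i0 i1 i2 by (simp add: edge_form_def)
    finally show ?thesis .
  qed
  have "edge_form \<phi> k e = 0" if "e \<in> edges G - F" for e
  proof -
    have "(LINT t|leb e. (k e t)\<^sup>2) = 0"
      "(LINT t|leb e. (restr G W e t + lam) * (restr G \<phi> e t)\<^sup>2) = 0"
      "(LINT t|leb e. restr G \<rho> e t * (pot e t * (restr G \<phi> e t)\<^sup>2)) = 0"
      using out[of e] that by (auto intro!: integral_edge_zero)
    then show ?thesis by (simp add: edge_form_def)
  qed
  then have "infsum (edge_form \<phi> k) (edges G) = (\<Sum>e\<in>F. edge_form \<phi> k e)"
    using F by (intro infsum_finite_support) auto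
  moreover have "quadratic_form G W \<rho> p lam u \<phi> = infsum (edge_form \<phi> k) (edges G)"
    unfolding quadratic_form_def graph_integral_def by (rule infsum_cong) (rule edge)
  ultimately show ?thesis by simp
qed

text \<open>The product of \<open>u\<close> and \<open>\<psi>\<close> is kept together because for
  \<open>\<psi> = \<eta>^2 u\<close> on \<open>Z\<close> it is the square of
  \<open>\<phi>\<close>.\<close>

lemma weak_solution_test_pair:
  assumes tp: "test_pair G \<psi> l" and F: "finite F" "F \<subseteq> edges G"
    and out: "\<And>e t. e \<in> edges G \<Longrightarrow> e \<notin> F \<Longrightarrow> t \<in> edge_dom G e \<Longrightarrow> restr G \<psi> e t = 0 \<and> l e t = 0"
  shows "(\<Sum>e\<in>F. LINT t|leb e. gderiv G u e t * l e t + (restr G W e t + lam) * (restr G u e t * restr G \<psi> e t))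
    = (\<Sum>e\<in>F. LINT t|leb e. restr G \<rho> e t * (pot e t * (restr G u e t * restr G \<psi> e t)))"
proof -
  have lhs: "(LINT x|leb e. gderiv G u e x * gderiv G \<psi> e x +
          (restr G W e x + lam) * restr G u e x * restr G \<psi> e x) =
      (LINT t|leb e. gderiv G u e t * l e t + (restr G W e t + lam) * (restr G u e t * restr G \<psi> e t))"
    if e: "e \<in> edges G" for e
  proof -
    note t = test_pair_edge[OF wf tp e]
    have m: "gderiv G u e \<in> borel_measurable (leb e)" "restr G u e \<in> borel_measurable (leb e)"
      "restr G W e \<in> borel_measurable (leb e)" "l e \<in> borel_measurable (leb e)"
      "restr G \<psi> e \<in> borel_measurable (leb e)"
      using H1_edge(2,3)[OF wf u e] W e t(2,3) by (auto simp: L2_on_def Linf_def)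
    show ?thesis
    proof (rule integral_cong_AE)
      show "(\<lambda>x. gderiv G u e x * gderiv G \<psi> e x + (restr G W e x + lam) * restr G u e x * restr G \<psi> e x)
          \<in> borel_measurable (leb e)"
        using m t(5) by measurable
      show "(\<lambda>t. gderiv G u e t * l e t + (restr G W e t + lam) * (restr G u e t * restr G \<psi> e t))
          \<in> borel_measurable (leb e)"
        using m by measurable
    qed (use t(6) in eventually_elim, simp)
  qed
  have "\<psi> \<in> H1 G \<inter> Cc G" using test_pair_H1[OF wf tp] test_pair_Cc[OF wf tp] by simp
  then have "(\<Sum>\<^sub>\<infinity>e\<in>edges G. LINT x|leb e. gderiv G u e x * gderiv G \<psi> e x +
          (restr G W e x + lam) * restr G u e x * restr G \<psi> e x) =
        (\<Sum>\<^sub>\<infinity>e\<in>edges G. LINT x|leb e. restr G \<rho> e x * pot e x * restr G u e x * restr G \<psi> e x)"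
    using sol by (simp add: weak_solution_def graph_integral_def)
  moreover have "(\<Sum>\<^sub>\<infinity>e\<in>edges G. LINT x|leb e. gderiv G u e x * gderiv G \<psi> e x +
          (restr G W e x + lam) * restr G u e x * restr G \<psi> e x) =
     (\<Sum>\<^sub>\<infinity>e\<in>edges G. LINT t|leb e. gderiv G u e t * l e t +
          (restr G W e t + lam) * (restr G u e t * restr G \<psi> e t))"
    by (rule infsum_cong) (rule lhs)
  moreover have "\<dots> = (\<Sum>e\<in>F. LINT t|leb e. gderiv G u e t * l e t +
          (restr G W e t + lam) * (restr G u e t * restr G \<psi> e t))"
  proof (rule infsum_finite_support[OF F])
    fix e assume "e \<in> edges G - F"
    then show "(LINT t|leb e. gderiv G u e t * l e t + (restr G W e t + lam) * (restr G u e t * restr G \<psi> e t)) = 0"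
      using out[of e] by (intro integral_edge_zero) auto
  qed
  moreover have "(\<Sum>\<^sub>\<infinity>e\<in>edges G. LINT x|leb e. restr G \<rho> e x * pot e x * restr G u e x * restr G \<psi> e x)
      = (\<Sum>\<^sub>\<infinity>e\<in>edges G. LINT t|leb e. restr G \<rho> e t * (pot e t * (restr G u e t * restr G \<psi> e t)))"
    by (simp add: mult.assoc)
  moreover have "\<dots> = (\<Sum>e\<in>F. LINT t|leb e. restr G \<rho> e t * (pot e t * (restr G u e t * restr G \<psi> e t)))"
  proof (rule infsum_finite_support[OF F])
    fix e assume "e \<in> edges G - F"
    then show "(LINT t|leb e. restr G \<rho> e t * (pot e t * (restr G u e t * restr G \<psi> e t))) = 0"
      using out[of e] by (intro integral_edge_zero) auto
  qed
  ultimately show ?thesis by simp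
qed

text \<open>Two pointwise identities, trivial off \<open>Z\<close>:
  \<open>u \<psi> = \<phi>^2\<close>, and \<open>u' l = k^2 - (v d\<eta>)^2\<close> by completing
  the square. With \<open>p - 1 = 1 + (p - 2)\<close>, the first two integrals on the right are the
  two sides of the weak equation and cancel after summation over the edges.\<close>

lemma edge_energy_identity:
  assumes v_def: "v = (\<lambda>x. indicator Z x * u x)"
    and dv_def: "dv = (\<lambda>e t. indicator Z (par G e t) * gderiv G u e t)"
    and \<phi>_def: "\<phi> = (\<lambda>x. \<eta> x * v x)"
    and k_def: "k = (\<lambda>e t. restr G \<eta> e t * dv e t + restr G v e t * d\<eta> e t)"
    and \<psi>_def: "\<psi> = (\<lambda>x. \<eta> x * \<phi> x)"
    and l_def: "l = (\<lambda>e t. restr G \<eta> e t * k e t + restr G \<phi> e t * d\<eta> e t)"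
    and e: "e \<in> edges G" and tp: "test_pair G \<phi> k"
    and vd: "(\<lambda>t. restr G v e t * d\<eta> e t) \<in> L2_on (edge_dom G e)"
  shows "edge_form \<phi> k e =
    (LINT t|leb e. gderiv G u e t * l e t + (restr G W e t + lam) * (restr G u e t * restr G \<psi> e t))
    - (LINT t|leb e. restr G \<rho> e t * (pot e t * (restr G u e t * restr G \<psi> e t)))
    + (LINT t|leb e. (restr G v e t * d\<eta> e t)\<^sup>2)
    - (p - 2) * (LINT t|leb e. restr G \<rho> e t * (pot e t * (restr G \<phi> e t)\<^sup>2))"
proof -
  note t = test_pair_edge[OF wf tp e]
  obtain R where R: "\<And>t. t \<in> edge_dom G e \<Longrightarrow> R < t \<Longrightarrow> restr G \<phi> e t = 0"
    using test_pair_support[OF tp] e by metis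
  have R2: "(restr G \<phi> e t)\<^sup>2 = 0" if "t \<in> edge_dom G e" "R < t" for t using R[OF that] by simp
  have c2: "continuous_on (edge_dom G e) (\<lambda>t. (restr G \<phi> e t)\<^sup>2)"
    by (intro continuous_intros t(1))
  note i1 = integrable_W_edge[OF e c2 R2]
  have i0: "integrable (leb e) (\<lambda>t. (k e t)\<^sup>2)" using t(3) by (simp add: L2_on_def)
  have i3: "integrable (leb e) (\<lambda>t. (restr G v e t * d\<eta> e t)\<^sup>2)" using vd by (simp add: L2_on_def)
  have u\<psi>: "restr G u e t * restr G \<psi> e t = (restr G \<phi> e t)\<^sup>2" for t
    by (auto simp: restr_def \<psi>_def \<phi>_def v_def power2_eq_square indicator_def)
  have gl: "gderiv G u e t * l e t = (k e t)\<^sup>2 - (restr G v e t * d\<eta> e t)\<^sup>2" for t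
    by (auto simp: restr_def l_def k_def \<phi>_def v_def dv_def power2_eq_square indicator_def algebra_simps)
  have "(LINT t|leb e. gderiv G u e t * l e t + (restr G W e t + lam) * (restr G u e t * restr G \<psi> e t)) =
      (LINT t|leb e. (k e t)\<^sup>2) - (LINT t|leb e. (restr G v e t * d\<eta> e t)\<^sup>2) +
      (LINT t|leb e. (restr G W e t + lam) * (restr G \<phi> e t)\<^sup>2)"
    unfolding u\<psi> gl using i0 i1 i3 by simp
  then show ?thesis
    unfolding u\<psi> edge_form_def by (simp add: algebra_simps)
qed

text \<open>\<open>t0\<close> may be an end of the edge, so the interval cannot be centred there: it
  is spanned by \<open>t0\<close> and a second nearby point \<open>s\<close> of the edge. The bound
  \<open>b\<close> is the minimum of \<open>\<bar>u\<bar>\<close> on it.\<close>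

lemma exists_positive_interval:
  assumes e: "e \<in> edges G" and t0: "t0 \<in> edge_dom G e" "restr G u e t0 \<noteq> 0"
  obtains c d b where "c < d" "{c..d} \<subseteq> edge_dom G e" "t0 \<in> {c..d}" "0 < b"
    "\<And>t. t \<in> {c..d} \<Longrightarrow> b \<le> \<bar>restr G u e t\<bar>"
proof -
  have cont: "continuous_on (edge_dom G e) (restr G u e)" by (rule H1_edge(1)[OF wf u e])
  obtain r where r: "r > 0" "\<And>y. y \<in> edge_dom G e \<Longrightarrow> dist t0 y < r \<Longrightarrow> restr G u e y \<noteq> 0"
    using continuous_on_avoid[OF cont t0] by metis
  obtain s where s: "s \<in> edge_dom G e" "s \<noteq> t0" "dist t0 s < r"
  proof (cases "len G e")
    case (real L)
    then have L: "0 < L" "edge_dom G e = {0..L}" using len_pos[OF e] by (auto simp: edge_dom_def)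
    show ?thesis
    proof (cases "t0 < L")
      case True
      then show ?thesis using L r t0 by (intro that[of "min L (t0 + r / 2)"]) (auto simp: dist_real_def)
    next
      case False
      then show ?thesis using L r t0 by (intro that[of "max 0 (t0 - r / 2)"]) (auto simp: dist_real_def)
    qed
  next
    case PInf
    then have "edge_dom G e = {0..}" by (auto simp: edge_dom_def)
    then show ?thesis using r t0 by (intro that[of "t0 + r / 2"]) (auto simp: dist_real_def)
  next
    case MInf
    then show ?thesis using len_pos[OF e] by simp
  qed
  define c d where "c = min t0 s" and "d = max t0 s"
  have cd: "c < d" "c \<in> edge_dom G e" "d \<in> edge_dom G e" "t0 \<in> {c..d}"
    using s t0 by (auto simp: c_def d_def min_def max_def)
  have sub: "{c..d} \<subseteq> edge_dom G e"
    using is_interval_edge_dom[of G e] cd by (meson atLeastAtMost_iff mem_is_interval_1_I subsetI)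
  have nz: "restr G u e t \<noteq> 0" if "t \<in> {c..d}" for t
  proof (rule r(2))
    show "t \<in> edge_dom G e" using that sub by blast
    show "dist t0 t < r" using that s by (auto simp: c_def d_def dist_real_def min_def max_def split: if_splits)
  qed
  have "continuous_on {c..d} (\<lambda>t. \<bar>restr G u e t\<bar>)"
    by (intro continuous_intros continuous_on_subset[OF cont sub])
  then obtain m where m: "m \<in> {c..d}" "\<And>t. t \<in> {c..d} \<Longrightarrow> \<bar>restr G u e m\<bar> \<le> \<bar>restr G u e t\<bar>"
    using continuous_attains_inf[of "{c..d}" "\<lambda>t. \<bar>restr G u e t\<bar>"] cd by auto
  then show ?thesis using that[of c d "\<bar>restr G u e m\<bar>"] cd sub nz[of m] by auto
qed

end

section \<open>Negative directions\<close>

lemma sum_power2_orthogonal: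
  fixes f :: "'a \<Rightarrow> real"
  assumes "finite I" "\<And>i j. i \<in> I \<Longrightarrow> j \<in> I \<Longrightarrow> i \<noteq> j \<Longrightarrow> f i * f j = 0"
  shows "(\<Sum>i\<in>I. f i)\<^sup>2 = (\<Sum>i\<in>I. (f i)\<^sup>2)"
  using assms
proof (induction I rule: finite_induct)
  case (insert i I)
  have "f i * (\<Sum>j\<in>I. f j) = 0"
    unfolding sum_distrib_left using insert by (intro sum.neutral) auto
  moreover have "(\<Sum>j\<in>I. f j)\<^sup>2 = (\<Sum>j\<in>I. (f j)\<^sup>2)" using insert by auto
  ultimately show ?case using insert(1,2) by (simp add: power2_sum)
qed simp

lemma sum_fun_apply: "(\<Sum>i\<in>I. f i) x = (\<Sum>i\<in>I. f i x)"
  by (induction I rule: infinite_finite_induct) auto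

context graph_solution
begin

text \<open>Besides \<open>\<phi>\<close>, also the derivative \<open>k\<close> is confined to
  \<open>Z\<close>, so for distinct zones the products of derivatives vanish at every point.\<close>

lemma nodal_zone_test_function:
  assumes Z: "Z \<in> nodal_zones G u" and nn: "\<not> graph_null G (Z - {x \<in> points G. \<rho> x = 0})"
  obtains \<phi> k where "test_pair G \<phi> k" "\<And>x. \<phi> x \<noteq> 0 \<Longrightarrow> x \<in> Z"
    "\<And>e t. k e t \<noteq> 0 \<Longrightarrow> par G e t \<in> Z" "quadratic_form G W \<rho> p lam u \<phi> < 0"
proof -
  obtain e0 where e0: "e0 \<in> edges G"
    and N': "{x \<in> edge_dom G e0. par G e0 x \<in> Z - {x \<in> points G. \<rho> x = 0}} \<notin> null_sets lebesgue"
    using nn unfolding graph_null_def by blast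
  define N where "N = {x \<in> edge_dom G e0. par G e0 x \<in> Z - {x \<in> points G. \<rho> x = 0}}"
  have N: "N \<notin> null_sets lebesgue" using N' by (simp add: N_def)
  \<comment> \<open>By the dichotomy the alternative is \<open>\<rho> = 0\<close> almost everywhere
    on \<open>e0\<close>, which would make \<open>N\<close> a null set.\<close>
  have \<rho>a: "AE x in leb e0. restr G \<rho> e0 x \<ge> a"
  proof (rule ccontr)
    assume "\<not> (AE x in leb e0. restr G \<rho> e0 x \<ge> a)"
    then have "AE x in leb e0. restr G \<rho> e0 x = 0" using \<rho>_dichotomy[OF e0] by blast
    then have "AE x in lebesgue. x \<in> edge_dom G e0 \<longrightarrow> restr G \<rho> e0 x = 0"
      by (subst (asm) AE_restrict_space_iff) auto
    then have "AE x in lebesgue. x \<notin> N"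
      by eventually_elim (use par_in_points[OF wf e0] in \<open>auto simp: restr_def N_def\<close>)
    then show False using N by (simp add: completion.AE_iff_null_sets)
  qed
  have "N \<noteq> {}" using N by (metis null_sets.empty_sets)
  then obtain t0 where t0: "t0 \<in> edge_dom G e0" "par G e0 t0 \<in> Z" by (auto simp: N_def)
  have ut0: "restr G u e0 t0 \<noteq> 0"
    using nodal_zone_subset(2)[OF wf Z t0(2)] by (simp add: restr_def)
  obtain c d b where cd: "c < d" "{c..d} \<subseteq> edge_dom G e0" "t0 \<in> {c..d}" "0 < b"
    and b: "\<And>t. t \<in> {c..d} \<Longrightarrow> b \<le> \<bar>restr G u e0 t\<bar>"
    using exists_positive_interval[OF e0 t0(1) ut0] by metis
  \<comment> \<open>\<open>u\<close> has no zero on \<open>[c, d]\<close>, so the whole interval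
    stays in the zone of \<open>t0\<close>.\<close>
  have cdZ: "par G e0 t \<in> Z" if "t \<in> {c..d}" for t
  proof -
    have nz: "restr G u e0 r \<noteq> 0" if "r \<in> {c..d}" for r using b[OF that] cd(4) by auto
    have "t \<in> edge_dom G e0" using that cd(2) by blast
    show ?thesis
    proof (cases "t \<le> t0")
      case True
      then show ?thesis
        using nodal_zone_saturated[OF wf Z e0, of t t0] that t0 cd nz \<open>t \<in> edge_dom G e0\<close> by auto
    next
      case False
      then show ?thesis
        using nodal_zone_saturated[OF wf Z e0, of t0 t] that t0 cd nz \<open>t \<in> edge_dom G e0\<close> by auto
    qed
  qed
  \<comment> \<open>Lower bound for the integrand of the nonlinear term on \<open>[c, d]\<close>:
    there \<open>\<rho> \<ge> a\<close> almost everywhere, \<open>\<bar>u\<bar> \<ge> b\<close>, and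
    \<open>\<bar>\<phi>\<bar> \<ge> b / 2\<close> because the cutoff is at least
    \<open>1 / 2\<close> up to \<open>d\<close>. None of these bounds depends on
    \<open>\<kappa>\<close>, which can therefore be chosen afterwards.\<close>
  define m where "m = a * (b powr (p - 2) * (b / 2)\<^sup>2)"
  define \<delta> where "\<delta> = (p - 2) * (m * (d - c))"
  have m: "0 < m" using a cd by (simp add: m_def)
  have \<delta>: "0 < \<delta>" using m p cd by (simp add: \<delta>_def)
  \<comment> \<open>The full \<open>H1\<close> energy of an edge dominates the integral of
    \<open>u^2\<close>, and its summability is part of \<open>H1\<close>.\<close>
  define E where "E = (\<lambda>e. (LINT x|leb e. (gderiv G u e x)\<^sup>2) + (LINT x|leb e. (restr G u e x)\<^sup>2))"
  define M where "M = infsum E (edges G)"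
  have Enn: "0 \<le> E e" for e unfolding E_def by (intro add_nonneg_nonneg integral_nonneg_AE) auto
  have sumE: "E summable_on edges G" using u by (simp add: H1_def E_def)
  have M: "0 \<le> M" unfolding M_def by (rule infsum_nonneg) (rule Enn)
  \<comment> \<open>Adding 1 to \<open>M\<close> gives \<open>\<kappa>^2 * M < \<delta>\<close>
    strictly and covers the case \<open>M = 0\<close>.\<close>
  define \<kappa> where "\<kappa> = sqrt (\<delta> / (M + 1))"
  have \<kappa>: "0 < \<kappa>" using \<delta> M by (simp add: \<kappa>_def)
  have \<kappa>M: "\<kappa>\<^sup>2 * M < \<delta>"
  proof -
    have "\<kappa>\<^sup>2 * M = \<delta> * (M / (M + 1))" using \<delta> M by (simp add: \<kappa>_def)
    also have "\<dots> < \<delta> * 1" using \<delta> M by (intro mult_strict_left_mono) auto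
    finally show ?thesis by simp
  qed
  have "0 \<le> d" using cd by (auto simp: edge_dom_def)
  then obtain \<eta> d\<eta> where cut: "cutoff G \<kappa> \<eta> d\<eta>"
    and \<eta>half: "\<And>t. t \<in> edge_dom G e0 \<Longrightarrow> t \<le> d \<Longrightarrow> 1 / 2 \<le> restr G \<eta> e0 t"
    using exists_cutoff[OF G e0 \<kappa>] by metis
  define v where "v = (\<lambda>x. indicator Z x * u x)"
  define dv where "dv = (\<lambda>e t. indicator Z (par G e t) * gderiv G u e t)"
  define \<phi> where "\<phi> = (\<lambda>x. \<eta> x * v x)"
  define k where "k = (\<lambda>e t. restr G \<eta> e t * dv e t + restr G v e t * d\<eta> e t)"
  define \<psi> where "\<psi> = (\<lambda>x. \<eta> x * \<phi> x)"
  define l where "l = (\<lambda>e t. restr G \<eta> e t * k e t + restr G \<phi> e t * d\<eta> e t)"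
  have u0: "u x = 0" if "x \<notin> points G" for x using u that by (simp add: H1_def)
  note vz = nodal_zone_restriction[OF wf u Z, folded v_def]
  have tp: "test_pair G \<phi> k"
    unfolding \<phi>_def k_def dv_def
    by (rule test_pair_cutoff[OF wf cut _ vz]) (simp add: v_def u0)
  have tp2: "test_pair G \<psi> l"
    unfolding \<psi>_def l_def
  proof (rule test_pair_cutoff[OF wf cut])
    show "\<phi> x = 0" if "x \<notin> points G" for x using that by (simp add: \<phi>_def v_def u0)
    fix e assume e: "e \<in> edges G"
    show "ac_on (edge_dom G e) (restr G \<phi> e) (k e)" using tp e by (simp add: test_pair_def)
    show "restr G \<phi> e \<in> L2_on (edge_dom G e)" "k e \<in> L2_on (edge_dom G e)"
      using test_pair_edge(2,3)[OF wf tp e] by auto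
  qed
  obtain F' R where F': "finite F'" "\<forall>e\<in>edges G. \<forall>t\<in>edge_dom G e. e \<notin> F' \<or> R < t \<longrightarrow>
        restr G \<eta> e t = 0 \<and> d\<eta> e t = 0"
    using cut unfolding cutoff_def by blast
  \<comment> \<open>\<open>e0\<close> is included so that its contribution is a summand of the
    finite sum.\<close>
  define F where "F = insert e0 (F' \<inter> edges G)"
  have F: "finite F" "F \<subseteq> edges G" "e0 \<in> F" using F'(1) e0 by (auto simp: F_def)
  have out\<eta>: "restr G \<eta> e t = 0" "d\<eta> e t = 0"
    if "e \<in> edges G" "e \<notin> F" "t \<in> edge_dom G e" for e t
    using F'(2) that by (auto simp: F_def)
  have out1: "restr G \<phi> e t = 0 \<and> k e t = 0" if "e \<in> edges G" "e \<notin> F" "t \<in> edge_dom G e" for e t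
    using out\<eta>[OF that] by (simp add: \<phi>_def k_def restr_def)
  have out2: "restr G \<psi> e t = 0 \<and> l e t = 0" if "e \<in> edges G" "e \<notin> F" "t \<in> edge_dom G e" for e t
    using out\<eta>[OF that] by (simp add: \<psi>_def l_def restr_def)
  define S where "S = (\<lambda>e. LINT t|leb e. (restr G v e t * d\<eta> e t)\<^sup>2)"
  define D where "D = (\<lambda>e. LINT t|leb e. restr G \<rho> e t * (pot e t * (restr G \<phi> e t)\<^sup>2))"
  have d\<eta>: "d\<eta> e \<in> borel_measurable (leb e)" "\<And>t. t \<in> edge_dom G e \<Longrightarrow> \<bar>d\<eta> e t\<bar> \<le> \<kappa>"
    if "e \<in> edges G" for e
    using cut that by (auto simp: cutoff_def measurable_restrict_space1 measurable_completion)
  have vd: "(\<lambda>t. restr G v e t * d\<eta> e t) \<in> L2_on (edge_dom G e)" if e: "e \<in> edges G" for e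
    using L2_on_bounded_mult[OF d\<eta>[OF e] vz(2)[OF e]] by (simp add: mult.commute)
  have form: "edge_form \<phi> k e =
    (LINT t|leb e. gderiv G u e t * l e t + (restr G W e t + lam) * (restr G u e t * restr G \<psi> e t))
    - (LINT t|leb e. restr G \<rho> e t * (pot e t * (restr G u e t * restr G \<psi> e t))) + S e - (p - 2) * D e"
    if "e \<in> F" for e
    unfolding S_def D_def
    by (rule edge_energy_identity[OF v_def dv_def \<phi>_def k_def \<psi>_def l_def _ tp vd])
      (use that F(2) in auto)
  have "quadratic_form G W \<rho> p lam u \<phi> = (\<Sum>e\<in>F. edge_form \<phi> k e)"
    by (rule quadratic_form_test_pair[OF tp F(1,2) out1])
  \<comment> \<open>The equation tested with \<open>\<psi>\<close> removes all terms except the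
    cutoff error and the nonlinear remainder.\<close>
  also have "\<dots> = (\<Sum>e\<in>F. S e) - (p - 2) * (\<Sum>e\<in>F. D e)"
    using weak_solution_test_pair[OF tp2 F(1,2) out2]
    by (simp add: form sum.distrib sum_subtractf sum_distrib_left)
  finally have Q: "quadratic_form G W \<rho> p lam u \<phi> = (\<Sum>e\<in>F. S e) - (p - 2) * (\<Sum>e\<in>F. D e)" .
  have S: "(\<Sum>e\<in>F. S e) \<le> \<kappa>\<^sup>2 * M"
  proof -
    have "S e \<le> \<kappa>\<^sup>2 * E e" if e: "e \<in> F" for e
    proof -
      have eE: "e \<in> edges G" using e F by blast
      have iu: "integrable (leb e) (\<lambda>t. (restr G u e t)\<^sup>2)"
        using H1_edge(2)[OF wf u eE] by (simp add: L2_on_def)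
      have "S e \<le> (LINT t|leb e. \<kappa>\<^sup>2 * (restr G u e t)\<^sup>2)"
        unfolding S_def
      proof (rule integral_mono_AE)
        show "integrable (leb e) (\<lambda>t. (restr G v e t * d\<eta> e t)\<^sup>2)"
          using vd[OF eE] by (simp add: L2_on_def)
        show "integrable (leb e) (\<lambda>t. \<kappa>\<^sup>2 * (restr G u e t)\<^sup>2)" using iu by simp
        show "AE t in leb e. (restr G v e t * d\<eta> e t)\<^sup>2 \<le> \<kappa>\<^sup>2 * (restr G u e t)\<^sup>2"
        proof (rule AE_I2)
          fix t assume "t \<in> space (leb e)"
          then have "\<bar>d\<eta> e t\<bar> \<le> \<bar>\<kappa>\<bar>" using d\<eta>(2)[OF eE] \<kappa> by simp
          then have "(d\<eta> e t)\<^sup>2 \<le> \<kappa>\<^sup>2" by (simp add: abs_le_square_iff)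
          moreover have "(restr G v e t)\<^sup>2 \<le> (restr G u e t)\<^sup>2"
            by (simp add: restr_def v_def indicator_def)
          ultimately have "(restr G v e t)\<^sup>2 * (d\<eta> e t)\<^sup>2 \<le> (restr G u e t)\<^sup>2 * \<kappa>\<^sup>2"
            by (intro mult_mono) auto
          then show "(restr G v e t * d\<eta> e t)\<^sup>2 \<le> \<kappa>\<^sup>2 * (restr G u e t)\<^sup>2"
            by (simp add: power_mult_distrib mult.commute)
        qed
      qed
      also have "\<dots> = \<kappa>\<^sup>2 * (LINT t|leb e. (restr G u e t)\<^sup>2)" by simp
      also have "\<dots> \<le> \<kappa>\<^sup>2 * E e"
        unfolding E_def by (intro mult_left_mono) (auto intro: integral_nonneg_AE)
      finally show ?thesis .
    qed
    then have "(\<Sum>e\<in>F. S e) \<le> (\<Sum>e\<in>F. \<kappa>\<^sup>2 * E e)" by (rule sum_mono)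
    also have "\<dots> = \<kappa>\<^sup>2 * (\<Sum>e\<in>F. E e)" by (simp add: sum_distrib_left)
    also have "(\<Sum>e\<in>F. E e) \<le> M"
      unfolding M_def by (rule finite_sum_le_infsum[OF sumE F(1,2)]) (rule Enn)
    finally show ?thesis by (simp add: mult_left_mono)
  qed
  have D: "m * (d - c) \<le> (\<Sum>e\<in>F. D e)"
  proof -
    \<comment> \<open>Since \<open>\<rho>\<close> is nonnegative almost everywhere, no edge can
      spoil the lower bound obtained on \<open>e0\<close>.\<close>
    have "0 \<le> D e" if "e \<in> F" for e
    proof -
      have "e \<in> edges G" using that F by blast
      from \<rho>_nonneg[OF this] have "AE t in leb e. 0 \<le> restr G \<rho> e t * (pot e t * (restr G \<phi> e t)\<^sup>2)"
        by eventually_elim simp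
      then show ?thesis unfolding D_def by (rule integral_nonneg_AE)
    qed
    then have "D e0 \<le> (\<Sum>e\<in>F. D e)" by (intro member_le_sum F) auto
    moreover have "m * (d - c) \<le> D e0"
    proof -
      have ind: "(\<lambda>t. m * indicator {c..d} t) absolutely_integrable_on {c..d}"
      proof (rule absolutely_integrable_spike[where f = "\<lambda>t. m" and S = "{}"])
        show "(\<lambda>t. m) absolutely_integrable_on {c..d}"
          by (intro absolutely_integrable_continuous_real continuous_intros)
      qed auto
      have z: "m * indicator {c..d} t = 0" if "t \<notin> {c..d}" for t using that by simp
      have "m * (d - c) = integral {c..d} (\<lambda>t. m)" using cd(1) by simp
      also have "\<dots> = integral {c..d} (\<lambda>t. m * indicator {c..d} t)"
        by (rule integral_cong) simp
      also have "\<dots> = (LINT t|leb e0. m * indicator {c..d} t)"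
        by (rule lebesgue_on_supported(2)[OF _ cd(2) z ind, symmetric]) simp
      also have "\<dots> \<le> D e0"
        unfolding D_def
      proof (rule integral_mono_AE)
        show "integrable (leb e0) (\<lambda>t. m * indicator {c..d} t)"
          by (rule lebesgue_on_supported(1)[OF _ cd(2) z ind]) simp
        obtain R where R: "\<And>t. t \<in> edge_dom G e0 \<Longrightarrow> R < t \<Longrightarrow> restr G \<phi> e0 t = 0"
          using test_pair_support[OF tp] e0 by metis
        show "integrable (leb e0) (\<lambda>t. restr G \<rho> e0 t * (pot e0 t * (restr G \<phi> e0 t)\<^sup>2))"
          by (rule integrable_\<rho>_edge[OF e0, where R = R])
            (use R test_pair_edge(1)[OF wf tp e0] in \<open>auto intro: continuous_intros\<close>)
        have *: "m * indicator {c..d} t \<le> restr G \<rho> e0 t * (pot e0 t * (restr G \<phi> e0 t)\<^sup>2)"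
          if "restr G \<rho> e0 t \<ge> a" for t
        proof (cases "t \<in> {c..d}")
          case True
          have "b powr (p - 2) \<le> pot e0 t" using b[OF True] cd(4) p by (intro powr_mono2) auto
          moreover have "(b / 2)\<^sup>2 \<le> (restr G \<phi> e0 t)\<^sup>2"
          proof -
            have \<eta>: "1 / 2 \<le> restr G \<eta> e0 t" using \<eta>half[of t] True cd(2) by auto
            have "restr G \<phi> e0 t = restr G \<eta> e0 t * restr G u e0 t"
              using cdZ[OF True] by (simp add: \<phi>_def v_def restr_def)
            then have "1 / 2 * b \<le> \<bar>restr G \<phi> e0 t\<bar>"
              using mult_mono[OF \<eta> b[OF True]] \<eta> cd(4) by (simp add: abs_mult)
            then have "\<bar>b / 2\<bar> \<le> \<bar>restr G \<phi> e0 t\<bar>" using cd(4) by simp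
            then show ?thesis by (simp only: abs_le_square_iff)
          qed
          ultimately have "b powr (p - 2) * (b / 2)\<^sup>2 \<le> pot e0 t * (restr G \<phi> e0 t)\<^sup>2"
            by (intro mult_mono) auto
          then have "m \<le> restr G \<rho> e0 t * (pot e0 t * (restr G \<phi> e0 t)\<^sup>2)"
            unfolding m_def by (rule mult_mono[OF that]) (use that a in auto)
          then show ?thesis using True by simp
        qed (use that a in simp)
        show "AE t in leb e0. m * indicator {c..d} t \<le> restr G \<rho> e0 t * (pot e0 t * (restr G \<phi> e0 t)\<^sup>2)"
          using \<rho>a by eventually_elim (rule *)
      qed
      finally show ?thesis .
    qed
    ultimately show ?thesis by linarith
  qed
  have "(p - 2) * (m * (d - c)) \<le> (p - 2) * (\<Sum>e\<in>F. D e)"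
    using D p by (intro mult_left_mono) auto
  then have "quadratic_form G W \<rho> p lam u \<phi> < 0"
    using Q S \<kappa>M by (simp add: \<delta>_def)
  moreover have "x \<in> Z" if "\<phi> x \<noteq> 0" for x
    using that by (auto simp: \<phi>_def v_def indicator_def split: if_splits)
  moreover have "par G e t \<in> Z" if "k e t \<noteq> 0" for e t
  proof (rule ccontr)
    assume "par G e t \<notin> Z"
    then have "k e t = 0" by (simp add: k_def v_def dv_def restr_def)
    then show False using that by simp
  qed
  ultimately show ?thesis using that tp by blast
qed

text \<open>Pointwise orthogonality of functions and of derivatives removes all mixed terms under
  the integrals, so the form is diagonal in the coefficients.\<close>

lemma edge_form_sum:
  assumes I: "finite I" and tp: "\<And>i. i \<in> I \<Longrightarrow> test_pair G (\<phi> i) (k i)" and e: "e \<in> edges G"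
    and disj: "\<And>i j t. i \<in> I \<Longrightarrow> j \<in> I \<Longrightarrow> i \<noteq> j \<Longrightarrow> t \<in> edge_dom G e \<Longrightarrow>
      restr G (\<phi> i) e t * restr G (\<phi> j) e t = 0 \<and> k i e t * k j e t = 0"
  shows "edge_form (\<lambda>x. \<Sum>i\<in>I. c i * \<phi> i x) (\<lambda>e t. \<Sum>i\<in>I. c i * k i e t) e =
    (\<Sum>i\<in>I. (c i)\<^sup>2 * edge_form (\<phi> i) (k i) e)"
proof -
  have 1: "(\<Sum>i\<in>I. c i * k i e t)\<^sup>2 = (\<Sum>i\<in>I. (c i)\<^sup>2 * (k i e t)\<^sup>2)" if "t \<in> edge_dom G e" for t
    using disj[OF _ _ _ that] by (subst sum_power2_orthogonal[OF I]) (auto simp: power_mult_distrib)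
  have 2: "(restr G (\<lambda>x. \<Sum>i\<in>I. c i * \<phi> i x) e t)\<^sup>2 = (\<Sum>i\<in>I. (c i)\<^sup>2 * (restr G (\<phi> i) e t)\<^sup>2)"
    if "t \<in> edge_dom G e" for t
    using disj[OF _ _ _ that] unfolding restr_def
    by (subst sum_power2_orthogonal[OF I]) (auto simp: power_mult_distrib)
  have i0: "integrable (leb e) (\<lambda>t. (k i e t)\<^sup>2)"
    and i1: "integrable (leb e) (\<lambda>t. (restr G W e t + lam) * (restr G (\<phi> i) e t)\<^sup>2)"
    and i2: "integrable (leb e) (\<lambda>t. restr G \<rho> e t * (pot e t * (restr G (\<phi> i) e t)\<^sup>2))"
    if i: "i \<in> I" for i
  proof -
    note t = test_pair_edge[OF wf tp[OF i] e]
    obtain R where "\<And>t. t \<in> edge_dom G e \<Longrightarrow> R < t \<Longrightarrow> restr G (\<phi> i) e t = 0"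
      using test_pair_support[OF tp[OF i]] e by metis
    then have R: "(restr G (\<phi> i) e t)\<^sup>2 = 0" if "t \<in> edge_dom G e" "R < t" for t using that by simp
    have c: "continuous_on (edge_dom G e) (\<lambda>t. (restr G (\<phi> i) e t)\<^sup>2)"
      by (intro continuous_intros t(1))
    show "integrable (leb e) (\<lambda>t. (k i e t)\<^sup>2)" using t(3) by (simp add: L2_on_def)
    show "integrable (leb e) (\<lambda>t. (restr G W e t + lam) * (restr G (\<phi> i) e t)\<^sup>2)"
      by (rule integrable_W_edge[OF e c R])
    show "integrable (leb e) (\<lambda>t. restr G \<rho> e t * (pot e t * (restr G (\<phi> i) e t)\<^sup>2))"
      by (rule integrable_\<rho>_edge[OF e c R])
  qed
  have "(LINT t|leb e. (\<Sum>i\<in>I. c i * k i e t)\<^sup>2) = (LINT t|leb e. (\<Sum>i\<in>I. (c i)\<^sup>2 * (k i e t)\<^sup>2))"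
    by (rule Bochner_Integration.integral_cong) (simp_all add: 1)
  also have "\<dots> = (\<Sum>i\<in>I. (c i)\<^sup>2 * (LINT t|leb e. (k i e t)\<^sup>2))"
    using i0 by simp
  finally have e0: "(LINT t|leb e. (\<Sum>i\<in>I. c i * k i e t)\<^sup>2) = (\<Sum>i\<in>I. (c i)\<^sup>2 * (LINT t|leb e. (k i e t)\<^sup>2))" .
  have "(LINT t|leb e. (restr G W e t + lam) * (restr G (\<lambda>x. \<Sum>i\<in>I. c i * \<phi> i x) e t)\<^sup>2) =
      (LINT t|leb e. (\<Sum>i\<in>I. (c i)\<^sup>2 * ((restr G W e t + lam) * (restr G (\<phi> i) e t)\<^sup>2)))"
    by (rule Bochner_Integration.integral_cong) (simp_all add: 2 sum_distrib_left mult.left_commute)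
  also have "\<dots> = (\<Sum>i\<in>I. (c i)\<^sup>2 * (LINT t|leb e. (restr G W e t + lam) * (restr G (\<phi> i) e t)\<^sup>2))"
    using i1 by simp
  finally have e1: "(LINT t|leb e. (restr G W e t + lam) * (restr G (\<lambda>x. \<Sum>i\<in>I. c i * \<phi> i x) e t)\<^sup>2) =
    (\<Sum>i\<in>I. (c i)\<^sup>2 * (LINT t|leb e. (restr G W e t + lam) * (restr G (\<phi> i) e t)\<^sup>2))" .
  have "(LINT t|leb e. restr G \<rho> e t * (pot e t * (restr G (\<lambda>x. \<Sum>i\<in>I. c i * \<phi> i x) e t)\<^sup>2)) =
      (LINT t|leb e. (\<Sum>i\<in>I. (c i)\<^sup>2 * (restr G \<rho> e t * (pot e t * (restr G (\<phi> i) e t)\<^sup>2))))"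
    by (rule Bochner_Integration.integral_cong) (simp_all add: 2 sum_distrib_left mult.left_commute)
  also have "\<dots> = (\<Sum>i\<in>I. (c i)\<^sup>2 * (LINT t|leb e. restr G \<rho> e t * (pot e t * (restr G (\<phi> i) e t)\<^sup>2)))"
    using i2 by simp
  finally have e2: "(LINT t|leb e. restr G \<rho> e t * (pot e t * (restr G (\<lambda>x. \<Sum>i\<in>I. c i * \<phi> i x) e t)\<^sup>2)) =
    (\<Sum>i\<in>I. (c i)\<^sup>2 * (LINT t|leb e. restr G \<rho> e t * (pot e t * (restr G (\<phi> i) e t)\<^sup>2)))" .
  show ?thesis
    unfolding edge_form_def e0 e1 e2
    by (simp add: sum_distrib_left sum.distrib sum_subtractf right_diff_distrib distrib_left mult.left_commute)
qed

lemma exists_negative_subspace: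
  assumes I: "finite I" "I \<subseteq> {Z \<in> nodal_zones G u. \<not> graph_null G (Z - {x \<in> points G. \<rho> x = 0})}"
  obtains X where "fun_vs.subspace X" "X \<subseteq> H1 G \<inter> Cc G"
    "\<And>\<phi>. \<phi> \<in> X - {0} \<Longrightarrow> quadratic_form G W \<rho> p lam u \<phi> < 0" "subspace_edim X = enat (card I)"
proof -
  let ?Q = "quadratic_form G W \<rho> p lam u"
  have "\<forall>Z\<in>I. \<exists>\<phi>k. test_pair G (fst \<phi>k) (snd \<phi>k) \<and> (\<forall>x. fst \<phi>k x \<noteq> 0 \<longrightarrow> x \<in> Z) \<and>
      (\<forall>e t. snd \<phi>k e t \<noteq> 0 \<longrightarrow> par G e t \<in> Z) \<and> ?Q (fst \<phi>k) < 0"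
  proof
    fix Z assume "Z \<in> I"
    then have Z: "Z \<in> nodal_zones G u" "\<not> graph_null G (Z - {x \<in> points G. \<rho> x = 0})"
      using I(2) by auto
    obtain \<phi> k where "test_pair G \<phi> k" "\<And>x. \<phi> x \<noteq> 0 \<Longrightarrow> x \<in> Z"
      "\<And>e t. k e t \<noteq> 0 \<Longrightarrow> par G e t \<in> Z" "?Q \<phi> < 0"
      using nodal_zone_test_function[OF Z] by blast
    then show "\<exists>\<phi>k. test_pair G (fst \<phi>k) (snd \<phi>k) \<and> (\<forall>x. fst \<phi>k x \<noteq> 0 \<longrightarrow> x \<in> Z) \<and>
      (\<forall>e t. snd \<phi>k e t \<noteq> 0 \<longrightarrow> par G e t \<in> Z) \<and> ?Q (fst \<phi>k) < 0"
      by (intro exI[of _ "(\<phi>, k)"]) simp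
  qed
  from bchoice[OF this] obtain h where h: "\<forall>Z\<in>I. test_pair G (fst (h Z)) (snd (h Z)) \<and>
      (\<forall>x. fst (h Z) x \<noteq> 0 \<longrightarrow> x \<in> Z) \<and>
      (\<forall>e t. snd (h Z) e t \<noteq> 0 \<longrightarrow> par G e t \<in> Z) \<and> ?Q (fst (h Z)) < 0" by blast
  define \<Phi> K where "\<Phi> = fst \<circ> h" and "K = snd \<circ> h"
  have tp: "test_pair G (\<Phi> Z) (K Z)" and \<Phi>Z: "\<Phi> Z x \<noteq> 0 \<Longrightarrow> x \<in> Z"
    and KZ: "K Z e t \<noteq> 0 \<Longrightarrow> par G e t \<in> Z" and Qneg: "?Q (\<Phi> Z) < 0"
    if "Z \<in> I" for Z x e t
    using h that by (auto simp: \<Phi>_def K_def)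
  have eqZ: "Z = Z'" if "Z \<in> I" "Z' \<in> I" "x \<in> Z" "x \<in> Z'" for Z Z' x
    using nodal_zones_disjoint[OF _ _ that(3,4)] that(1,2) I(2) by auto
  have orth: "\<Phi> Z x * \<Phi> Z' x = 0" "K Z e t * K Z' e t = 0"
    if "Z \<in> I" "Z' \<in> I" "Z \<noteq> Z'" for Z Z' x e t
    using eqZ[OF that(1,2)] that(3) \<Phi>Z[OF that(1)] \<Phi>Z[OF that(2)] KZ[OF that(1)] KZ[OF that(2)]
    by (metis mult_eq_0_iff)+
  have Q0: "?Q (\<lambda>x. 0) = 0"
    using quadratic_form_test_pair[OF test_pair_zero, of "{}"] by (simp add: restr_def)
  have "\<exists>x. \<Phi> Z x \<noteq> 0" if "Z \<in> I" for Z
  proof (rule ccontr)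
    assume "\<nexists>x. \<Phi> Z x \<noteq> 0"
    then have "\<Phi> Z = (\<lambda>x. 0)" by auto
    then show False using Qneg[OF that] Q0 by simp
  qed
  \<comment> \<open>A negative form value excludes \<open>\<Phi> Z = 0\<close>. At
    \<open>pt Z\<close> every other test function vanishes, so evaluation there recovers the
    coefficient of \<open>\<Phi> Z\<close>; injectivity of \<open>\<Phi>\<close> and linear
    independence follow.\<close>
  then obtain pt where pt: "\<And>Z. Z \<in> I \<Longrightarrow> \<Phi> Z (pt Z) \<noteq> 0" by metis
  have pt0: "\<Phi> Z' (pt Z) = 0" if "Z \<in> I" "Z' \<in> I" "Z \<noteq> Z'" for Z Z'
    using orth(1)[OF that, of "pt Z"] pt[OF that(1)] by simp
  have inj: "inj_on \<Phi> I"
    using pt pt0 by (metis inj_onI)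
  define comb where "comb = (\<lambda>c x. \<Sum>Z\<in>I. c Z * \<Phi> Z x)"
  have comb_pt: "comb c (pt Z) = c Z * \<Phi> Z (pt Z)" if "Z \<in> I" for c Z
  proof -
    have "comb c (pt Z) = c Z * \<Phi> Z (pt Z) + (\<Sum>Z'\<in>I - {Z}. c Z' * \<Phi> Z' (pt Z))"
      unfolding comb_def by (rule sum.remove[OF I(1) that])
    also have "(\<Sum>Z'\<in>I - {Z}. c Z' * \<Phi> Z' (pt Z)) = 0"
      using pt0[OF that] by (intro sum.neutral) auto
    finally show ?thesis by simp
  qed
  \<comment> \<open>Linear combinations in the span are indexed by functions; injectivity of
    \<open>\<Phi>\<close> lets the zones serve as indices instead.\<close>
  have reindex: "(\<Sum>\<phi>\<in>\<Phi> ` I. (\<lambda>x. c \<phi> * \<phi> x)) = comb (c \<circ> \<Phi>)" for c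
    by (simp add: sum.reindex[OF inj] fun_eq_iff sum_fun_apply comb_def)
  define X where "X = fun_vs.span (\<Phi> ` I)"
  have XE: "\<exists>c. \<phi> = comb c" if "\<phi> \<in> X" for \<phi>
    using that I(1) by (auto simp: X_def fun_vs.span_finite reindex)
  have indep: "fun_vs.independent (\<Phi> ` I)"
  proof (rule fun_vs.independent_if_scalars_zero)
    show "finite (\<Phi> ` I)" using I(1) by simp
    fix c \<phi> assume 0: "(\<Sum>\<phi>\<in>\<Phi> ` I. (\<lambda>x. c \<phi> * \<phi> x)) = 0" and "\<phi> \<in> \<Phi> ` I"
    then obtain Z where Z: "Z \<in> I" "\<phi> = \<Phi> Z" by blast
    have "comb (c \<circ> \<Phi>) (pt Z) = 0" using 0 unfolding reindex by simp
    then show "c \<phi> = 0" using comb_pt[OF Z(1), of "c \<circ> \<Phi>"] pt[OF Z(1)] Z(2) by simp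
  qed
  have tpc: "test_pair G (comb c) (\<lambda>e t. \<Sum>Z\<in>I. c Z * K Z e t)" for c
    unfolding comb_def by (rule test_pair_sum[OF I(1) tp])
  have Qc: "?Q (comb c) = (\<Sum>Z\<in>I. (c Z)\<^sup>2 * ?Q (\<Phi> Z))" for c
  proof -
    have "\<forall>Z\<in>I. \<exists>F. finite F \<and> F \<subseteq> edges G \<and> (\<forall>e\<in>edges G. \<forall>t\<in>edge_dom G e. e \<notin> F \<longrightarrow>
        restr G (\<Phi> Z) e t = 0 \<and> K Z e t = 0)"
    proof
      fix Z assume "Z \<in> I"
      from test_pair_support[OF tp[OF this]]
      show "\<exists>F. finite F \<and> F \<subseteq> edges G \<and> (\<forall>e\<in>edges G. \<forall>t\<in>edge_dom G e. e \<notin> F \<longrightarrow>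
        restr G (\<Phi> Z) e t = 0 \<and> K Z e t = 0)" by metis
    qed
    from bchoice[OF this] obtain FF where FF: "\<forall>Z\<in>I. finite (FF Z) \<and> FF Z \<subseteq> edges G \<and>
        (\<forall>e\<in>edges G. \<forall>t\<in>edge_dom G e. e \<notin> FF Z \<longrightarrow> restr G (\<Phi> Z) e t = 0 \<and> K Z e t = 0)" by blast
    \<comment> \<open>One finite set of edges serving all zones at once allows the sums over edges
      and zones to be exchanged.\<close>
    define F where "F = (\<Union>Z\<in>I. FF Z)"
    have F: "finite F" "F \<subseteq> edges G" using FF I(1) by (auto simp: F_def)
    have out: "restr G (\<Phi> Z) e t = 0 \<and> K Z e t = 0"
      if "Z \<in> I" "e \<in> edges G" "e \<notin> F" "t \<in> edge_dom G e" for Z e t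
      using FF that unfolding F_def by blast
    have "?Q (comb c) = (\<Sum>e\<in>F. edge_form (comb c) (\<lambda>e t. \<Sum>Z\<in>I. c Z * K Z e t) e)"
    proof (rule quadratic_form_test_pair[OF tpc F])
      fix e t assume "e \<in> edges G" "e \<notin> F" "t \<in> edge_dom G e"
      from out[OF _ this] show "restr G (comb c) e t = 0 \<and> (\<Sum>Z\<in>I. c Z * K Z e t) = 0"
        by (auto simp: comb_def restr_def intro!: sum.neutral)
    qed
    also have "\<dots> = (\<Sum>e\<in>F. \<Sum>Z\<in>I. (c Z)\<^sup>2 * edge_form (\<Phi> Z) (K Z) e)"
      unfolding comb_def
      by (intro sum.cong refl edge_form_sum[OF I(1) tp]) (use F(2) orth in \<open>auto simp: restr_def\<close>)
    also have "\<dots> = (\<Sum>Z\<in>I. (c Z)\<^sup>2 * (\<Sum>e\<in>F. edge_form (\<Phi> Z) (K Z) e))"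
      by (subst sum.swap) (simp add: sum_distrib_left)
    also have "\<dots> = (\<Sum>Z\<in>I. (c Z)\<^sup>2 * ?Q (\<Phi> Z))"
      by (intro sum.cong refl arg_cong2[where f = "(*)"]
          quadratic_form_test_pair[OF tp F, symmetric] out) auto
    finally show ?thesis .
  qed
  show ?thesis
  proof (rule that[of X])
    show "fun_vs.subspace X" by (simp add: X_def)
    show "X \<subseteq> H1 G \<inter> Cc G"
      using XE test_pair_H1[OF wf tpc] test_pair_Cc[OF wf tpc] by blast
    have "\<exists>B. finite B \<and> X \<subseteq> fun_vs.span B" using I(1) by (auto simp: X_def)
    then show "subspace_edim X = enat (card I)"
      using fun_vs.dim_span_eq_card_independent[OF indep] card_image[OF inj]
      by (simp add: subspace_edim_def X_def)
    fix \<phi> assume \<phi>: "\<phi> \<in> X - {0}"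
    then obtain c where c: "\<phi> = comb c" using XE by auto
    have "\<exists>Z\<in>I. c Z \<noteq> 0"
    proof (rule ccontr)
      assume "\<not> (\<exists>Z\<in>I. c Z \<noteq> 0)"
      then have "comb c = 0" by (auto simp: comb_def fun_eq_iff)
      then show False using \<phi> c by simp
    qed
    then obtain Z where Z: "Z \<in> I" "c Z \<noteq> 0" by blast
    have "?Q \<phi> = (c Z)\<^sup>2 * ?Q (\<Phi> Z) + (\<Sum>Z\<in>I - {Z}. (c Z)\<^sup>2 * ?Q (\<Phi> Z))"
      unfolding c Qc by (rule sum.remove[OF I(1) Z(1)])
    moreover have "(c Z)\<^sup>2 * ?Q (\<Phi> Z) < 0"
      using Z Qneg by (simp add: mult_pos_neg)
    moreover have "(\<Sum>Z\<in>I - {Z}. (c Z)\<^sup>2 * ?Q (\<Phi> Z)) \<le> 0"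
      using Qneg by (intro sum_nonpos mult_nonneg_nonpos) (auto intro: less_imp_le)
    ultimately show "?Q \<phi> < 0" by linarith
  qed
qed

lemma enat_card_le_morse_index:
  assumes "finite I" "I \<subseteq> {Z \<in> nodal_zones G u. \<not> graph_null G (Z - {x \<in> points G. \<rho> x = 0})}"
  shows "enat (card I) \<le> morse_index G W \<rho> p lam u"
proof -
  obtain X where X: "fun_vs.subspace X" "X \<subseteq> H1 G \<inter> Cc G"
    "\<And>\<phi>. \<phi> \<in> X - {0} \<Longrightarrow> quadratic_form G W \<rho> p lam u \<phi> < 0" "subspace_edim X = enat (card I)"
    using exists_negative_subspace[OF assms] by metis
  have "subspace_edim X \<le> morse_index G W \<rho> p lam u"
    unfolding morse_index_def using X(1-3) by (intro Sup_upper imageI) blast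
  then show ?thesis by (simp add: X(4))
qed

text \<open>With infinitely many zones there are finite subfamilies of every size \<open>n\<close>,
  so the index exceeds all finite values.\<close>

lemma ecard_le_morse_index:
  "ecard {Z \<in> nodal_zones G u. \<not> graph_null G (Z - {x \<in> points G. \<rho> x = 0})} \<le> morse_index G W \<rho> p lam u"
  (is "ecard ?S \<le> ?m")
proof (cases "finite ?S")
  case True
  then show ?thesis using enat_card_le_morse_index[OF True] by (simp add: ecard_def)
next
  case False
  have "enat n \<le> ?m" for n
  proof -
    obtain I where I: "finite I" "card I = n" "I \<subseteq> ?S"
      using infinite_arbitrarily_large[OF False, of n] by (elim exE conjE)
    show ?thesis using enat_card_le_morse_index[OF I(1,3)] I(2) by simp
  qed
  then have "?m = \<infinity>" by (metis Suc_n_not_le_n enat_ord_simps(1) not_infinity_eq)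
  then show ?thesis by (simp only: top_greatest top_enat_def[symmetric])
qed

end

theorem proposition4p1:
  fixes G :: "('v, 'e) metric_graph"
    and W \<rho> u :: "('v, 'e) gpoint \<Rightarrow> real"
    and p lam :: real
  assumes "graph_class_G G"
    and "p > 2"
    and "W \<in> Linf G"
    and "\<rho> \<in> Linf G"
    and "\<not> (\<forall>e\<in>edges G. AE x in lebesgue_on (edge_dom G e). restr G \<rho> e x = 0)"
    and "\<exists>a>0. \<forall>e\<in>edges G.
           (AE x in lebesgue_on (edge_dom G e). restr G \<rho> e x \<ge> a) \<or>
           (AE x in lebesgue_on (edge_dom G e). restr G \<rho> e x = 0)"
    and "u \<in> H1 G"
    and "weak_solution G W \<rho> p lam u"
  shows "morse_index G W \<rho> p lam u \<ge>
           ecard {Z \<in> nodal_zones G u. \<not> graph_null G (Z - {x \<in> points G. \<rho> x = 0})}"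
proof -
  obtain a where a: "a > 0" "\<forall>e\<in>edges G.
           (AE x in lebesgue_on (edge_dom G e). restr G \<rho> e x \<ge> a) \<or>
           (AE x in lebesgue_on (edge_dom G e). restr G \<rho> e x = 0)"
    using assms(6) by blast
  interpret graph_solution G W \<rho> u p lam a
    by unfold_locales (use assms a in auto)
  show ?thesis by (rule ecard_le_morse_index)
qed

end
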